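(* Let $n\ge m\ge1$ be integers. Consider the representation $\tau$ of $H=SO(n,m)$ given by $\tau(h)f(\eta)=J_{h^{-1}}(\eta)^{\beta}f(h^{-1}\eta)$, $\beta=\frac{n-2}{n+m}$. On the space of continuous functions on $Y$, it is equivalent to the representation $\mathrm{Ind}_P^H(1\otimes\exp(i\lambda+\rho)\otimes1)$, where $P$ is the minimal parabolic subgroup defined by the maximal abelian subspace $\mathfrak{a}\subset\mathfrak{p}$, and $\lambda\in(\mathfrak{a}^{\mathbb{C}})^*$ is defined by $$-(i\lambda+\rho)|_{\mathfrak{a}_0}=-\frac{2(n-2)}{n-1}\rho_0,\qquad -(i\lambda+\rho)|_{\mathfrak{a}_0^\perp}=0.$$ In fact, when the continuous functions on $Y$ are identified with right $L\cap M_0$-invariant functions on $L$, they can be extended to functions on $H$ in such a way that the two representations are equal in this setting.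
   Context: $H=SO(n,m)$ is the group of real $(n+m)\times(n+m)$ matrices of determinant one preserving the form $u_1v_1+\dots+u_nv_n-u_{n+1}v_{n+1}-\dots-u_{n+m}v_{n+m}$, with Lie algebra $\mathfrak{h}$. It acts on $Y=\{v\in M_{nm}(\mathbb{R}):v^tv=I_m\}$ by $h(v)=(Av+B)(Cv+D)^{-1}$ for $h=\begin{pmatrix}A&B\\C&D\end{pmatrix}$, $A$ of size $n\times n$. $J_h(v)=\det(Cv+D)^{-(n+m)}$ is the complex Jacobian of $h$ at $v$, and $J_h(v)^s=|\det(Cv+D)|^{-s(n+m)}$ for $v\in Y$. $L=S(O(n)\times O(m))$ is the block diagonal subgroup of $H$. Let $E_j$ ($1\le j\le m$) be the symmetric matrix with entries $1$ at positions $(j,n+j)$ and $(n+j,j)$ and zeros elsewhere. $\mathfrak{a}=\sum_{j=1}^m\mathbb{R}E_j$, with dual basis $E_j^*$, is a maximal abelian subspace of the space $\mathfrak p$ of Hermitian matrices in $\mathfrak{su}(n,m)$ (and of the space of symmetric matrices in $\mathfrak{h}$). The positive restricted roots are $E_j^*\pm E_i^*$ ($j>i$) and $E_j^*$; $\rho$ is half the sum of the positive restricted roots with multiplicities, $\mathfrak{n}$ the sum of their root spaces, and $P=MAN$ the corresponding minimal parabolic subgroup of $H$, $A=\exp\mathfrak{a}$. $\mathfrak{a}_0=\mathbb{R}(E_1+\dots+E_m)$, and $\mathfrak{a}_0^\perp=\{\sum t_jE_j:\sum t_j=0\}$ is its orthogonal complement in $\mathfrak{a}$ for the Killing form. $P_0=M_0A_0N_0\supset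 P$ is the maximal parabolic subgroup defined by $\mathfrak{a}_0$ with its Langlands decomposition, where $\mathfrak{n}_0$ is the sum of the root spaces for $E_j^*+E_i^*$ ($j>i$) and $E_j^*$; $\rho_0$ is half the sum, with multiplicities, of the restrictions of these roots to $\mathfrak{a}_0$, so that $2\rho_0(t(E_1+\dots+E_m))=m(n-1)t$. $Y$ is regarded as the homogeneous space $Y=H/P_0=L/(L\cap M_0)$ with base point $\begin{pmatrix}I_m\\0\end{pmatrix}$. $\mathrm{Ind}_P^H(1\otimes\exp(i\lambda+\rho)\otimes1)$ is the action of $H$ by left translation, $F\mapsto F(h^{-1}\,\cdot)$, on continuous functions $F:H\to\mathbb{C}$ with $F(xman)=e^{-(i\lambda+\rho)(\log a)}F(x)$ for $x\in H$, $man\in MAN$.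
   Formalization: n = 1 is excluded (λ undefined). Y is the H-orbit of the base point: all of {v : v^t v = I_m} if n > m, one component of O(n) if n = m. Equivalence is with the subspace of Ind whose restrictions to L are right L∩M_0-invariant; for m ≥ 2 it fails for all of Ind. *)

theory Defs
  imports "HOL-Analysis.Analysis"
begin

text \<open>
  Conventions. The sizes \<open>n\<close> and \<open>m\<close> are \<open>CARD('n)\<close> and \<open>CARD('m)\<close>; an \<open>(n+m) \<times> (n+m)\<close> matrix
  is indexed by the sum type \<open>'n + 'm\<close>, so that \<open>Inl\<close> indexes the first \<open>n\<close> coordinates and \<open>Inr\<close>
  the last \<open>m\<close>. The inequality \<open>n \<ge> m\<close> is witnessed by an injection \<open>\<iota> :: 'm \<Rightarrow> 'n\<close>, which
  replaces the inclusion of \<open>{1..m}\<close> in \<open>{1..n}\<close>: position \<open>(j, n+j)\<close> is \<open>(Inl (\<iota> j), Inr j)\<close>.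
\<close>

subsection \<open>The group, its Lie algebra, and the action\<close>

definition form :: "real ^ ('n::finite + 'm::finite) \<Rightarrow> real ^ ('n + 'm) \<Rightarrow> real" where
  "form u v = (\<Sum>i\<in>UNIV. u $ Inl i * v $ Inl i) - (\<Sum>j\<in>UNIV. u $ Inr j * v $ Inr j)"

definition SO_nm :: "(real ^ ('n::finite + 'm::finite) ^ ('n + 'm)) set" where
  "SO_nm = {h. det h = 1 \<and> (\<forall>u v. form (h *v u) (h *v v) = form u v)}"

definition so_nm :: "(real ^ ('n::finite + 'm::finite) ^ ('n + 'm)) set" where
  "so_nm = {X. \<forall>u v. form (X *v u) v + form u (X *v v) = 0}"

definition blockA :: "real ^ ('n::finite + 'm::finite) ^ ('n + 'm) \<Rightarrow> real ^ 'n ^ 'n" where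
  "blockA h = (\<chi> i j. h $ Inl i $ Inl j)"

definition blockB :: "real ^ ('n::finite + 'm::finite) ^ ('n + 'm) \<Rightarrow> real ^ 'm ^ 'n" where
  "blockB h = (\<chi> i j. h $ Inl i $ Inr j)"

definition blockC :: "real ^ ('n::finite + 'm::finite) ^ ('n + 'm) \<Rightarrow> real ^ 'n ^ 'm" where
  "blockC h = (\<chi> i j. h $ Inr i $ Inl j)"

definition blockD :: "real ^ ('n::finite + 'm::finite) ^ ('n + 'm) \<Rightarrow> real ^ 'm ^ 'm" where
  "blockD h = (\<chi> i j. h $ Inr i $ Inr j)"

definition Lgrp :: "(real ^ ('n::finite + 'm::finite) ^ ('n + 'm)) set" where
  "Lgrp = {h \<in> SO_nm. blockB h = 0 \<and> blockC h = 0}"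

definition stiefel :: "(real ^ 'm::finite ^ 'n::finite) set" where
  "stiefel = {v. transpose v ** v = mat 1}"

definition act :: "real ^ ('n::finite + 'm::finite) ^ ('n + 'm) \<Rightarrow> real ^ 'm ^ 'n \<Rightarrow> real ^ 'm ^ 'n" where
  "act h v = (blockA h ** v + blockB h) ** matrix_inv (blockC h ** v + blockD h)"

text \<open>\<open>Jac_pow h v s\<close> is \<open>J\<^sub>h(v)\<^sup>s\<close>, where \<open>J\<^sub>h(v) = det (Cv + D)\<close> to the power \<open>-(n+m)\<close>.\<close>

definition Jac_pow ::
  "real ^ ('n::finite + 'm::finite) ^ ('n + 'm) \<Rightarrow> real ^ 'm ^ 'n \<Rightarrow> real \<Rightarrow> real" where
  "Jac_pow h v s =
     \<bar>det (blockC h ** v + blockD h)\<bar> powr (- s * (real CARD('n) + real CARD('m)))"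

definition base_point :: "('m::finite \<Rightarrow> 'n::finite) \<Rightarrow> real ^ 'm ^ 'n" where
  "base_point \<iota> = (\<chi> i j. if i = \<iota> j then 1 else 0)"

text \<open>
  \<open>Y\<close> as a homogeneous space of \<open>H\<close>: the orbit of the base point. It is all of \<open>stiefel\<close> if
  \<open>n > m\<close>. If \<open>n = m\<close> then \<open>stiefel\<close> is \<open>O(n)\<close>, on which \<open>H\<close> is not transitive (it preserves the
  sign of the determinant), and the orbit is the component of the base point.
\<close>

definition Yhom :: "('m::finite \<Rightarrow> 'n::finite) \<Rightarrow> (real ^ 'm ^ 'n) set" where
  "Yhom \<iota> = {act h (base_point \<iota>) | h. h \<in> SO_nm}"

subsection \<open>Restricted roots and parabolic subgroups\<close>

definition mexp :: "real ^ 'k::finite ^ 'k \<Rightarrow> real ^ 'k ^ 'k" where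
  "mexp X = (\<Sum>k. (1 / fact k) *\<^sub>R (((**) X ^^ k) (mat 1)))"

definition Emat :: "('m::finite \<Rightarrow> 'n::finite) \<Rightarrow> 'm \<Rightarrow> real ^ ('n + 'm) ^ ('n + 'm)" where
  "Emat \<iota> j = (\<chi> p q. if (p = Inl (\<iota> j) \<and> q = Inr j) \<or> (p = Inr j \<and> q = Inl (\<iota> j)) then 1 else 0)"

definition afrak :: "('m::finite \<Rightarrow> 'n::finite) \<Rightarrow> (real ^ ('n + 'm) ^ ('n + 'm)) set" where
  "afrak \<iota> = {\<Sum>j\<in>UNIV. t j *\<^sub>R Emat \<iota> j | t. True}"

definition afrak0 :: "('m::finite \<Rightarrow> 'n::finite) \<Rightarrow> (real ^ ('n + 'm) ^ ('n + 'm)) set" where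
  "afrak0 \<iota> = {t *\<^sub>R (\<Sum>j\<in>UNIV. Emat \<iota> j) | t. True}"

definition afrak0_perp :: "('m::finite \<Rightarrow> 'n::finite) \<Rightarrow> (real ^ ('n + 'm) ^ ('n + 'm)) set" where
  "afrak0_perp \<iota> = {\<Sum>j\<in>UNIV. t j *\<^sub>R Emat \<iota> j | t. (\<Sum>j\<in>UNIV. t j) = 0}"

text \<open>
  The dual basis of \<open>afrak \<iota>\<close>, written as entry functionals on all matrices; these and the roots
  built from them are only ever evaluated on \<open>afrak \<iota>\<close>.
\<close>

definition Edual :: "('m::finite \<Rightarrow> 'n::finite) \<Rightarrow> 'm \<Rightarrow> real ^ ('n + 'm) ^ ('n + 'm) \<Rightarrow> real" where
  "Edual \<iota> j T = T $ Inl (\<iota> j) $ Inr j"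

definition pos_roots ::
  "('m::{finite,linorder} \<Rightarrow> 'n::finite) \<Rightarrow> (real ^ ('n + 'm) ^ ('n + 'm) \<Rightarrow> real) set" where
  "pos_roots \<iota> = {\<lambda>T. Edual \<iota> j T + Edual \<iota> i T | i j. i < j}
     \<union> {\<lambda>T. Edual \<iota> j T - Edual \<iota> i T | i j. i < j} \<union> {Edual \<iota> j | j. True}"

definition pos_roots0 ::
  "('m::{finite,linorder} \<Rightarrow> 'n::finite) \<Rightarrow> (real ^ ('n + 'm) ^ ('n + 'm) \<Rightarrow> real) set" where
  "pos_roots0 \<iota> = {\<lambda>T. Edual \<iota> j T + Edual \<iota> i T | i j. i < j} \<union> {Edual \<iota> j | j. True}"

definition root_space ::
  "('m::finite \<Rightarrow> 'n::finite) \<Rightarrow> (real ^ ('n + 'm) ^ ('n + 'm) \<Rightarrow> real)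
     \<Rightarrow> (real ^ ('n + 'm) ^ ('n + 'm)) set" where
  "root_space \<iota> \<alpha> = {X \<in> so_nm. \<forall>T\<in>afrak \<iota>. T ** X - X ** T = \<alpha> T *\<^sub>R X}"

text \<open>If \<open>n = m\<close>, the functionals \<open>Edual \<iota> j\<close> are not roots; their multiplicity below is then 0.\<close>

definition rho ::
  "('m::{finite,linorder} \<Rightarrow> 'n::finite) \<Rightarrow> real ^ ('n + 'm) ^ ('n + 'm) \<Rightarrow> real" where
  "rho \<iota> T = (1/2) * (\<Sum>\<alpha>\<in>pos_roots \<iota>. real (dim (root_space \<iota> \<alpha>)) * \<alpha> T)"

text \<open>To be evaluated on \<open>afrak0 \<iota>\<close> only.\<close>

definition rho0 ::
  "('m::{finite,linorder} \<Rightarrow> 'n::finite) \<Rightarrow> real ^ ('n + 'm) ^ ('n + 'm) \<Rightarrow> real" where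
  "rho0 \<iota> T = (1/2) * (\<Sum>\<alpha>\<in>pos_roots0 \<iota>. real (dim (root_space \<iota> \<alpha>)) * \<alpha> T)"

definition nfrak ::
  "('m::{finite,linorder} \<Rightarrow> 'n::finite) \<Rightarrow> (real ^ ('n + 'm) ^ ('n + 'm)) set" where
  "nfrak \<iota> = span (\<Union>\<alpha>\<in>pos_roots \<iota>. root_space \<iota> \<alpha>)"

definition Ngrp ::
  "('m::{finite,linorder} \<Rightarrow> 'n::finite) \<Rightarrow> (real ^ ('n + 'm) ^ ('n + 'm)) set" where
  "Ngrp \<iota> = mexp ` nfrak \<iota>"

text \<open>\<open>M\<close>, the centralizer of \<open>\<aa>\<close> in the maximal compact subgroup \<open>L\<close> of \<open>H\<close>.\<close>

definition Mgrp :: "('m::finite \<Rightarrow> 'n::finite) \<Rightarrow> (real ^ ('n + 'm) ^ ('n + 'm)) set" where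
  "Mgrp \<iota> = {l \<in> Lgrp. \<forall>T\<in>afrak \<iota>. l ** T = T ** l}"

text \<open>
  \<open>M\<^sub>0\<close> of the Langlands decomposition: the product of the centralizer of \<open>\<aa>\<^sub>0\<close> in \<open>L\<close> with the
  connected subgroup whose Lie algebra is the orthogonal complement of \<open>\<aa>\<^sub>0\<close> in its centralizer.
  Orthogonality is for the trace form \<open>tr (XY)\<close>, of which the Killing form of \<open>so(n,m)\<close> is the
  multiple by \<open>n + m - 2\<close>. A connected Lie subgroup is generated by the exponentials of its Lie
  algebra, and these are closed under inverses.
\<close>

definition mfrak0 :: "('m::finite \<Rightarrow> 'n::finite) \<Rightarrow> (real ^ ('n + 'm) ^ ('n + 'm)) set" where
  "mfrak0 \<iota> = {X \<in> so_nm. \<forall>T\<in>afrak0 \<iota>. T ** X = X ** T \<and> trace (T ** X) = 0}"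

inductive_set exp_generated :: "(real ^ 'k::finite ^ 'k) set \<Rightarrow> (real ^ 'k ^ 'k) set"
  for V :: "(real ^ 'k ^ 'k) set" where
  one: "mat 1 \<in> exp_generated V"
| mult: "y \<in> exp_generated V \<Longrightarrow> X \<in> V \<Longrightarrow> y ** mexp X \<in> exp_generated V"

definition M0grp :: "('m::finite \<Rightarrow> 'n::finite) \<Rightarrow> (real ^ ('n + 'm) ^ ('n + 'm)) set" where
  "M0grp \<iota> = {l ** y | l y. l \<in> Lgrp \<and> (\<forall>T\<in>afrak0 \<iota>. l ** T = T ** l)
                \<and> y \<in> exp_generated (mfrak0 \<iota>)}"

subsection \<open>Function spaces and representations\<close>

text \<open>
  Continuous functions on a subset \<open>S\<close>, represented by total functions that vanish outside \<open>S\<close>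
  so that equality of functions on \<open>S\<close> is equality in HOL.
\<close>

definition cfun :: "'a::topological_space set \<Rightarrow> ('a \<Rightarrow> complex) set" where
  "cfun S = {f. continuous_on S f \<and> (\<forall>x. x \<notin> S \<longrightarrow> f x = 0)}"

definition is_linear_on :: "('a \<Rightarrow> complex) set \<Rightarrow> (('a \<Rightarrow> complex) \<Rightarrow> ('b \<Rightarrow> complex)) \<Rightarrow> bool" where
  "is_linear_on V T \<longleftrightarrow>
     (\<forall>f\<in>V. \<forall>g\<in>V. \<forall>a b. T (\<lambda>x. a * f x + b * g x) = (\<lambda>y. a * T f y + b * T g y))"

definition is_subspace :: "('a \<Rightarrow> complex) set \<Rightarrow> bool" where
  "is_subspace V \<longleftrightarrow>
     (\<lambda>_. 0) \<in> V \<and> (\<forall>f\<in>V. \<forall>g\<in>V. \<forall>a b. (\<lambda>x. a * f x + b * g x) \<in> V)"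

definition is_rep ::
  "(real ^ 'k::finite ^ 'k) set \<Rightarrow> ('a \<Rightarrow> complex) set
     \<Rightarrow> (real ^ 'k ^ 'k \<Rightarrow> ('a \<Rightarrow> complex) \<Rightarrow> ('a \<Rightarrow> complex)) \<Rightarrow> bool" where
  "is_rep G V \<pi> \<longleftrightarrow> is_subspace V
     \<and> (\<forall>g\<in>G. is_linear_on V (\<pi> g) \<and> (\<forall>f\<in>V. \<pi> g f \<in> V))
     \<and> (\<forall>f\<in>V. \<pi> (mat 1) f = f)
     \<and> (\<forall>g\<in>G. \<forall>h\<in>G. \<forall>f\<in>V. \<pi> (g ** h) f = \<pi> g (\<pi> h f))"

text \<open>
  \<open>T\<close> is a linear intertwining bijection that is a homeomorphism for locally uniform convergence
  (uniform convergence on compact subsets of \<open>S\<close>, respectively \<open>S'\<close>; both topologies are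
  metrizable for the \<open>S\<close>, \<open>S'\<close> used here).
\<close>

definition is_equivalence ::
  "(real ^ 'k::finite ^ 'k) set
     \<Rightarrow> 'a::topological_space set \<Rightarrow> ('a \<Rightarrow> complex) set
     \<Rightarrow> (real ^ 'k ^ 'k \<Rightarrow> ('a \<Rightarrow> complex) \<Rightarrow> ('a \<Rightarrow> complex))
     \<Rightarrow> 'b::topological_space set \<Rightarrow> ('b \<Rightarrow> complex) set
     \<Rightarrow> (real ^ 'k ^ 'k \<Rightarrow> ('b \<Rightarrow> complex) \<Rightarrow> ('b \<Rightarrow> complex))
     \<Rightarrow> (('a \<Rightarrow> complex) \<Rightarrow> ('b \<Rightarrow> complex)) \<Rightarrow> bool" where
  "is_equivalence G S V \<pi> S' W \<sigma> T \<longleftrightarrow>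
     is_linear_on V T \<and> bij_betw T V W
     \<and> (\<forall>g\<in>G. \<forall>f\<in>V. T (\<pi> g f) = \<sigma> g (T f))
     \<and> (\<forall>fs f. (\<forall>k. fs k \<in> V) \<and> f \<in> V \<longrightarrow>
          ((\<forall>K. compact K \<and> K \<subseteq> S \<longrightarrow> uniform_limit K fs f sequentially) \<longleftrightarrow>
           (\<forall>K. compact K \<and> K \<subseteq> S' \<longrightarrow> uniform_limit K (\<lambda>k::nat. T (fs k)) (T f) sequentially)))"

definition tau ::
  "(real ^ 'm::finite ^ 'n::finite) set \<Rightarrow> real ^ ('n + 'm) ^ ('n + 'm)
     \<Rightarrow> (real ^ 'm ^ 'n \<Rightarrow> complex) \<Rightarrow> (real ^ 'm ^ 'n \<Rightarrow> complex)" where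
  "tau Y h f = (\<lambda>\<eta>. if \<eta> \<in> Y
     then of_real (Jac_pow (matrix_inv h) \<eta> ((real CARD('n) - 2) / (real CARD('n) + real CARD('m))))
            * f (act (matrix_inv h) \<eta>)
     else 0)"

text \<open>A complex linear functional on \<open>\<aa>\<^sup>C\<close> is given by its restriction to \<open>\<aa>\<close>, a real linear map.\<close>

definition is_functional_on :: "'v::real_vector set \<Rightarrow> ('v \<Rightarrow> complex) \<Rightarrow> bool" where
  "is_functional_on V lam \<longleftrightarrow>
     (\<forall>S\<in>V. \<forall>T\<in>V. lam (S + T) = lam S + lam T) \<and> (\<forall>c. \<forall>T\<in>V. lam (c *\<^sub>R T) = c *\<^sub>R lam T)"

definition ind_space ::
  "('m::{finite,linorder} \<Rightarrow> 'n::finite) \<Rightarrow> (real ^ ('n + 'm) ^ ('n + 'm) \<Rightarrow> complex)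
     \<Rightarrow> (real ^ ('n + 'm) ^ ('n + 'm) \<Rightarrow> complex) set" where
  "ind_space \<iota> lam = {F \<in> cfun SO_nm.
     \<forall>x\<in>SO_nm. \<forall>k\<in>Mgrp \<iota>. \<forall>T\<in>afrak \<iota>. \<forall>u\<in>Ngrp \<iota>.
       F (x ** k ** mexp T ** u) = exp (- (\<i> * lam T + of_real (rho \<iota> T))) * F x}"

definition left_translate ::
  "real ^ 'k::finite ^ 'k \<Rightarrow> (real ^ 'k ^ 'k \<Rightarrow> complex) \<Rightarrow> (real ^ 'k ^ 'k \<Rightarrow> complex)" where
  "left_translate h F = (\<lambda>x. F (matrix_inv h ** x))"

definition right_inv_on ::
  "(real ^ 'k::finite ^ 'k) set \<Rightarrow> (real ^ 'k ^ 'k) set \<Rightarrow> (real ^ 'k ^ 'k \<Rightarrow> complex) \<Rightarrow> bool" where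
  "right_inv_on G K \<phi> \<longleftrightarrow> (\<forall>l\<in>G. \<forall>k\<in>K. \<phi> (l ** k) = \<phi> l)"

text \<open>Functions on \<open>L\<close> that are right invariant under \<open>L \<inter> M\<^sub>0\<close>.\<close>

definition L_space :: "('m::finite \<Rightarrow> 'n::finite) \<Rightarrow> (real ^ ('n + 'm) ^ ('n + 'm) \<Rightarrow> complex) set" where
  "L_space \<iota> = {\<phi> \<in> cfun Lgrp. right_inv_on Lgrp (Lgrp \<inter> M0grp \<iota>) \<phi>}"

text \<open>
  The members of the induced representation space whose restrictions to \<open>L\<close> have this invariance,
  i.e. correspond to functions on \<open>Y\<close>.
\<close>

definition ind_space_Y ::
  "('m::{finite,linorder} \<Rightarrow> 'n::finite) \<Rightarrow> (real ^ ('n + 'm) ^ ('n + 'm) \<Rightarrow> complex)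
     \<Rightarrow> (real ^ ('n + 'm) ^ ('n + 'm) \<Rightarrow> complex) set" where
  "ind_space_Y \<iota> lam = {F \<in> ind_space \<iota> lam. right_inv_on Lgrp (Lgrp \<inter> M0grp \<iota>) F}"

text \<open>The identification of functions on \<open>Y\<close> with functions on \<open>L\<close>.\<close>

definition pull_L ::
  "('m::finite \<Rightarrow> 'n::finite) \<Rightarrow> (real ^ 'm ^ 'n \<Rightarrow> complex)
     \<Rightarrow> (real ^ ('n + 'm) ^ ('n + 'm) \<Rightarrow> complex)" where
  "pull_L \<iota> f = (\<lambda>l. if l \<in> Lgrp then f (act l (base_point \<iota>)) else 0)"

end

theory Submission
  imports Defs
begin

text \<open>
  Write \<open>j(h, v) = Cv + D\<close> for the automorphy factor, so that \<open>h\<close> maps \<open>(v y, y)\<close> to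
  \<open>(w z, z)\<close> with \<open>w = h(v)\<close> and \<open>z = j(h, v) y\<close>; in particular \<open>j\<close> is a cocycle. A function \<open>f\<close>
  on \<open>Y\<close> is extended to \<open>H\<close> by \<open>F(x) = J\<^sub>x(v\<^sub>0)\<^sup>\<beta> f(x v\<^sub>0)\<close> with \<open>v\<^sub>0\<close> the base point. The cocycle
  property turns \<open>\<tau>\<close> into left translation of \<open>F\<close>, and on \<open>L\<close> the automorphy factor is
  orthogonal, so that \<open>F\<close> restricts to \<open>l \<mapsto> f(l v\<^sub>0)\<close>. The group \<open>MAN\<close> fixes \<open>v\<^sub>0\<close>, and
  \<open>\<bar>det j\<bar>\<close> at \<open>v\<^sub>0\<close> is 1 on \<open>M\<close>, is 1 on \<open>N\<close> by triangularity, and is \<open>exp (\<Sum>t\<^sub>j)\<close> at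
  \<open>exp (\<Sum>t\<^sub>jE\<^sub>j)\<close>; this gives the covariance of \<open>F\<close>. Conversely, by the Iwasawa decomposition a
  member of the induced space is determined by its restriction to \<open>L\<close>.
\<close>

subsection \<open>Exponentials of matrices\<close>

text \<open>The graph of \<open>v\<close> in \<open>stiefel\<close> is a totally isotropic m-plane,
  so \<open>act\<close> is the action of H on such planes, and facts about \<open>act\<close> and
  \<open>aut_factor\<close> follow from identities \<open>h *v lift v y = lift w (a *v y)\<close>.
  The plane of the base point is spanned by the vectors \<open>wplus \<iota> j\<close> of weight
  \<open>E\<^sub>j\<^sup>*\<close>; the roots \<open>E\<^sub>j\<^sup>* - E\<^sub>i\<^sup>*\<close>
  raise index i to j and the other positive roots kill the plane, whence the triangularity. The
  constant: \<open>rho0\<close> at s(E_1+...+E_m) is m(n-1)s/2, so the prescribed exponent on A is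
  -(n-2) times the sum of the t_j, and \<beta>(n+m) = n-2. Two obstacles shape the proof.
  \<open>Ngrp\<close> is merely the image of \<open>mexp\<close>, and its closure under products is
  not established; hence the Iwasawa argument multiplies by one exponential at a time, those from
  \<open>nfrak\<close> always with X(X y) = 0 on the vectors tracked, where exp X is 1 + X. And
  invariance under L \<inter> M_0 is a condition on the restriction to L, so it is not visible that
  translations by H preserve \<open>ind_space_Y\<close>; this follows because that space is the
  image of the extension map.\<close>

lemma bounded_linear_matrix_mult_left:
  "bounded_linear (\<lambda>Y :: real^'j::finite^'k::finite. (X :: real^'k^'l::finite) ** Y)"
  by (intro linear_conv_bounded_linear[THEN iffD1] linearI)
     (simp_all add: matrix_add_ldistrib matrix_scalar_ac scalar_matrix_assoc[symmetric])

lemma bounded_linear_matrix_mult_right: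
  "bounded_linear (\<lambda>X :: real^'k::finite^'l::finite. X ** (Y :: real^'j::finite^'k))"
  by (intro linear_conv_bounded_linear[THEN iffD1] linearI)
     (simp_all add: matrix_matrix_mult_def vec_eq_iff sum.distrib algebra_simps sum_distrib_left)

lemma bounded_linear_matrix_vector_mult_right:
  "bounded_linear (\<lambda>X :: real^'k::finite^'l::finite. X *v y)"
  by (intro linear_conv_bounded_linear[THEN iffD1] linearI)
     (simp_all add: matrix_vector_mult_def vec_eq_iff sum.distrib algebra_simps sum_distrib_left)

definition mpow :: "real ^ 'k::finite ^ 'k \<Rightarrow> nat \<Rightarrow> real ^ 'k ^ 'k" where
  "mpow X k = ((**) X ^^ k) (mat 1)"

lemma mpow_0 [simp]: "mpow X 0 = mat 1"
  and mpow_Suc: "mpow X (Suc k) = X ** mpow X k"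
  by (simp_all add: mpow_def)

lemma mpow_intertwine:
  fixes X :: "real^'k::finite^'k" and Y :: "real^'j::finite^'k"
  assumes "X ** Y = Y ** Z"
  shows "mpow X k ** Y = Y ** mpow Z k"
proof (induction k)
  case (Suc k)
  then have "mpow X (Suc k) ** Y = X ** (Y ** mpow Z k)"
    by (simp add: mpow_Suc matrix_mul_assoc[symmetric])
  with assms show ?case
    by (simp add: mpow_Suc matrix_mul_assoc)
qed simp

lemma mpow_add: "mpow X (i + k) = mpow X i ** mpow X k"
  by (induction i) (simp_all add: mpow_Suc matrix_mul_assoc)

lemma mpow_scaleR: "mpow (c *\<^sub>R X) k = c ^ k *\<^sub>R mpow X k"
  by (induction k)
     (simp_all add: mpow_Suc scalar_mult_eq_scaleR[symmetric] matrix_scalar_ac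
        scalar_matrix_assoc[symmetric])

lemma mpow_vec_Suc: "mpow X (Suc k) *v y = mpow X k *v (X *v y)"
  using mpow_add[of X k 1] by (simp add: mpow_Suc matrix_vector_mul_assoc)

text \<open>Left multiplication by \<open>X\<close> is bounded with some constant \<open>K\<close>,
  so the powers of \<open>X\<close> grow at most like \<open>K ^ k\<close> and the exponential
  series of \<open>K\<close> dominates.\<close>

lemma norm_mexp_summable: "summable (\<lambda>k. norm ((1 / fact k) *\<^sub>R mpow X k))"
proof -
  obtain K where K: "K > 0" "\<And>Y :: real^'a^'a. norm (X ** Y) \<le> norm Y * K"
    using bounded_linear.pos_bounded[OF bounded_linear_matrix_mult_left, of X] by blast
  have bound: "norm (mpow X k) \<le> norm (mat 1 :: real^'a^'a) * K ^ k" for k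
  proof (induction k)
    case (Suc k)
    have "norm (mpow X (Suc k)) \<le> norm (mpow X k) * K"
      using K by (simp add: mpow_Suc)
    also have "\<dots> \<le> norm (mat 1 :: real^'a^'a) * K ^ k * K"
      using Suc K by (intro mult_right_mono) auto
    finally show ?case by (simp add: mult_ac)
  qed simp
  have "summable (\<lambda>k. norm (mat 1 :: real^'a^'a) * (inverse (fact k) * K ^ k))"
    by (intro summable_mult summable_exp)
  then show ?thesis
  proof (rule summable_comparison_test')
    fix k :: nat
    show "norm (norm ((1 / fact k) *\<^sub>R mpow X k))
        \<le> norm (mat 1 :: real^'a^'a) * (inverse (fact k) * K ^ k)"
      using bound[of k] by (simp add: field_simps)
  qed
qed

lemma mexp_sums: "(\<lambda>k. (1 / fact k) *\<^sub>R mpow X k) sums mexp X"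
  using summable_norm_cancel[OF norm_mexp_summable[of X]]
  unfolding mexp_def mpow_def by (rule summable_sums)

lemma mexp_entry_sums: "(\<lambda>k. (1 / fact k) * mpow X k $ p $ q) sums (mexp X $ p $ q)"
proof -
  have "bounded_linear (\<lambda>M :: real^'a^'a. M $ p $ q)"
    by (intro linear_conv_bounded_linear[THEN iffD1] linearI) auto
  from bounded_linear.sums[OF this mexp_sums, of X] show ?thesis
    by simp
qed

lemma mexp_vec_sums: "(\<lambda>k. (1 / fact k) *\<^sub>R (mpow X k *v y)) sums (mexp X *v y)"
  using bounded_linear.sums[OF bounded_linear_matrix_vector_mult_right mexp_sums, of X y]
  by (simp add: linear_cmul[OF bounded_linear.linear[OF bounded_linear_matrix_vector_mult_right]])

text \<open>\<open>Y\<close> need not be square. With \<open>Z = X\<close> this is commutation with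
  the exponential; with \<open>Y\<close> the embedding of an invariant subspace it restricts the
  exponential to that subspace.\<close>

lemma mexp_intertwine:
  fixes X :: "real^'k::finite^'k" and Y :: "real^'j::finite^'k"
  assumes "X ** Y = Y ** Z"
  shows "mexp X ** Y = Y ** mexp Z"
proof -
  have "(\<lambda>k. (1 / fact k) *\<^sub>R (mpow X k ** Y)) sums (mexp X ** Y)"
    using bounded_linear.sums[OF bounded_linear_matrix_mult_right mexp_sums, of X Y]
    by (simp add: linear_cmul[OF bounded_linear.linear[OF bounded_linear_matrix_mult_right]])
  moreover have "(\<lambda>k. (1 / fact k) *\<^sub>R (Y ** mpow Z k)) sums (Y ** mexp Z)"
    using bounded_linear.sums[OF bounded_linear_matrix_mult_left mexp_sums, of Y Z]
    by (simp add: linear_cmul[OF bounded_linear.linear[OF bounded_linear_matrix_mult_left]])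
  ultimately show ?thesis
    using mpow_intertwine[OF assms] by (simp add: sums_unique2)
qed

lemma mexp_eigenvector:
  assumes "X *v y = c *\<^sub>R y"
  shows "mexp X *v y = exp c *\<^sub>R y"
proof -
  have "mpow X k *v y = c ^ k *\<^sub>R y" for k
    by (induction k) (simp_all add: mpow_vec_Suc assms scaleR_matrix_vector_assoc
        matrix_vector_mult_scaleR power_commutes)
  moreover have "(\<lambda>k. (c ^ k /\<^sub>R fact k) *\<^sub>R y) sums (exp c *\<^sub>R y)"
    by (intro sums_scaleR_left exp_converges)
  ultimately show ?thesis
    using mexp_vec_sums[of X y] by (simp add: sums_unique2 divide_inverse)
qed

text \<open>The series stops after two terms on this particular \<open>y\<close>, whatever
  \<open>X\<close> does elsewhere. All unipotent factors of the Iwasawa argument are evaluated in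
  this way.\<close>

lemma mexp_square_zero:
  assumes "X *v (X *v y) = 0"
  shows "mexp X *v y = y + X *v y"
proof -
  have "mpow X (Suc (Suc k)) *v y = 0" for k
    by (simp add: mpow_vec_Suc assms)
  then have z: "mpow X k *v y = 0" if "k \<notin> {..<2}" for k
    using that by (cases k; cases "k - 1") auto
  have "(\<lambda>k. (1 / fact k) *\<^sub>R (mpow X k *v y)) sums (\<Sum>k<2. (1 / fact k) *\<^sub>R (mpow X k *v y))"
    by (rule sums_finite) (use z in auto)
  then show ?thesis
    using mexp_vec_sums[of X y] sums_unique2 by (fastforce simp: numeral_2_eq_2 mpow_Suc)
qed

lemma mexp_0: "mexp (0 :: real^'k::finite^'k) = mat 1"
proof -
  have "mexp 0 *v y = mat 1 *v y" for y :: "real^'k"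
    using mexp_eigenvector[of 0 y 0] by simp
  then show ?thesis by (simp add: matrix_eq)
qed

lemma norm_component_le: "norm (X $ p $ q) \<le> norm X" for X :: "real^'k::finite^'l::finite"
  using component_le_norm_cart[of "X $ p" q] Finite_Cartesian_Product.norm_nth_le[of X p] by simp

text \<open>The Cauchy product is taken entry by entry, because square matrices are not an instance of
  \<open>real_normed_algebra\<close>.\<close>

lemma mexp_scaleR_mult: "mexp (s *\<^sub>R X) ** mexp (t *\<^sub>R X) = mexp ((s + t) *\<^sub>R X)"
proof -
  define e where "e Y p q k = (1 / fact k) * mpow Y k $ p $ q"
    for Y :: "real^'a^'a" and p q k
  have ent: "e Y p q sums (mexp Y $ p $ q)" for Y p q
    unfolding e_def[abs_def] by (rule mexp_entry_sums)
  have abs: "summable (\<lambda>k. norm (e Y p q k))" for Y p q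
    by (rule summable_comparison_test'[OF norm_mexp_summable[of Y]])
       (use norm_component_le in \<open>auto simp: e_def divide_simps\<close>)
  \<comment> \<open>Both factors are multiples of one \<open>X\<close>, so \<open>mpow X k\<close>
    factors out of the Cauchy product and the binomial theorem remains.\<close>
  have coeff: "(\<Sum>r\<in>UNIV. \<Sum>i\<le>k. e (s *\<^sub>R X) p r i * e (t *\<^sub>R X) r q (k - i)) = e ((s + t) *\<^sub>R X) p q k"
    for p q k
  proof -
    have "(\<Sum>r\<in>UNIV. \<Sum>i\<le>k. e (s *\<^sub>R X) p r i * e (t *\<^sub>R X) r q (k - i))
        = (\<Sum>i\<le>k. \<Sum>r\<in>UNIV. e (s *\<^sub>R X) p r i * e (t *\<^sub>R X) r q (k - i))"
      by (rule sum.swap)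
    also have "\<dots> = (\<Sum>i\<le>k. (s ^ i * t ^ (k - i) / (fact i * fact (k - i))) * mpow X k $ p $ q)"
    proof (rule sum.cong[OF refl])
      fix i assume "i \<in> {..k}"
      then have "mpow X k = mpow X i ** mpow X (k - i)"
        using mpow_add[of X i "k - i"] by simp
      then have "mpow X k $ p $ q = (\<Sum>r\<in>UNIV. mpow X i $ p $ r * mpow X (k - i) $ r $ q)"
        by (simp add: matrix_matrix_mult_def)
      then show "(\<Sum>r\<in>UNIV. e (s *\<^sub>R X) p r i * e (t *\<^sub>R X) r q (k - i))
          = (s ^ i * t ^ (k - i) / (fact i * fact (k - i))) * mpow X k $ p $ q"
        by (simp add: e_def mpow_scaleR sum_distrib_left mult_ac)
    qed
    also have "\<dots> = (\<Sum>i\<le>k. of_nat (k choose i) * s ^ i * t ^ (k - i)) / fact k * mpow X k $ p $ q"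
      by (simp add: sum_divide_distrib sum_distrib_left sum_distrib_right binomial_fact field_simps)
    also have "\<dots> = e ((s + t) *\<^sub>R X) p q k"
      by (simp add: e_def mpow_scaleR binomial_ring mult_ac)
    finally show ?thesis .
  qed
  have "(mexp (s *\<^sub>R X) ** mexp (t *\<^sub>R X)) $ p $ q = mexp ((s + t) *\<^sub>R X) $ p $ q" for p q
  proof -
    have "(\<lambda>k. \<Sum>r\<in>UNIV. \<Sum>i\<le>k. e (s *\<^sub>R X) p r i * e (t *\<^sub>R X) r q (k - i)) sums
        (\<Sum>r\<in>UNIV. mexp (s *\<^sub>R X) $ p $ r * mexp (t *\<^sub>R X) $ r $ q)"
      using Cauchy_product_sums[OF abs abs, of "s *\<^sub>R X" p _ "t *\<^sub>R X" _ q]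
      by (intro sums_sum) (simp add: sums_unique[OF ent, symmetric])
    then have "e ((s + t) *\<^sub>R X) p q sums
        (\<Sum>r\<in>UNIV. mexp (s *\<^sub>R X) $ p $ r * mexp (t *\<^sub>R X) $ r $ q)"
      by (simp only: coeff)
    from sums_unique2[OF this ent] show ?thesis
      by (simp add: matrix_matrix_mult_def)
  qed
  then show ?thesis by (simp add: vec_eq_iff)
qed

lemma mexp_minus: "mexp (- X) ** mexp X = mat 1"
  using mexp_scaleR_mult[of "-1" X 1] by (simp add: mexp_0)

text \<open>exp X is the square of exp (X/2). The sign is all that is wanted, since preservation of
  the form already forces the determinant to be 1 or -1.\<close>

lemma det_mexp_nonneg: "det (mexp X) \<ge> 0"
proof -
  have "det (mexp X) = det (mexp ((1/2) *\<^sub>R X)) ^ 2"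
    using mexp_scaleR_mult[of "1/2" X "1/2"] by (simp add: power2_eq_square flip: det_mul)
  then show ?thesis by simp
qed

subsection \<open>The form and its group\<close>

lemma sum_UNIV_Plus:
  "(\<Sum>p\<in>UNIV. f p) = (\<Sum>i\<in>UNIV. f (Inl i)) + (\<Sum>j\<in>UNIV. f (Inr j))"
  for f :: "'n::finite + 'm::finite \<Rightarrow> 'a::comm_monoid_add"
  by (simp add: UNIV_Plus_UNIV[symmetric] sum.Plus del: UNIV_Plus_UNIV)

text \<open>The Cartan involution diag(I_n, -I_m) on vectors. It converts between the form and the
  inner product, and L consists of the elements of H that commute with it.\<close>

definition theta :: "real ^ ('n::finite + 'm::finite) \<Rightarrow> real ^ ('n + 'm)" where
  "theta y = (\<chi> p. case p of Inl i \<Rightarrow> y $ Inl i | Inr j \<Rightarrow> - y $ Inr j)"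

lemma theta_nth [simp]: "theta y $ Inl i = y $ Inl i" "theta y $ Inr j = - y $ Inr j"
  by (simp_all add: theta_def)

lemma vec_eq_Plus:
  "x = y \<longleftrightarrow> (\<forall>i. x $ Inl i = y $ Inl i) \<and> (\<forall>j. x $ Inr j = y $ Inr j)"
  for x y :: "'a ^ ('n::finite + 'm::finite)"
  unfolding vec_eq_iff by (metis sum.exhaust)

lemma theta_theta [simp]: "theta (theta y) = y"
  by (simp add: vec_eq_Plus)

lemma linear_theta: "linear theta"
  by (rule linearI) (simp_all add: vec_eq_Plus)

lemma inner_Plus: "x \<bullet> y = (\<Sum>i\<in>UNIV. x $ Inl i * y $ Inl i) + (\<Sum>j\<in>UNIV. x $ Inr j * y $ Inr j)"
  for x y :: "real ^ ('n::finite + 'm::finite)"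
  by (simp add: inner_vec_def sum_UNIV_Plus)

lemma form_eq_inner: "form x y = x \<bullet> theta y"
  by (simp add: form_def inner_Plus sum_negf)

lemma form_theta [simp]: "form x (theta y) = x \<bullet> y" "form (theta x) y = x \<bullet> y"
  by (simp add: form_eq_inner) (simp add: form_def inner_Plus sum_negf)

lemma inner_transpose: "x \<bullet> (transpose A *v y) = (A *v x) \<bullet> y"
  for A :: "real^'k::finite^'l::finite"
  using dot_lmul_matrix[of x "transpose A" y] by simp

lemma form_commute: "form x y = form y x"
  by (simp add: form_def mult.commute)

lemma form_simps [simp]:
  "form (x + x') y = form x y + form x' y" "form x (y + y') = form x y + form x y'"
  "form (x - x') y = form x y - form x' y" "form x (y - y') = form x y - form x y'"
  "form (c *\<^sub>R x) y = c * form x y" "form x (c *\<^sub>R y) = c * form x y"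
  "form 0 y = 0" "form x 0 = 0" "form (- x) y = - form x y" "form x (- y) = - form x y"
  by (simp_all add: form_eq_inner linear_add[OF linear_theta] linear_diff[OF linear_theta]
      linear_cmul[OF linear_theta] linear_0[OF linear_theta] linear_neg[OF linear_theta]
      inner_add_left inner_add_right inner_diff_left inner_diff_right)

lemma form_sum_left: "form (\<Sum>i\<in>I. f i) y = (\<Sum>i\<in>I. form (f i) y)"
  by (induction I rule: infinite_finite_induct) simp_all

lemma form_sum_right: "form y (\<Sum>i\<in>I. f i) = (\<Sum>i\<in>I. form y (f i))"
  by (induction I rule: infinite_finite_induct) simp_all

lemma form_nondegenerate: "(\<And>y. form x y = 0) \<Longrightarrow> x = 0"
  by (metis form_theta(1) inner_eq_zero_iff)

lemma SO_form: "h \<in> SO_nm \<Longrightarrow> form (h *v u) (h *v v) = form u v"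
  and SO_det: "h \<in> SO_nm \<Longrightarrow> det h = 1"
  by (simp_all add: SO_nm_def)

lemma SO_invertible: "h \<in> SO_nm \<Longrightarrow> invertible h"
  by (simp add: SO_det invertible_det_nz)

lemma invertible_matrix_inv:
  assumes "invertible A"
  shows "matrix_inv A ** A = mat 1" "A ** matrix_inv A = mat 1"
  using someI_ex[OF assms[unfolded invertible_def]] by (auto simp: matrix_inv_def)

lemma SO_inv_mult [simp]:
  assumes "h \<in> SO_nm"
  shows "matrix_inv h ** h = mat 1" "h ** matrix_inv h = mat 1"
  using assms by (simp_all add: SO_invertible invertible_matrix_inv)

lemma SO_inv_mult_vec [simp]:
  assumes "h \<in> SO_nm"
  shows "matrix_inv h *v (h *v y) = y" "h *v (matrix_inv h *v y) = y"
  using assms by (simp_all add: matrix_vector_mul_assoc)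

lemma SO_one [simp]: "mat 1 \<in> SO_nm"
  by (simp add: SO_nm_def)

lemma SO_mult [simp]: "g \<in> SO_nm \<Longrightarrow> h \<in> SO_nm \<Longrightarrow> g ** h \<in> SO_nm"
  by (simp add: SO_nm_def det_mul matrix_vector_mul_assoc[symmetric])

lemma SO_inv [simp]:
  assumes "h \<in> SO_nm"
  shows "matrix_inv h \<in> SO_nm"
proof -
  have "det (matrix_inv h ** h) = 1"
    using assms by simp
  then have "det (matrix_inv h) = 1"
    by (simp only: det_mul SO_det[OF assms])
  moreover have "form (matrix_inv h *v u) (matrix_inv h *v v) = form u v" for u v
    using SO_form[OF assms, of "matrix_inv h *v u" "matrix_inv h *v v"] assms by simp
  ultimately show ?thesis by (simp add: SO_nm_def)
qed

lemma matrix_inv_eqI: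
  fixes A :: "real^'k::finite^'k"
  assumes "B ** A = mat 1"
  shows "matrix_inv A = B"
proof -
  have "A ** B = mat 1" using assms matrix_left_right_inverse by blast
  then have "invertible A" using assms by (auto simp: invertible_def)
  then show ?thesis
    by (metis assms invertible_matrix_inv(2) matrix_mul_assoc matrix_mul_lid matrix_mul_rid)
qed

lemma matrix_inv_mat_1 [simp]: "matrix_inv (mat 1 :: real^'k::finite^'k) = mat 1"
  by (rule matrix_inv_eqI) simp

lemma SO_matrix_inv_mult:
  "g \<in> SO_nm \<Longrightarrow> h \<in> SO_nm \<Longrightarrow> matrix_inv (g ** h) = matrix_inv h ** matrix_inv g"
  by (rule matrix_inv_eqI) (metis SO_inv_mult(1) matrix_mul_assoc matrix_mul_lid)

lemma SO_mult_iff: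
  assumes "h \<in> SO_nm"
  shows "matrix_inv h ** x \<in> SO_nm \<longleftrightarrow> x \<in> SO_nm"
proof
  assume "matrix_inv h ** x \<in> SO_nm"
  from SO_mult[OF assms this] have "h ** (matrix_inv h ** x) \<in> SO_nm" .
  with assms show "x \<in> SO_nm" by (simp add: matrix_mul_assoc)
qed (use assms in simp)

text \<open>\<open>X\<close> is skew for the form, so moving a power of it to the other side
  replaces \<open>X\<close> by \<open>- X\<close>; then both series are summed.\<close>

lemma form_mexp_adjoint:
  assumes "X \<in> so_nm"
  shows "form (mexp X *v u) v = form u (mexp (- X) *v v)"
proof -
  have adj: "form (X *v u) v = form u ((- X) *v v)" for u v
  proof -
    have "form (X *v u) v + form u (X *v v) = 0" using assms by (auto simp: so_nm_def)
    moreover have "(- X) *v v = - (X *v v)"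
      using scaleR_matrix_vector_assoc[of "-1" X v] by simp
    ultimately show ?thesis by simp
  qed
  have pow: "form (mpow X k *v u) v = form u (mpow (- X) k *v v)" for k u v
  proof (induction k arbitrary: u v)
    case (Suc k)
    have "form (mpow X (Suc k) *v u) v = form (mpow X k *v u) ((- X) *v v)"
      by (simp only: mpow_Suc adj flip: matrix_vector_mul_assoc)
    also have "\<dots> = form u (mpow (- X) k *v ((- X) *v v))"
      by (rule Suc)
    finally show ?case by (simp only: mpow_vec_Suc)
  qed simp
  have l: "bounded_linear (\<lambda>u. form u v)" "bounded_linear (form u)" for u v
    by (auto intro!: linear_conv_bounded_linear[THEN iffD1] linearI)
  have "(\<lambda>k. (1 / fact k) * form (mpow X k *v u) v) sums form (mexp X *v u) v"
    using bounded_linear.sums[OF l(1) mexp_vec_sums] by simp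
  moreover have "(\<lambda>k. (1 / fact k) * form u (mpow (- X) k *v v)) sums form u (mexp (- X) *v v)"
    using bounded_linear.sums[OF l(2) mexp_vec_sums] by simp
  ultimately show ?thesis
    by (simp add: pow sums_unique2)
qed

definition Theta :: "real ^ ('n::finite + 'm::finite) ^ ('n + 'm)" where
  "Theta = matrix theta"

lemma Theta_mult [simp]: "Theta *v y = theta y"
  using fun_cong[OF matrix_vector_mul(2)[OF linear_theta], of y] by (simp add: Theta_def)

text \<open>Invariance of the form is the matrix identity
  \<open>transpose h ** Theta ** h = Theta\<close>; taking determinants gives the claim.\<close>

lemma det_form_preserving:
  fixes h :: "real^('n::finite + 'm::finite)^('n + 'm)"
  assumes "\<And>u v. form (h *v u) (h *v v) = form u v"
  shows "\<bar>det h\<bar> = 1"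
proof -
  let ?T = "Theta :: real^('n + 'm)^('n + 'm)"
  have "u \<bullet> ((transpose h ** Theta ** h) *v v) = u \<bullet> (Theta *v v)" for u v
    using assms[of u v]
    by (simp only: form_eq_inner inner_transpose transpose_transpose Theta_mult
        flip: matrix_vector_mul_assoc)
  then have "transpose h ** Theta ** h = Theta"
    unfolding matrix_eq using vector_eq_ldot by blast
  then have "det (transpose h ** Theta ** h) = det ?T" by (simp only:)
  then have "det h * det h * det ?T = det ?T"
    by (simp add: det_mul det_transpose)
  moreover have "det (?T ** ?T) = 1"
  proof -
    have "?T ** ?T = mat 1"
      by (simp add: matrix_eq flip: matrix_vector_mul_assoc)
    then show ?thesis by simp
  qed
  then have "det ?T \<noteq> 0" by (auto simp: det_mul)
  ultimately have "det h * det h = 1" by simp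
  then show ?thesis using abs_square_eq_1[of "det h"] by (simp add: power2_eq_square)
qed

lemma mexp_SO:
  assumes "X \<in> so_nm"
  shows "mexp X \<in> SO_nm"
proof -
  have f: "form (mexp X *v u) (mexp X *v v) = form u v" for u v
    by (simp add: form_mexp_adjoint[OF assms] matrix_vector_mul_assoc mexp_minus)
  with det_form_preserving[OF f] det_mexp_nonneg[of X] show ?thesis
    by (simp add: SO_nm_def)
qed

subsection \<open>The action\<close>

text \<open>Parametrization of the graph of \<open>v\<close>, the m-plane in R^(n+m) that stands for
  the point \<open>v\<close>.\<close>

definition lift :: "real^'m::finite^'n::finite \<Rightarrow> real^'m \<Rightarrow> real^('n + 'm)" where
  "lift v y = (\<chi> p. case p of Inl i \<Rightarrow> (v *v y) $ i | Inr j \<Rightarrow> y $ j)"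

definition aut_factor :: "real^('n::finite + 'm::finite)^('n + 'm) \<Rightarrow> real^'m^'n \<Rightarrow> real^'m^'m" where
  "aut_factor h v = blockC h ** v + blockD h"

lemma lift_nth [simp]: "lift v y $ Inl i = (v *v y) $ i" "lift v y $ Inr j = y $ j"
  by (simp_all add: lift_def)

lemma linear_lift: "linear (lift v)"
  by (rule linearI) (simp_all add: vec_eq_Plus matrix_vector_right_distrib matrix_vector_mult_scaleR)

lemma lift_inj: "lift v y = lift w z \<Longrightarrow> y = z"
  by (metis lift_nth(2) vec_eq_iff)

lemma form_lift: "form (lift v y) (lift v z) = (v *v y) \<bullet> (v *v z) - y \<bullet> z"
  by (simp add: form_def inner_vec_def)

text \<open>The condition v^t v = I says that the form vanishes on the graph of \<open>v\<close>,
  which is a property that elements of \<open>SO_nm\<close> visibly preserve.\<close>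

lemma stiefel_iff_form: "v \<in> stiefel \<longleftrightarrow> (\<forall>y z. form (lift v y) (lift v z) = 0)"
proof -
  have "(v *v y) \<bullet> (v *v z) = y \<bullet> ((transpose v ** v) *v z)" for y z
    by (simp only: inner_transpose flip: matrix_vector_mul_assoc)
  then have "(\<forall>y z. form (lift v y) (lift v z) = 0) \<longleftrightarrow>
      (\<forall>y z. y \<bullet> ((transpose v ** v) *v z) = y \<bullet> (mat 1 *v z))"
    by (simp add: form_lift)
  also have "\<dots> \<longleftrightarrow> transpose v ** v = mat 1"
    unfolding matrix_eq using vector_eq_ldot by blast
  finally show ?thesis by (simp add: stiefel_def)
qed

lemma mult_lift:
  "(h *v lift v y) $ Inl i = ((blockA h ** v + blockB h) *v y) $ i"
  "(h *v lift v y) $ Inr j = (aut_factor h v *v y) $ j"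
  by (simp_all add: matrix_vector_mult_add_rdistrib aut_factor_def flip: matrix_vector_mul_assoc)
     (simp_all add: matrix_vector_mult_def sum_UNIV_Plus blockA_def blockB_def blockC_def blockD_def)

text \<open>If (Cv+D)y = 0, then h(vy, y) has vanishing last m coordinates. The form is positive
  definite on such vectors but vanishes on the image of the graph, so y = 0.\<close>

lemma aut_factor_invertible:
  assumes "h \<in> SO_nm" "v \<in> stiefel"
  shows "invertible (aut_factor h v)"
proof -
  have "y = 0" if y: "aut_factor h v *v y = 0" for y
  proof -
    define z where "z = h *v lift v y"
    have zr: "z $ Inr j = 0" for j using y by (simp add: z_def mult_lift)
    have "form z z = 0"
      using assms by (simp add: z_def SO_form stiefel_iff_form)
    then have "z \<bullet> z = 0" using zr by (simp add: form_def inner_Plus)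
    then have "h *v lift v y = 0" by (simp add: z_def)
    then have "matrix_inv h *v (h *v lift v y) = 0" by simp
    then have "lift v y = 0" using assms by simp
    then show "y = 0" using lift_inj[of v y v 0] linear_0[OF linear_lift, of v] by simp
  qed
  then show ?thesis
    by (simp add: invertible_left_inverse matrix_left_invertible_ker)
qed

lemma lift_act:
  assumes "h \<in> SO_nm" "v \<in> stiefel"
  shows "h *v lift v y = lift (act h v) (aut_factor h v *v y)"
proof -
  have "act h v *v (aut_factor h v *v y) = (blockA h ** v + blockB h) *v y"
    using invertible_matrix_inv(1)[OF aut_factor_invertible[OF assms]]
    unfolding act_def aut_factor_def[symmetric]
    by (simp add: matrix_vector_mul_assoc matrix_mul_assoc[symmetric])
  then show ?thesis by (simp add: vec_eq_Plus mult_lift)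
qed

lemma aut_factor_surj:
  assumes "h \<in> SO_nm" "v \<in> stiefel"
  obtains z where "y = aut_factor h v *v z"
  using invertible_matrix_inv(2)[OF aut_factor_invertible[OF assms]]
  by (metis matrix_vector_mul_assoc matrix_vector_mul_lid)

text \<open>A point of a graph determines its parameter, so one intertwining identity fixes the
  image point and the automorphy factor at once. Products, the factors of the parabolic and the
  orbit of the base point are all treated through it.\<close>

lemma lift_act_eqI:
  assumes h: "h \<in> SO_nm" "v \<in> stiefel" and eq: "\<And>y. h *v lift v y = lift w (a *v y)"
  shows "act h v = w" "aut_factor h v = a"
proof -
  have a: "aut_factor h v *v y = a *v y" for y
    using lift_inj eq[of y] lift_act[OF h, of y] by metis
  then show "aut_factor h v = a" by (simp add: matrix_eq)
  have "act h v *v y = w *v y" for y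
  proof -
    obtain z where z: "y = aut_factor h v *v z" by (rule aut_factor_surj[OF h])
    have "lift (act h v) y = lift w y"
      using eq[of z] lift_act[OF h, of z] a z by metis
    then show ?thesis by (metis lift_nth(1) vec_eq_iff)
  qed
  then show "act h v = w" by (simp add: matrix_eq)
qed

lemma act_stiefel:
  assumes "h \<in> SO_nm" "v \<in> stiefel"
  shows "act h v \<in> stiefel"
  unfolding stiefel_iff_form
proof (intro allI)
  fix y z
  obtain y' z' where "y = aut_factor h v *v y'" "z = aut_factor h v *v z'"
    using aut_factor_surj[OF assms] by metis
  then show "form (lift (act h v) y) (lift (act h v) z) = 0"
    using assms by (simp add: SO_form stiefel_iff_form flip: lift_act)
qed

lemma act_mult:
  assumes "g \<in> SO_nm" "h \<in> SO_nm" "v \<in> stiefel"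
  shows "act (g ** h) v = act g (act h v)"
    and "aut_factor (g ** h) v = aut_factor g (act h v) ** aut_factor h v"
proof -
  have "(g ** h) *v lift v y
      = lift (act g (act h v)) ((aut_factor g (act h v) ** aut_factor h v) *v y)" for y
    using assms by (simp add: lift_act act_stiefel flip: matrix_vector_mul_assoc)
  from lift_act_eqI[OF SO_mult[OF assms(1,2)] assms(3) this]
  show "act (g ** h) v = act g (act h v)"
    and "aut_factor (g ** h) v = aut_factor g (act h v) ** aut_factor h v" by blast+
qed

lemma act_one [simp]: "v \<in> stiefel \<Longrightarrow> act (mat 1) v = v"
  and aut_factor_one [simp]: "v \<in> stiefel \<Longrightarrow> aut_factor (mat 1) v = mat 1"
  using lift_act_eqI[of "mat 1" v v "mat 1"] by simp_all

lemma act_inv: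
  assumes "h \<in> SO_nm" "v \<in> stiefel"
  shows "act (matrix_inv h) (act h v) = v" "act h (act (matrix_inv h) v) = v"
  using assms by (simp_all flip: act_mult(1))

lemma Jac_pow_mult:
  assumes "g \<in> SO_nm" "h \<in> SO_nm" "v \<in> stiefel"
  shows "Jac_pow (g ** h) v s = Jac_pow g (act h v) s * Jac_pow h v s"
  using act_mult(2)[OF assms]
  by (simp add: Jac_pow_def aut_factor_def[symmetric] det_mul abs_mult powr_mult)

lemma Jac_pow_one [simp]: "v \<in> stiefel \<Longrightarrow> Jac_pow (mat 1) v s = 1"
  by (simp add: Jac_pow_def aut_factor_def[symmetric])

subsection \<open>Weight vectors and root spaces\<close>

text \<open>The element a \<and> b under the usual identification of so(n,m) with the exterior
  square of R^(n+m). Brackets act on it as derivations, so the weights of the two factors add up to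
  the root.\<close>

definition wedge :: "real^('n::finite + 'm::finite) \<Rightarrow> real^('n + 'm) \<Rightarrow> real^('n + 'm)^('n + 'm)" where
  "wedge a b = matrix (\<lambda>y. form b y *\<^sub>R a - form a y *\<^sub>R b)"

lemma wedge_mult: "wedge a b *v y = form b y *\<^sub>R a - form a y *\<^sub>R b"
proof -
  have "linear (\<lambda>y. form b y *\<^sub>R a - form a y *\<^sub>R b)"
    by (rule linearI) (simp_all add: algebra_simps)
  from fun_cong[OF matrix_vector_mul(2)[OF this]] show ?thesis
    by (simp add: wedge_def)
qed

lemma wedge_so: "wedge a b \<in> so_nm"
  by (simp add: so_nm_def wedge_mult form_commute)

lemma linear_wedge: "linear (wedge a)"
  by (rule linearI)
     (simp_all add: matrix_eq wedge_mult algebra_simps flip: scaleR_matrix_vector_assoc)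

lemma so_skew: "X \<in> so_nm \<Longrightarrow> form (X *v u) v = - form u (X *v v)"
  unfolding so_nm_def by (simp add: eq_neg_iff_add_eq_0)

lemma wedge_commutator:
  assumes "T \<in> so_nm"
  shows "T ** wedge a b - wedge a b ** T = wedge (T *v a) b + wedge a (T *v b)"
  by (simp add: matrix_eq wedge_mult so_skew[OF assms] algebra_simps flip: matrix_vector_mul_assoc)

lemma subspace_so: "subspace so_nm"
proof (rule subspaceI)
  show "0 \<in> so_nm" by (simp add: so_nm_def)
  fix X Y :: "real^('n::finite + 'm::finite)^('n + 'm)" and c
  assume "X \<in> so_nm" "Y \<in> so_nm"
  then show "X + Y \<in> so_nm"
    by (simp add: so_nm_def matrix_vector_mult_add_rdistrib add_eq_0_iff)
next
  fix X :: "real^('n::finite + 'm::finite)^('n + 'm)" and c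
  assume "X \<in> so_nm"
  then show "c *\<^sub>R X \<in> so_nm"
    by (simp add: so_nm_def add_eq_0_iff flip: scaleR_matrix_vector_assoc)
qed

section \<open>Weight vectors of \<open>afrak \<iota>\<close> in R^(n+m)\<close>

definition wplus :: "('m::finite \<Rightarrow> 'n::finite) \<Rightarrow> 'm \<Rightarrow> real^('n + 'm)" where
  "wplus \<iota> j = axis (Inl (\<iota> j)) 1 + axis (Inr j) 1"

definition wminus :: "('m::finite \<Rightarrow> 'n::finite) \<Rightarrow> 'm \<Rightarrow> real^('n + 'm)" where
  "wminus \<iota> j = axis (Inl (\<iota> j)) 1 - axis (Inr j) 1"

abbreviation evec :: "'n \<Rightarrow> real^('n::finite + 'm::finite)" where
  "evec k \<equiv> axis (Inl k) 1"

definition amat :: "('m::finite \<Rightarrow> 'n::finite) \<Rightarrow> ('m \<Rightarrow> real) \<Rightarrow> real^('n + 'm)^('n + 'm)" where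
  "amat \<iota> t = (\<Sum>j\<in>UNIV. t j *\<^sub>R Emat \<iota> j)"

lemma afrak_eq: "afrak \<iota> = range (amat \<iota>)"
  and afrak0_eq: "afrak0 \<iota> = range (\<lambda>s. amat \<iota> (\<lambda>_. s))"
  and afrak0_perp_eq: "afrak0_perp \<iota> = {amat \<iota> t | t. (\<Sum>j\<in>UNIV. t j) = 0}"
  by (auto simp: afrak_def afrak0_def afrak0_perp_def amat_def scaleR_sum_right)

lemma amat_add: "amat \<iota> s + amat \<iota> t = amat \<iota> (\<lambda>j. s j + t j)"
  and amat_scaleR: "c *\<^sub>R amat \<iota> t = amat \<iota> (\<lambda>j. c * t j)"
  by (simp_all add: amat_def sum.distrib scaleR_add_left scaleR_sum_right)

lemma wplus_nth [simp]:
  "wplus \<iota> j $ Inr l = (if l = j then 1 else 0)"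
  "wplus \<iota> j $ Inl i = (if i = \<iota> j then 1 else 0)"
  and wminus_nth [simp]:
  "wminus \<iota> j $ Inr l = (if l = j then -1 else 0)"
  "wminus \<iota> j $ Inl i = (if i = \<iota> j then 1 else 0)"
  by (auto simp: wplus_def wminus_def axis_def)

lemma theta_wplus [simp]: "theta (wplus \<iota> j) = wminus \<iota> j"
  and theta_wminus [simp]: "theta (wminus \<iota> j) = wplus \<iota> j"
  and theta_evec [simp]: "theta (evec k) = evec k"
  by (auto simp: vec_eq_Plus axis_def)

lemma form_evec [simp]: "form y (evec k) = y $ Inl k" "form (evec k) y = y $ Inl k"
proof -
  show "form y (evec k) = y $ Inl k" by (simp add: form_eq_inner inner_axis)
  then show "form (evec k) y = y $ Inl k" by (simp add: form_commute)
qed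

lemma form_wplus: "form y (wplus \<iota> j) = y $ Inl (\<iota> j) - y $ Inr j"
  and form_wminus: "form y (wminus \<iota> j) = y $ Inl (\<iota> j) + y $ Inr j"
  by (simp_all add: form_eq_inner) (simp_all add: wplus_def wminus_def inner_diff_right inner_add_right inner_axis)

lemma lift_base_point: "lift (base_point \<iota>) y = (\<Sum>j\<in>UNIV. y $ j *\<^sub>R wplus \<iota> j)"
proof -
  have "(\<Sum>j\<in>UNIV. (if i = \<iota> j then 1 else 0) * y $ j) = (\<Sum>j\<in>UNIV. y $ j * (if i = \<iota> j then 1 else 0))" for i
    by (simp add: mult.commute)
  then show ?thesis
    by (simp add: vec_eq_Plus base_point_def matrix_vector_mult_def if_distrib[of "\<lambda>x. _ * x"] cong: if_cong)
qed

lemma lift_base_point_axis: "lift (base_point \<iota>) (axis j 1) = wplus \<iota> j"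
  by (simp add: lift_base_point axis_def if_distrib[of "\<lambda>x. x *\<^sub>R _"] cong: if_cong)

text \<open>Strictly lower triangular: the diagonal vanishes too. The order matches the positive
  roots, as \<open>E\<^sub>j\<^sup>* - E\<^sub>i\<^sup>*\<close> with i < j sends
  \<open>wplus \<iota> i\<close> to a multiple of \<open>wplus \<iota> j\<close>, an entry in row j
  and column i.\<close>

definition triangular :: "((real, 'm) vec, 'm::{finite,linorder}) vec \<Rightarrow> bool" where
  "triangular Z \<longleftrightarrow> (\<forall>i j. \<not> j < i \<longrightarrow> Z $ i $ j = 0)"

text \<open>Weights are recorded by their coordinates in the dual basis, so that they add pointwise.
  The zero vector has every weight, and for most \<open>g\<close> it is the only vector of weight
  \<open>g\<close>.\<close>

definition weight_vec ::
  "('m::finite \<Rightarrow> 'n::finite) \<Rightarrow> ('m \<Rightarrow> real) \<Rightarrow> real^('n + 'm) \<Rightarrow> bool" where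
  "weight_vec \<iota> g y \<longleftrightarrow> (\<forall>t. amat \<iota> t *v y = (\<Sum>j\<in>UNIV. g j * t j) *\<^sub>R y)"

abbreviation unit :: "'m \<Rightarrow> 'm \<Rightarrow> real" where
  "unit j l \<equiv> (if l = j then 1 else 0)"

lemma weight_vec_cong: "weight_vec \<iota> g y \<Longrightarrow> (\<And>l. g l = g' l) \<Longrightarrow> weight_vec \<iota> g' y"
  by (simp add: weight_vec_def)

context
  fixes \<iota> :: "'m::finite \<Rightarrow> 'n::finite"
  assumes inj: "inj \<iota>"
begin

lemma iota_eq [simp]: "\<iota> i = \<iota> j \<longleftrightarrow> i = j"
  using inj by (simp add: inj_eq)

lemma form_basis [simp]:
  "form (wplus \<iota> i) (wplus \<iota> j) = 0" "form (wminus \<iota> i) (wminus \<iota> j) = 0"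
  "form (wplus \<iota> i) (wminus \<iota> j) = (if i = j then 2 else 0)"
  "form (wminus \<iota> i) (wplus \<iota> j) = (if i = j then 2 else 0)"
  by (auto simp: form_wplus form_wminus)

lemma Edual_amat [simp]: "Edual \<iota> j (amat \<iota> t) = t j"
  by (simp add: Edual_def amat_def Emat_def if_distrib[of "\<lambda>x. _ * x"] cong: if_cong)

lemma amat_mult:
  "(amat \<iota> t *v y) $ Inr j = t j * y $ Inl (\<iota> j)"
  "(amat \<iota> t *v y) $ Inl (\<iota> j) = t j * y $ Inr j"
  "k \<notin> range \<iota> \<Longrightarrow> (amat \<iota> t *v y) $ Inl k = 0"
proof -
  have E: "amat \<iota> t *v y = (\<Sum>j\<in>UNIV. t j *\<^sub>R (Emat \<iota> j *v y))"
    unfolding amat_def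
    by (simp add: linear_sum[OF bounded_linear.linear[OF bounded_linear_matrix_vector_mult_right]]
        flip: scaleR_matrix_vector_assoc)
  have m: "(Emat \<iota> l *v y) $ Inr j = (if l = j then y $ Inl (\<iota> j) else 0)"
    "(Emat \<iota> l *v y) $ Inl k = (if k = \<iota> l then y $ Inr l else 0)" for l j k
    by (simp_all add: matrix_vector_mult_def Emat_def sum_UNIV_Plus
        if_distrib[of "\<lambda>x. x * _"] cong: if_cong)
  show "(amat \<iota> t *v y) $ Inr j = t j * y $ Inl (\<iota> j)"
    "(amat \<iota> t *v y) $ Inl (\<iota> j) = t j * y $ Inr j"
    by (simp_all add: E m if_distrib[of "\<lambda>x. _ * x"] cong: if_cong)
  show "(amat \<iota> t *v y) $ Inl k = 0" if "k \<notin> range \<iota>"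
    using that by (auto simp: E m intro!: sum.neutral)
qed

lemma vec_eq_inj:
  "x = y \<longleftrightarrow> (\<forall>j. x $ Inl (\<iota> j) = y $ Inl (\<iota> j)) \<and> (\<forall>k. k \<notin> range \<iota> \<longrightarrow> x $ Inl k = y $ Inl k)
     \<and> (\<forall>j. x $ Inr j = y $ Inr j)" for x y :: "real^('n + 'm)"
  unfolding vec_eq_Plus by (metis rangeE)

lemma amat_basis:
  "amat \<iota> t *v wplus \<iota> j = t j *\<^sub>R wplus \<iota> j"
  "amat \<iota> t *v wminus \<iota> j = - t j *\<^sub>R wminus \<iota> j"
  "k \<notin> range \<iota> \<Longrightarrow> amat \<iota> t *v evec k = 0"
  by (auto simp: vec_eq_inj amat_mult axis_def)

lemma amat_so: "amat \<iota> t \<in> so_nm"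
proof -
  \<comment> \<open>The right-hand side is antisymmetric in \<open>u\<close> and \<open>v\<close>,
    which is the skewness sought.\<close>
  have "form (amat \<iota> t *v u) v = (\<Sum>j\<in>UNIV. t j * (u $ Inr j * v $ Inl (\<iota> j) - u $ Inl (\<iota> j) * v $ Inr j))" for u v
  proof -
    have "(\<Sum>i\<in>UNIV. (amat \<iota> t *v u) $ Inl i * v $ Inl i)
        = (\<Sum>i\<in>range \<iota>. (amat \<iota> t *v u) $ Inl i * v $ Inl i)"
      by (rule sum.mono_neutral_right) (auto simp: amat_mult)
    also have "\<dots> = (\<Sum>j\<in>UNIV. (amat \<iota> t *v u) $ Inl (\<iota> j) * v $ Inl (\<iota> j))"
      by (simp add: sum.reindex[OF inj])
    finally show ?thesis
      by (simp add: form_def amat_mult algebra_simps sum_subtractf)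
  qed
  note f = this
  have "form (amat \<iota> t *v u) v + form (amat \<iota> t *v v) u = 0" for u v
    unfolding f sum.distrib[symmetric] by (rule sum.neutral) (simp add: algebra_simps)
  then show ?thesis
    unfolding so_nm_def by (simp add: form_commute)
qed

text \<open>\<open>wplus \<iota> j\<close> and \<open>wminus \<iota> j\<close> form a hyperbolic
  pair with product 2, so each coefficient is half the pairing with the opposite vector; the
  remaining \<open>evec k\<close> are orthonormal.\<close>

lemma basis_expansion:
  "y = (\<Sum>j\<in>UNIV. (form y (wminus \<iota> j) / 2) *\<^sub>R wplus \<iota> j)
     + (\<Sum>j\<in>UNIV. (form y (wplus \<iota> j) / 2) *\<^sub>R wminus \<iota> j)
     + (\<Sum>k\<in>- range \<iota>. y $ Inl k *\<^sub>R evec k)"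
proof -
  define a b where "a j = form y (wminus \<iota> j) / 2" and "b j = form y (wplus \<iota> j) / 2" for j
  have z: "(\<Sum>j\<in>UNIV. c j * unit (\<iota> j) k) = 0" if "k \<notin> range \<iota>" for k and c :: "'m \<Rightarrow> real"
    using that by (intro sum.neutral) auto
  have e: "(\<Sum>k\<in>- range \<iota>. y $ Inl k * unit k i) = (if i \<in> range \<iota> then 0 else y $ Inl i)" for i
    by (simp add: if_distrib[of "\<lambda>x. _ * x"] cong: if_cong)
  have u: "(\<Sum>j\<in>UNIV. c j * unit j l) = c l"
    "(\<Sum>j\<in>UNIV. c j * (if l = j then - 1 else 0)) = - c l" for l and c :: "'m \<Rightarrow> real"
    by (simp_all add: if_distrib[of "\<lambda>x. _ * x"] cong: if_cong)
  have y: "y $ Inl (\<iota> j) = a j + b j" "y $ Inr j = a j - b j" for j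
    by (simp_all add: a_def b_def form_wplus form_wminus field_simps)
  have "y = (\<Sum>j\<in>UNIV. a j *\<^sub>R wplus \<iota> j) + (\<Sum>j\<in>UNIV. b j *\<^sub>R wminus \<iota> j)
     + (\<Sum>k\<in>- range \<iota>. y $ Inl k *\<^sub>R evec k)"
    unfolding vec_eq_inj
    by (simp add: axis_def z e u) (simp add: y)
  then show ?thesis by (simp only: a_def b_def)
qed

text \<open>Sum \<open>wedge (X *v b) b'\<close> over a basis b and its dual basis b'. The first
  half of each wedge adds up to \<open>X\<close>, and by skewness so does the second, whence the
  outer factor 1/2. A root vector is thereby determined by its values on weight vectors.\<close>

lemma so_expansion:
  assumes "X \<in> so_nm"
  shows "X = (1/2) *\<^sub>R ((\<Sum>j\<in>UNIV. (1/2) *\<^sub>R wedge (X *v wplus \<iota> j) (wminus \<iota> j))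
     + (\<Sum>j\<in>UNIV. (1/2) *\<^sub>R wedge (X *v wminus \<iota> j) (wplus \<iota> j))
     + (\<Sum>k\<in>- range \<iota>. wedge (X *v evec k) (evec k)))" (is "X = (1/2) *\<^sub>R ?R")
proof -
  define R where "R = ?R"
  have "X *v y = ((1/2) *\<^sub>R R) *v y" for y
  proof -
    note lin = linear_sum[OF bounded_linear.linear[OF bounded_linear_matrix_vector_mult_right]]
    have skew: "form (X *v u) y = - form (X *v y) u" for u
      using so_skew[OF assms, of u y] by (simp add: form_commute)
    have "R *v y = (\<Sum>j\<in>UNIV. (1/2) *\<^sub>R (form y (wminus \<iota> j) *\<^sub>R (X *v wplus \<iota> j) + form (X *v y) (wplus \<iota> j) *\<^sub>R wminus \<iota> j))
     + (\<Sum>j\<in>UNIV. (1/2) *\<^sub>R (form y (wplus \<iota> j) *\<^sub>R (X *v wminus \<iota> j) + form (X *v y) (wminus \<iota> j) *\<^sub>R wplus \<iota> j))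
     + (\<Sum>k\<in>- range \<iota>. y $ Inl k *\<^sub>R (X *v evec k) + (X *v y) $ Inl k *\<^sub>R evec k)"
      unfolding R_def using skew[of "evec _"]
      by (simp add: matrix_vector_mult_add_rdistrib lin wedge_mult skew form_commute[of "wplus \<iota> _" y]
          form_commute[of "wminus \<iota> _" y] flip: scaleR_matrix_vector_assoc)
    also have "\<dots> = X *v ((\<Sum>j\<in>UNIV. (form y (wminus \<iota> j) / 2) *\<^sub>R wplus \<iota> j)
        + (\<Sum>j\<in>UNIV. (form y (wplus \<iota> j) / 2) *\<^sub>R wminus \<iota> j)
        + (\<Sum>k\<in>- range \<iota>. y $ Inl k *\<^sub>R evec k))
      + ((\<Sum>j\<in>UNIV. (form (X *v y) (wminus \<iota> j) / 2) *\<^sub>R wplus \<iota> j)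
        + (\<Sum>j\<in>UNIV. (form (X *v y) (wplus \<iota> j) / 2) *\<^sub>R wminus \<iota> j)
        + (\<Sum>k\<in>- range \<iota>. (X *v y) $ Inl k *\<^sub>R evec k))"
      by (simp add: matrix_vector_right_distrib linear_sum[OF matrix_vector_mul_linear]
          matrix_vector_mult_scaleR sum.distrib scaleR_add_right)
    also have "\<dots> = X *v y + X *v y"
      by (simp only: basis_expansion[symmetric])
    finally have "R *v y = X *v y + X *v y" .
    then show ?thesis
      using scaleR_half_double[of "X *v y"] scaleR_matrix_vector_assoc[of "1/2" R y] by simp
  qed
  then have "X = (1/2) *\<^sub>R R" by (intro matrix_eq[THEN iffD2] allI)
  then show ?thesis by (simp only: R_def)
qed

lemma weight_vec_basis:
  "weight_vec \<iota> (unit j) (wplus \<iota> j)"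
  "weight_vec \<iota> (\<lambda>l. - unit j l) (wminus \<iota> j)"
  "k \<notin> range \<iota> \<Longrightarrow> weight_vec \<iota> (\<lambda>_. 0) (evec k)"
  by (simp_all add: weight_vec_def amat_basis if_distrib[of "\<lambda>x. x * _"] sum_negf cong: if_cong)

text \<open>Only \<open>E\<^sub>l\<close> is tested: it swaps the two coordinates with index l and
  annihilates all others.\<close>

lemma weight_vec_unit:
  assumes "weight_vec \<iota> g y"
  shows "y $ Inl (\<iota> l) = g l * y $ Inr l" "y $ Inr l = g l * y $ Inl (\<iota> l)"
    and "j \<noteq> l \<Longrightarrow> g l * y $ Inr j = 0"
    and "i \<noteq> \<iota> l \<Longrightarrow> g l * y $ Inl i = 0"
proof -
  have "amat \<iota> (unit l) *v y = (\<Sum>j\<in>UNIV. g j * unit l j) *\<^sub>R y"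
    using assms by (simp add: weight_vec_def)
  then have e: "amat \<iota> (unit l) *v y = g l *\<^sub>R y"
    by (simp add: if_distrib[of "\<lambda>x. _ * x"] cong: if_cong)
  have n: "(amat \<iota> (unit l) *v y) $ p = g l * y $ p" for p
    by (simp add: e)
  show "y $ Inl (\<iota> l) = g l * y $ Inr l" "y $ Inr l = g l * y $ Inl (\<iota> l)"
    using n[of "Inr l"] n[of "Inl (\<iota> l)"] by (simp_all add: amat_mult)
  show "g l * y $ Inr j = 0" if "j \<noteq> l"
    using n[of "Inr j"] that by (simp add: amat_mult)
  show "g l * y $ Inl i = 0" if "i \<noteq> \<iota> l"
    using n[of "Inl i"] that by (cases "i \<in> range \<iota>") (auto simp: amat_mult)
qed

text \<open>A nonzero \<open>g l\<close> confines \<open>y\<close> to the two coordinates with index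
  l; two such indices leave nothing.\<close>

lemma weight_vec_two:
  assumes w: "weight_vec \<iota> g y" and "g l \<noteq> 0" "g l' \<noteq> 0" "l \<noteq> l'"
  shows "y = 0"
  unfolding vec_eq_Plus
proof (intro conjI allI)
  fix i
  show "y $ Inl i = 0 $ Inl i"
    using weight_vec_unit(4)[OF w, of i l] weight_vec_unit(4)[OF w, of i l'] assms(2-4)
    by (cases "i = \<iota> l") auto
next
  fix j
  show "y $ Inr j = 0 $ Inr j"
    using weight_vec_unit(3)[OF w, of j l] weight_vec_unit(3)[OF w, of j l'] assms(2-4)
    by (cases "j = l") auto
qed

text \<open>\<open>E\<^sub>l\<close> has no eigenvalues besides 0, 1 and -1.\<close>

lemma weight_vec_not_unit:
  assumes w: "weight_vec \<iota> g y" and "g l \<noteq> 0" "g l * g l \<noteq> 1"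
  shows "y = 0"
proof -
  have "y $ Inr l * (g l * g l - 1) = 0"
    using weight_vec_unit(1,2)[OF w, of l] by (simp add: algebra_simps)
  then have "y $ Inr l = 0" using assms by simp
  moreover from this have "y $ Inl (\<iota> l) = 0"
    using weight_vec_unit(1)[OF w, of l] by simp
  moreover have "y $ Inr j = 0" if "j \<noteq> l" for j
    using weight_vec_unit(3)[OF w that] assms(2) by simp
  moreover have "y $ Inl i = 0" if "i \<noteq> \<iota> l" for i
    using weight_vec_unit(4)[OF w that] assms(2) by simp
  ultimately show ?thesis
    unfolding vec_eq_Plus by (metis zero_index)
qed

lemma weight_vec_one:
  assumes w: "weight_vec \<iota> g y" and "g l = 1"
  shows "y = y $ Inr l *\<^sub>R wplus \<iota> l"
  unfolding vec_eq_Plus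
  using weight_vec_unit(1)[OF w, of l] weight_vec_unit(3,4)[OF w, of _ l] assms(2) by auto

lemma weight_vec_zero:
  assumes w: "weight_vec \<iota> (\<lambda>_. 0) y"
  shows "y = (\<Sum>k\<in>- range \<iota>. y $ Inl k *\<^sub>R evec k)"
  by (subst basis_expansion)
     (use weight_vec_unit(1,2)[OF w] in \<open>simp add: form_wplus form_wminus\<close>)

text \<open>Ladder argument: T(Xy) = X(Ty) + \<alpha>(T) Xy. Whenever the shifted weight does not
  occur, this forces X y = 0.\<close>

lemma root_space_weight:
  assumes "X \<in> root_space \<iota> \<alpha>" "\<And>t. \<alpha> (amat \<iota> t) = (\<Sum>l\<in>UNIV. a l * t l)" "weight_vec \<iota> g y"
  shows "weight_vec \<iota> (\<lambda>l. a l + g l) (X *v y)"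
  unfolding weight_vec_def
proof
  fix t
  have "amat \<iota> t ** X - X ** amat \<iota> t = \<alpha> (amat \<iota> t) *\<^sub>R X"
    using assms(1) by (simp add: root_space_def afrak_eq)
  then have "(amat \<iota> t ** X) *v y = (X ** amat \<iota> t + \<alpha> (amat \<iota> t) *\<^sub>R X) *v y"
    by (metis add.commute diff_add_cancel)
  then show "amat \<iota> t *v (X *v y) = (\<Sum>l\<in>UNIV. (a l + g l) * t l) *\<^sub>R (X *v y)"
    using assms(2,3)
    by (simp add: weight_vec_def matrix_vector_mult_add_rdistrib matrix_vector_mult_scaleR
        distrib_right sum.distrib scaleR_add_left add.commute
        flip: matrix_vector_mul_assoc scaleR_matrix_vector_assoc)
qed

lemma wedge_root_space:
  assumes "weight_vec \<iota> g x" "weight_vec \<iota> g' y" "\<And>t. \<alpha> (amat \<iota> t) = (\<Sum>l\<in>UNIV. (g l + g' l) * t l)"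
  shows "wedge x y \<in> root_space \<iota> \<alpha>"
proof -
  have "amat \<iota> t ** wedge x y - wedge x y ** amat \<iota> t = \<alpha> (amat \<iota> t) *\<^sub>R wedge x y" for t
    unfolding wedge_commutator[OF amat_so] using assms
    by (simp add: weight_vec_def matrix_eq wedge_mult distrib_right sum.distrib algebra_simps
        flip: scaleR_matrix_vector_assoc)
  then show ?thesis by (auto simp: root_space_def wedge_so afrak_eq)
qed

lemma subspace_root_space: "subspace (root_space \<iota> \<alpha>)"
proof (rule subspaceI)
  show "0 \<in> root_space \<iota> \<alpha>"
    using subspace_0[OF subspace_so] by (simp add: root_space_def)
next
  fix X Y assume "X \<in> root_space \<iota> \<alpha>" "Y \<in> root_space \<iota> \<alpha>"
  then show "X + Y \<in> root_space \<iota> \<alpha>"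
    using subspace_add[OF subspace_so, of X Y]
    by (simp add: root_space_def matrix_add_ldistrib scaleR_add_right
        linear_add[OF bounded_linear.linear[OF bounded_linear_matrix_mult_right]] add_diff_add)
next
  fix X c assume "X \<in> root_space \<iota> \<alpha>"
  then show "c *\<^sub>R X \<in> root_space \<iota> \<alpha>"
    using subspace_scale[OF subspace_so, of X c]
    by (simp add: root_space_def matrix_scalar_ac mult.commute
        flip: scalar_matrix_assoc scaleR_diff_right)
qed

end

lemma sum_unit [simp]: "(\<Sum>l\<in>UNIV. unit j l * t l) = t j"
  for j :: "'k::finite"
  by (simp add: if_distrib[of "\<lambda>x. x * _"] cong: if_cong)

lemma uminus_matrix_vector: "(- A) *v x = - (A *v x)"
  for A :: "real^'k::finite^'l::finite"
  using scaleR_matrix_vector_assoc[of "-1" A x] by simp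

lemma linear_wedge_left: "linear (\<lambda>x. wedge x b)"
  by (rule linearI)
     (simp_all add: matrix_eq wedge_mult algebra_simps flip: scaleR_matrix_vector_assoc)

lemma mult_wplus_zero_lift: "(\<And>l. X *v wplus \<iota> l = 0) \<Longrightarrow> X *v lift (base_point \<iota>) y = 0"
  by (simp add: lift_base_point linear_sum[OF matrix_vector_mul_linear] matrix_vector_mult_scaleR)

section \<open>Root spaces of the positive roots and their dimensions\<close>

context
  fixes \<iota> :: "'m::finite \<Rightarrow> 'n::finite"
  assumes inj: "inj \<iota>"
begin

lemmas basis_pairings = form_basis[OF inj] iota_eq[OF inj] Edual_amat[OF inj]

text \<open>After the shift by the root, the weights of \<open>wplus \<iota> l\<close>, of
  \<open>evec k\<close>, and of \<open>wminus \<iota> l\<close> with l other than i and j no longer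
  occur, so these vectors are killed, while \<open>wminus \<iota> j\<close> and
  \<open>wminus \<iota> i\<close> go to multiples of \<open>wplus \<iota> i\<close> and
  \<open>wplus \<iota> j\<close>. By \<open>so_expansion\<close>, X is then a multiple of a single
  wedge.\<close>

lemma root_space_plus:
  assumes "i \<noteq> j"
  shows "root_space \<iota> (\<lambda>T. Edual \<iota> j T + Edual \<iota> i T) = span {wedge (wplus \<iota> j) (wplus \<iota> i)}"
proof (rule antisym)
  let ?\<alpha> = "\<lambda>T :: real^('n + 'm)^('n + 'm). Edual \<iota> j T + Edual \<iota> i T"
  have \<alpha>: "?\<alpha> (amat \<iota> t) = (\<Sum>l\<in>UNIV. (unit j l + unit i l) * t l)" for t
    by (simp add: basis_pairings distrib_right sum.distrib)
  show "span {wedge (wplus \<iota> j) (wplus \<iota> i)} \<subseteq> root_space \<iota> ?\<alpha>"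
    by (rule span_minimal)
       (simp_all add: subspace_root_space[OF inj] wedge_root_space[OF inj weight_vec_basis(1)[OF inj]
          weight_vec_basis(1)[OF inj] \<alpha>])
  show "root_space \<iota> ?\<alpha> \<subseteq> span {wedge (wplus \<iota> j) (wplus \<iota> i)}"
  proof
    fix X assume X: "X \<in> root_space \<iota> ?\<alpha>"
    then have so: "X \<in> so_nm" by (simp add: root_space_def)
    note w = root_space_weight[OF inj X \<alpha>]
    have p: "X *v wplus \<iota> l = 0" for l
    proof (cases "l = i \<or> l = j")
      case True
      then show ?thesis
        using weight_vec_not_unit[OF inj w[OF weight_vec_basis(1)[OF inj, of l]], of l] assms by auto
    next
      case False
      then show ?thesis
        using weight_vec_two[OF inj w[OF weight_vec_basis(1)[OF inj, of l]], of i j] assms by auto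
    qed
    have e: "X *v evec k = 0" if "k \<notin> range \<iota>" for k
      using weight_vec_two[OF inj w[OF weight_vec_basis(3)[OF inj that]], of i j] assms by auto
    have m: "X *v wminus \<iota> l = 0" if "l \<noteq> i" "l \<noteq> j" for l
      using weight_vec_two[OF inj w[OF weight_vec_basis(2)[OF inj, of l]], of i j] assms that by auto
    define a where "a = (X *v wminus \<iota> j) $ Inr i"
    define b where "b = (X *v wminus \<iota> i) $ Inr j"
    have mj: "X *v wminus \<iota> j = a *\<^sub>R wplus \<iota> i" unfolding a_def
      by (rule weight_vec_one[OF inj w[OF weight_vec_basis(2)[OF inj, of j]]]) (use assms in auto)
    have mi: "X *v wminus \<iota> i = b *\<^sub>R wplus \<iota> j" unfolding b_def
      by (rule weight_vec_one[OF inj w[OF weight_vec_basis(2)[OF inj, of i]]]) (use assms in auto)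
    have "(\<Sum>l\<in>UNIV. (1/2) *\<^sub>R wedge (X *v wminus \<iota> l) (wplus \<iota> l))
        = (\<Sum>l\<in>{i, j}. (1/2) *\<^sub>R wedge (X *v wminus \<iota> l) (wplus \<iota> l))"
      by (rule sum.mono_neutral_right) (auto simp: m linear_0[OF linear_wedge_left])
    also have "\<dots> = (1/2) *\<^sub>R (b *\<^sub>R wedge (wplus \<iota> j) (wplus \<iota> i) + a *\<^sub>R wedge (wplus \<iota> i) (wplus \<iota> j))"
      using assms by (simp add: mi mj linear_cmul[OF linear_wedge_left] scaleR_add_right)
    also have "wedge (wplus \<iota> i) (wplus \<iota> j) = - wedge (wplus \<iota> j) (wplus \<iota> i)"
      by (simp add: matrix_eq wedge_mult uminus_matrix_vector)
    finally have "X = (1/2) *\<^sub>R (1/2) *\<^sub>R (b *\<^sub>R wedge (wplus \<iota> j) (wplus \<iota> i) + a *\<^sub>R (- wedge (wplus \<iota> j) (wplus \<iota> i)))"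
      using so_expansion[OF inj so] by (simp add: p e linear_0[OF linear_wedge_left])
    then show "X \<in> span {wedge (wplus \<iota> j) (wplus \<iota> i)}"
      by (metis insertI1 span_add span_base span_neg span_scale)
  qed
qed

text \<open>Adding \<open>E\<^sub>j\<^sup>*\<close> gives a weight only from
  \<open>wminus \<iota> j\<close>, which goes to weight 0, and from the \<open>evec k\<close>, which
  go to multiples of \<open>wplus \<iota> j\<close>. If n = m there is no such k and the space is
  0.\<close>

lemma root_space_single:
  "root_space \<iota> (Edual \<iota> j) = span (wedge (wplus \<iota> j) ` evec ` (- range \<iota>))"
proof (rule antisym)
  let ?S = "span (wedge (wplus \<iota> j) ` evec ` (- range \<iota>))"
  \<comment> \<open>The summand \<open>0\<close> is the weight of \<open>evec k\<close>; it is
    written out to match the sum of two weights in \<open>wedge_root_space\<close>.\<close>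
  have \<alpha>: "Edual \<iota> j (amat \<iota> t) = (\<Sum>l\<in>UNIV. (unit j l + 0) * t l)" for t
    by (simp add: basis_pairings)
  have \<alpha>': "Edual \<iota> j (amat \<iota> t) = (\<Sum>l\<in>UNIV. unit j l * t l)" for t
    by (simp add: basis_pairings)
  show "?S \<subseteq> root_space \<iota> (Edual \<iota> j)"
    by (rule span_minimal)
       (auto simp: subspace_root_space[OF inj]
          intro!: wedge_root_space[OF inj weight_vec_basis(1)[OF inj] weight_vec_basis(3)[OF inj] \<alpha>])
  show "root_space \<iota> (Edual \<iota> j) \<subseteq> ?S"
  proof
    fix X assume X: "X \<in> root_space \<iota> (Edual \<iota> j)"
    then have so: "X \<in> so_nm" by (simp add: root_space_def)
    note w = root_space_weight[OF inj X \<alpha>']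
    have p: "X *v wplus \<iota> l = 0" for l
    proof (cases "l = j")
      case True
      then show ?thesis
        using weight_vec_not_unit[OF inj w[OF weight_vec_basis(1)[OF inj, of l]], of l] by auto
    next
      case False
      then show ?thesis
        using weight_vec_two[OF inj w[OF weight_vec_basis(1)[OF inj, of l]], of l j] by auto
    qed
    have m: "X *v wminus \<iota> l = 0" if "l \<noteq> j" for l
      using weight_vec_two[OF inj w[OF weight_vec_basis(2)[OF inj, of l]], of l j] that by auto
    have e: "X *v evec k = (X *v evec k) $ Inr j *\<^sub>R wplus \<iota> j" if "k \<notin> range \<iota>" for k
      by (rule weight_vec_one[OF inj w[OF weight_vec_basis(3)[OF inj that]]]) auto
    define z where "z k = (X *v wminus \<iota> j) $ Inl k" for k
    have mj: "X *v wminus \<iota> j = (\<Sum>k\<in>- range \<iota>. z k *\<^sub>R evec k)"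
      unfolding z_def
      by (rule weight_vec_zero[OF inj weight_vec_cong[OF w[OF weight_vec_basis(2)[OF inj, of j]]]]) auto
    have anti: "wedge x (wplus \<iota> j) = - wedge (wplus \<iota> j) x" for x
      by (simp add: matrix_eq wedge_mult uminus_matrix_vector)
    have gen: "wedge (wplus \<iota> j) (evec k) \<in> ?S" if "k \<notin> range \<iota>" for k
      using that by (intro span_base) auto
    have "(\<Sum>l\<in>UNIV. (1/2) *\<^sub>R wedge (X *v wminus \<iota> l) (wplus \<iota> l))
        = (\<Sum>l\<in>{j}. (1/2) *\<^sub>R wedge (X *v wminus \<iota> l) (wplus \<iota> l))"
      by (rule sum.mono_neutral_right) (auto simp: m linear_0[OF linear_wedge_left])
    also have "\<dots> = (1/2) *\<^sub>R (\<Sum>k\<in>- range \<iota>. z k *\<^sub>R - wedge (wplus \<iota> j) (evec k))"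
      by (simp add: mj linear_sum[OF linear_wedge_left] linear_cmul[OF linear_wedge_left] anti[of "evec _"])
    also have "\<dots> \<in> ?S"
      by (intro span_scale span_sum span_neg gen) auto
    finally have 1: "(\<Sum>l\<in>UNIV. (1/2) *\<^sub>R wedge (X *v wminus \<iota> l) (wplus \<iota> l)) \<in> ?S" .
    have "wedge (X *v evec k) (evec k) \<in> ?S" if "k \<notin> range \<iota>" for k
      by (subst e[OF that]) (simp add: linear_cmul[OF linear_wedge_left] span_scale gen that)
    then have 2: "(\<Sum>k\<in>- range \<iota>. wedge (X *v evec k) (evec k)) \<in> ?S"
      by (intro span_sum) auto
    have 3: "(\<Sum>l\<in>UNIV. (1/2) *\<^sub>R wedge (X *v wplus \<iota> l) (wminus \<iota> l)) = 0"
      by (simp add: p linear_0[OF linear_wedge_left])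
    show "X \<in> ?S"
      by (subst so_expansion[OF inj so], intro span_scale span_add 1 2) (simp add: 3 span_zero)
  qed
qed

lemma dim_root_space_plus:
  assumes "i \<noteq> j"
  shows "dim (root_space \<iota> (\<lambda>T. Edual \<iota> j T + Edual \<iota> i T)) = 1"
proof -
  have "wedge (wplus \<iota> j) (wplus \<iota> i) *v wminus \<iota> i \<noteq> 0"
  proof
    assume "wedge (wplus \<iota> j) (wplus \<iota> i) *v wminus \<iota> i = 0"
    then have "(wedge (wplus \<iota> j) (wplus \<iota> i) *v wminus \<iota> i) $ Inr j = 0" by simp
    with assms show False by (simp add: wedge_mult basis_pairings)
  qed
  then have "wedge (wplus \<iota> j) (wplus \<iota> i) \<noteq> 0" by auto
  then show ?thesis
    by (simp add: root_space_plus[OF assms] dim_singleton)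
qed

text \<open>Wedging with \<open>wplus \<iota> j\<close> is injective on the span of the
  \<open>evec k\<close>: evaluation at \<open>wminus \<iota> j\<close>, which is orthogonal to that
  span, returns -2 times the other factor.\<close>

lemma dim_root_space_single:
  "dim (root_space \<iota> (Edual \<iota> j)) = CARD('n) - CARD('m)"
proof -
  let ?E = "evec ` (- range \<iota>) :: (real^('n + 'm)) set"
  have "?E \<subseteq> Basis" by (auto simp: axis_in_Basis_iff)
  then have ind: "independent ?E" by (rule independent_mono[OF independent_Basis])
  have "inj_on (wedge (wplus \<iota> j)) (span ?E)"
  proof (subst linear_inj_on_iff_eq_0[OF linear_wedge subspace_span], intro ballI impI)
    fix z assume z: "z \<in> span ?E" and 0: "wedge (wplus \<iota> j) z = 0"
    have "span ?E \<subseteq> {z. form z (wminus \<iota> j) = 0}"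
    proof (rule span_minimal)
      show "subspace {z. form z (wminus \<iota> j) = 0}" by (rule subspaceI) auto
    qed auto
    with z have "form z (wminus \<iota> j) = 0" by auto
    moreover have "wedge (wplus \<iota> j) z *v wminus \<iota> j = 0" by (simp add: 0)
    ultimately show "z = 0" by (simp add: wedge_mult basis_pairings)
  qed
  then have "dim (wedge (wplus \<iota> j) ` ?E) = dim ?E"
    by (rule dim_image_eq[OF linear_wedge])
  also have "\<dots> = card (- range \<iota>)"
    using dim_eq_card_independent[OF ind]
    by (simp add: card_image inj_on_def axis_eq_axis)
  also have "\<dots> = CARD('n) - CARD('m)"
    by (simp add: Compl_eq_Diff_UNIV card_Diff_subset card_image[OF inj])
  finally show ?thesis by (simp add: root_space_single)
qed

text \<open>Here only the action on the plane of the base point is determined, not the whole root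
  space: these roots vanish on \<open>afrak0 \<iota>\<close> and their multiplicities do not enter
  \<open>rho0\<close>.\<close>

lemma root_space_minus:
  assumes "i \<noteq> j" and X: "X \<in> root_space \<iota> (\<lambda>T. Edual \<iota> j T - Edual \<iota> i T)"
  shows "l \<noteq> i \<Longrightarrow> X *v wplus \<iota> l = 0" and "X *v wplus \<iota> i = (X *v wplus \<iota> i) $ Inr j *\<^sub>R wplus \<iota> j"
proof -
  have \<alpha>: "Edual \<iota> j (amat \<iota> t) - Edual \<iota> i (amat \<iota> t) = (\<Sum>l\<in>UNIV. (unit j l - unit i l) * t l)" for t
    by (simp add: basis_pairings left_diff_distrib sum_subtractf)
  note w = root_space_weight[OF inj X \<alpha>]
  show "X *v wplus \<iota> l = 0" if "l \<noteq> i"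
  proof (cases "l = j")
    case True
    then show ?thesis
      using weight_vec_not_unit[OF inj w[OF weight_vec_basis(1)[OF inj, of l]], of l] assms by auto
  next
    case False
    then show ?thesis
      using weight_vec_two[OF inj w[OF weight_vec_basis(1)[OF inj, of l]], of i j] assms that by auto
  qed
  show "X *v wplus \<iota> i = (X *v wplus \<iota> i) $ Inr j *\<^sub>R wplus \<iota> j"
    by (rule weight_vec_one[OF inj w[OF weight_vec_basis(1)[OF inj, of i]]]) (use assms in auto)
qed

lemma root_space_plus_wplus:
  assumes "i \<noteq> j" "X \<in> root_space \<iota> (\<lambda>T. Edual \<iota> j T + Edual \<iota> i T)"
  shows "X *v wplus \<iota> l = 0"
proof -
  have "root_space \<iota> (\<lambda>T. Edual \<iota> j T + Edual \<iota> i T) \<subseteq> {X. X *v wplus \<iota> l = 0}"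
    unfolding root_space_plus[OF assms(1)]
    by (rule span_minimal)
       (auto simp: wedge_mult basis_pairings matrix_vector_mult_add_rdistrib
         intro!: subspaceI simp flip: scaleR_matrix_vector_assoc)
  with assms show ?thesis by auto
qed

lemma root_space_single_wplus:
  assumes "X \<in> root_space \<iota> (Edual \<iota> j)"
  shows "X *v wplus \<iota> l = 0"
proof -
  have "root_space \<iota> (Edual \<iota> j) \<subseteq> {X. X *v wplus \<iota> l = 0}"
    unfolding root_space_single
    by (rule span_minimal)
       (auto simp: wedge_mult basis_pairings matrix_vector_mult_add_rdistrib
         intro!: subspaceI simp flip: scaleR_matrix_vector_assoc)
  with assms show ?thesis by auto
qed

end

section \<open>The nilpotent algebra \<open>nfrak\<close> and the value of
  \<open>rho0\<close>\<close>

context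
  fixes \<iota> :: "'m::{finite,linorder} \<Rightarrow> 'n::finite"
  assumes inj: "inj \<iota>"
begin

lemma nfrak_so: "X \<in> nfrak \<iota> \<Longrightarrow> X \<in> so_nm"
  unfolding nfrak_def
  using span_minimal[OF _ subspace_so, of "\<Union>\<alpha>\<in>pos_roots \<iota>. root_space \<iota> \<alpha>"]
  by (auto simp: root_space_def)

text \<open>The matrices that preserve the plane of the base point and act on it strictly
  triangularly form a subspace, so root vectors suffice. Those for
  \<open>E\<^sub>j\<^sup>* + E\<^sub>i\<^sup>*\<close> and \<open>E\<^sub>j\<^sup>*\<close> act by
  0, those for \<open>E\<^sub>j\<^sup>* - E\<^sub>i\<^sup>*\<close> by a matrix with a single
  entry.\<close>

lemma nfrak_triangular:
  assumes "X \<in> nfrak \<iota>"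
  shows "\<exists>Z. triangular Z \<and> (\<forall>y. X *v lift (base_point \<iota>) y = lift (base_point \<iota>) (Z *v y))"
proof -
  let ?P = "{X :: real^('n + 'm)^('n + 'm).
    \<exists>Z. triangular Z \<and> (\<forall>y. X *v lift (base_point \<iota>) y = lift (base_point \<iota>) (Z *v y))}"
  note add = linear_add[OF linear_lift] and scale = linear_cmul[OF linear_lift] and z = linear_0[OF linear_lift]
  have "nfrak \<iota> \<subseteq> ?P"
    unfolding nfrak_def
  proof (rule span_minimal)
    show "subspace ?P"
    proof (rule subspaceI)
      show "0 \<in> ?P" by (auto intro!: exI[of _ 0] simp: triangular_def z)
    next
      fix X Y assume "X \<in> ?P" "Y \<in> ?P"
      then obtain U V where UV: "triangular U" "triangular V"
        "\<And>y. X *v lift (base_point \<iota>) y = lift (base_point \<iota>) (U *v y)"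
        "\<And>y. Y *v lift (base_point \<iota>) y = lift (base_point \<iota>) (V *v y)" by auto
      then show "X + Y \<in> ?P"
        by (auto intro!: exI[of _ "U + V"] simp: triangular_def matrix_vector_mult_add_rdistrib add)
    next
      fix X c assume "X \<in> ?P"
      then obtain U where U: "triangular U"
        "\<And>y. X *v lift (base_point \<iota>) y = lift (base_point \<iota>) (U *v y)" by auto
      then show "c *\<^sub>R X \<in> ?P"
        by (auto intro!: exI[of _ "c *\<^sub>R U"] simp: triangular_def scale simp flip: scaleR_matrix_vector_assoc)
    qed
    show "(\<Union>\<alpha>\<in>pos_roots \<iota>. root_space \<iota> \<alpha>) \<subseteq> ?P"
    proof
      fix X assume "X \<in> (\<Union>\<alpha>\<in>pos_roots \<iota>. root_space \<iota> \<alpha>)"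
      then consider i j where "i < j" "X \<in> root_space \<iota> (\<lambda>T. Edual \<iota> j T + Edual \<iota> i T)"
        | i j where "i < j" "X \<in> root_space \<iota> (\<lambda>T. Edual \<iota> j T - Edual \<iota> i T)"
        | j where "X \<in> root_space \<iota> (Edual \<iota> j)"
        unfolding pos_roots_def by blast
      then show "X \<in> ?P"
      proof cases
        case 1
        then have "X *v lift (base_point \<iota>) y = 0" for y
          by (intro mult_wplus_zero_lift root_space_plus_wplus[OF inj, of i j]) auto
        then show ?thesis by (auto intro!: exI[of _ 0] simp: triangular_def z)
      next
        case 3
        then have "X *v lift (base_point \<iota>) y = 0" for y
          by (intro mult_wplus_zero_lift root_space_single_wplus[OF inj, of _ j]) auto
        then show ?thesis by (auto intro!: exI[of _ 0] simp: triangular_def z)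
      next
        case 2
        then have ij: "i \<noteq> j" by auto
        note r = root_space_minus[OF inj ij 2(2)]
        define c where "c = (X *v wplus \<iota> i) $ Inr j"
        have r2: "X *v wplus \<iota> i = c *\<^sub>R wplus \<iota> j"
          using r(2) unfolding c_def .
        define Z :: "((real, 'm) vec, 'm) vec" where "Z = (\<chi> p q. if p = j \<and> q = i then c else 0)"
        have "X *v lift (base_point \<iota>) y = lift (base_point \<iota>) (Z *v y)" for y
        proof -
          have Zy: "(Z *v y) $ j = y $ i * c"
            by (simp add: Z_def matrix_vector_mult_def if_distrib[of "\<lambda>x. x * _"] cong: if_cong)
          have "X *v lift (base_point \<iota>) y = (\<Sum>l\<in>UNIV. y $ l *\<^sub>R (X *v wplus \<iota> l))"
            by (simp add: lift_base_point linear_sum[OF matrix_vector_mul_linear] matrix_vector_mult_scaleR)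
          also have "\<dots> = (\<Sum>l\<in>{i}. y $ l *\<^sub>R (X *v wplus \<iota> l))"
            by (rule sum.mono_neutral_right) (auto simp: r(1))
          also have "\<dots> = (y $ i * c) *\<^sub>R wplus \<iota> j"
            by (simp add: r2)
          also have "\<dots> = (\<Sum>l\<in>{j}. (Z *v y) $ l *\<^sub>R wplus \<iota> l)"
            by (simp add: Zy)
          also have "\<dots> = lift (base_point \<iota>) (Z *v y)"
            unfolding lift_base_point
            by (rule sum.mono_neutral_left) (auto simp: Z_def matrix_vector_mult_def)
          finally show ?thesis .
        qed
        moreover have "triangular Z" using 2(1) by (auto simp: triangular_def Z_def)
        ultimately show ?thesis by auto
      qed
    qed
  qed
  with assms show ?thesis by blast
qed

text \<open>The explicit elements whose exponentials perform the Iwasawa steps. In the second family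
  the indices may come in either order, because \<open>wedge\<close> is antisymmetric.\<close>

lemma nfrak_wedge:
  "i < j \<Longrightarrow> wedge (wplus \<iota> j) (wminus \<iota> i) \<in> nfrak \<iota>"
  "i \<noteq> j \<Longrightarrow> wedge (wplus \<iota> j) (wplus \<iota> i) \<in> nfrak \<iota>"
  "k \<notin> range \<iota> \<Longrightarrow> wedge (wplus \<iota> j) (evec k) \<in> nfrak \<iota>"
proof -
  have gen: "X \<in> nfrak \<iota>" if "X \<in> root_space \<iota> \<alpha>" "\<alpha> \<in> pos_roots \<iota>" for X \<alpha>
    unfolding nfrak_def by (intro span_base) (use that in auto)
  show "wedge (wplus \<iota> j) (wminus \<iota> i) \<in> nfrak \<iota>" if "i < j"
  proof (rule gen)
    show "wedge (wplus \<iota> j) (wminus \<iota> i) \<in> root_space \<iota> (\<lambda>T. Edual \<iota> j T - Edual \<iota> i T)"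
      by (rule wedge_root_space[OF inj weight_vec_basis(1)[OF inj] weight_vec_basis(2)[OF inj]])
         (simp add: basis_pairings[OF inj] distrib_right sum.distrib left_diff_distrib sum_subtractf)
  qed (use that in \<open>auto simp: pos_roots_def\<close>)
  have p: "wedge (wplus \<iota> j) (wplus \<iota> i) \<in> nfrak \<iota>" if "i < j" for i j
  proof (rule gen)
    show "wedge (wplus \<iota> j) (wplus \<iota> i) \<in> root_space \<iota> (\<lambda>T. Edual \<iota> j T + Edual \<iota> i T)"
      using that by (subst root_space_plus[OF inj]) (auto intro: span_base)
  qed (use that in \<open>auto simp: pos_roots_def\<close>)
  show "wedge (wplus \<iota> j) (wplus \<iota> i) \<in> nfrak \<iota>" if "i \<noteq> j"
  proof (cases "i < j")
    case False
    with that have "wedge (wplus \<iota> i) (wplus \<iota> j) \<in> nfrak \<iota>" by (intro p) auto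
    then have "- wedge (wplus \<iota> i) (wplus \<iota> j) \<in> nfrak \<iota>"
      unfolding nfrak_def by (rule span_neg)
    moreover have "wedge (wplus \<iota> j) (wplus \<iota> i) = - wedge (wplus \<iota> i) (wplus \<iota> j)"
      by (simp add: matrix_eq wedge_mult uminus_matrix_vector)
    ultimately show ?thesis by simp
  qed (rule p)
  show "wedge (wplus \<iota> j) (evec k) \<in> nfrak \<iota>" if "k \<notin> range \<iota>"
  proof (rule gen)
    show "wedge (wplus \<iota> j) (evec k) \<in> root_space \<iota> (Edual \<iota> j)"
      using that by (subst root_space_single[OF inj]) (auto intro: span_base)
  qed (auto simp: pos_roots_def)
qed

text \<open>The count m(m-1)/2 in a form without division: the swap matches the pairs below the
  diagonal with those above it.\<close>

lemma card_less_pairs: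
  "2 * card {p :: 'm \<times> 'm. fst p < snd p} + CARD('m) = CARD('m) * CARD('m)"
proof -
  have "bij_betw prod.swap {p :: 'm \<times> 'm. fst p < snd p} {p. snd p < fst p}"
    by (rule bij_betwI[where g = prod.swap]) auto
  then have s: "card {p :: 'm \<times> 'm. snd p < fst p} = card {p :: 'm \<times> 'm. fst p < snd p}"
    by (simp add: bij_betw_same_card)
  have "bij_betw (\<lambda>x :: 'm. (x, x)) UNIV {p. fst p = snd p}"
    by (rule bij_betwI[where g = fst]) auto
  then have d: "card {p :: 'm \<times> 'm. fst p = snd p} = CARD('m)"
    by (simp add: bij_betw_same_card)
  have "(UNIV :: ('m \<times> 'm) set) = ({p. fst p < snd p} \<union> {p. snd p < fst p}) \<union> {p. fst p = snd p}"
    by auto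
  then have "CARD('m \<times> 'm) = card (({p :: 'm \<times> 'm. fst p < snd p} \<union> {p. snd p < fst p}) \<union> {p. fst p = snd p})"
    by simp
  also have "\<dots> = card {p :: 'm \<times> 'm. fst p < snd p} + card {p :: 'm \<times> 'm. snd p < fst p} + card {p :: 'm \<times> 'm. fst p = snd p}"
    by (subst card_Un_disjoint; (subst card_Un_disjoint)?) auto
  finally show ?thesis using s d by simp
qed

text \<open>The m(m-1)/2 roots \<open>E\<^sub>j\<^sup>* + E\<^sub>i\<^sup>*\<close> take the value
  2s with multiplicity 1, the m roots \<open>E\<^sub>j\<^sup>*\<close> the value s with multiplicity
  n-m. In total this is m(m-1)s + m(n-m)s = m(n-1)s, and \<open>rho0\<close> is half of it.\<close>

lemma rho0_scalar: "rho0 \<iota> (amat \<iota> (\<lambda>_. s)) = real CARD('m) * (real CARD('n) - 1) / 2 * s"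
proof -
  let ?V = "\<lambda>\<alpha>. real (dim (root_space \<iota> \<alpha>)) * \<alpha> (amat \<iota> (\<lambda>_. s))"
  let ?r = "\<lambda>p :: 'm \<times> 'm. \<lambda>T :: real^('n + 'm)^('n + 'm). Edual \<iota> (snd p) T + Edual \<iota> (fst p) T"
  let ?I = "{p :: 'm \<times> 'm. fst p < snd p}"
  have v: "Edual \<iota> j (amat \<iota> (unit k)) = unit k j" for j k
    by (simp add: basis_pairings[OF inj])
  \<comment> \<open>\<open>pos_roots0\<close> is a set of functionals, so different indices must be
    shown to give different functionals; evaluation at \<open>amat \<iota> (unit k)\<close> tells
    them apart.\<close>
  have inj1: "inj_on ?r ?I"
  proof (rule inj_onI)
    fix p q assume pq: "p \<in> ?I" "q \<in> ?I" "?r p = ?r q"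
    have "unit k (snd p) + unit k (fst p) = unit k (snd q) + (unit k (fst q) :: real)" for k
      using fun_cong[OF pq(3), of "amat \<iota> (unit k)"] by (simp add: v)
    note u = this
    have "fst p = fst q \<or> fst p = snd q"
      by (rule ccontr) (use u[of "fst p"] pq(1) in \<open>auto split: if_splits\<close>)
    moreover have "snd p = fst q \<or> snd p = snd q"
      by (rule ccontr) (use u[of "snd p"] pq(1) in \<open>auto split: if_splits\<close>)
    ultimately show "p = q"
      using pq(1,2) by (auto simp: prod_eq_iff)
  qed
  have inj2: "inj (Edual \<iota>)"
  proof (rule injI)
    fix i j assume "Edual \<iota> i = Edual \<iota> j"
    from fun_cong[OF this, of "amat \<iota> (unit i)"] show "i = j" by (simp add: v split: if_splits)
  qed
  have disj: "?r ` ?I \<inter> range (Edual \<iota>) = {}"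
  proof safe
    fix a b j assume ab: "fst (a, b) < snd (a, b)" "?r (a, b) = Edual \<iota> j"
    have "unit k b + unit k a = (unit k j :: real)" for k
      using fun_cong[OF ab(2), of "amat \<iota> (unit k)"] by (simp add: v)
    note u = this
    have "a = j"
      by (rule ccontr) (use u[of a] ab(1) in \<open>auto split: if_splits\<close>)
    moreover have "b = j"
      by (rule ccontr) (use u[of b] ab(1) in \<open>auto split: if_splits\<close>)
    ultimately show "?r (a, b) \<in> {}" using ab(1) by simp
  qed
  have set: "pos_roots0 \<iota> = ?r ` ?I \<union> range (Edual \<iota>)"
    unfolding pos_roots0_def by (auto simp: image_def)
  have le: "CARD('m) \<le> CARD('n)"
    using card_inj_on_le[OF inj, of UNIV] by simp
  have "(\<Sum>\<alpha>\<in>pos_roots0 \<iota>. ?V \<alpha>) = (\<Sum>\<alpha>\<in>?r ` ?I. ?V \<alpha>) + (\<Sum>\<alpha>\<in>range (Edual \<iota>). ?V \<alpha>)"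
    unfolding set by (rule sum.union_disjoint) (use disj in auto)
  also have "(\<Sum>\<alpha>\<in>?r ` ?I. ?V \<alpha>) = (\<Sum>p\<in>?I. ?V (?r p))"
    by (simp add: sum.reindex[OF inj1])
  also have "\<dots> = (\<Sum>p\<in>?I. 2 * s)"
    by (rule sum.cong[OF refl]) (simp add: dim_root_space_plus[OF inj] basis_pairings[OF inj])
  also have "(\<Sum>\<alpha>\<in>range (Edual \<iota>). ?V \<alpha>) = (\<Sum>j\<in>UNIV. ?V (Edual \<iota> j))"
    by (simp add: sum.reindex[OF inj2])
  also have "\<dots> = (\<Sum>j\<in>(UNIV :: 'm set). (real CARD('n) - real CARD('m)) * s)"
    using le by (intro sum.cong[OF refl]) (simp add: dim_root_space_single[OF inj] basis_pairings[OF inj] of_nat_diff)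
  also have "(\<Sum>p\<in>?I. 2 * s) + \<dots> = (real (2 * card ?I + CARD('m)) - real CARD('m)) * s
      + real CARD('m) * (real CARD('n) - real CARD('m)) * s"
    by (simp add: algebra_simps)
  also have "\<dots> = real CARD('m) * (real CARD('n) - 1) * s"
    unfolding card_less_pairs by (simp add: algebra_simps)
  finally show ?thesis by (simp add: rho0_def)
qed

end

subsection \<open>Action of the parabolic subgroup at the base point\<close>

text \<open>Block diagonal matrices are those commuting with diag(I_n, -I_m). In this form closure
  under products and inverses is immediate.\<close>

lemma Lgrp_iff: "h \<in> Lgrp \<longleftrightarrow> h \<in> SO_nm \<and> (\<forall>y. h *v theta y = theta (h *v y))"
proof -
  have c: "(h *v axis q 1) $ p = h $ p $ q" for p q
    by (simp add: matrix_vector_mult_basis column_def)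
  have t: "theta (axis (Inr j) 1) = - axis (Inr j) 1" "theta (axis (Inl i) 1) = axis (Inl i) 1"
    for i :: 'a and j :: 'b
    by (auto simp: vec_eq_Plus axis_def)
  have "blockB h = 0 \<and> blockC h = 0 \<longleftrightarrow> (\<forall>y. h *v theta y = theta (h *v y))"
  proof
    assume bc: "blockB h = 0 \<and> blockC h = 0"
    then have b: "h $ Inl i $ Inr j = 0" "h $ Inr j $ Inl i = 0" for i j
      by (auto simp: blockB_def blockC_def vec_eq_iff)
    then show "\<forall>y. h *v theta y = theta (h *v y)"
      by (simp add: vec_eq_Plus matrix_vector_mult_def sum_UNIV_Plus sum_negf)
  next
    assume *: "\<forall>y. h *v theta y = theta (h *v y)"
    have neg: "h *v (- y) = - (h *v y)" for y
      using matrix_vector_mult_scaleR[of h "-1" y] by simp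
    have "h $ Inl i $ Inr j = 0" for i j
    proof -
      have "(h *v theta (axis (Inr j) 1)) $ Inl i = theta (h *v axis (Inr j) 1) $ Inl i"
        using * by simp
      then show ?thesis by (simp add: t neg c)
    qed
    moreover have "h $ Inr j $ Inl i = 0" for i j
    proof -
      have "(h *v theta (axis (Inl i) 1)) $ Inr j = theta (h *v axis (Inl i) 1) $ Inr j"
        by (simp only: *)
      then show ?thesis by (simp add: t c)
    qed
    ultimately show "blockB h = 0 \<and> blockC h = 0"
      by (simp add: blockB_def blockC_def vec_eq_iff)
  qed
  then show ?thesis by (auto simp: Lgrp_def)
qed

lemma Lgrp_SO: "l \<in> Lgrp \<Longrightarrow> l \<in> SO_nm"
  by (simp add: Lgrp_def)

lemma Lgrp_theta: "l \<in> Lgrp \<Longrightarrow> l *v theta y = theta (l *v y)"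
  by (simp add: Lgrp_iff)

lemma Lgrp_one: "mat 1 \<in> Lgrp"
  by (simp add: Lgrp_iff)

lemma Lgrp_mult: "k \<in> Lgrp \<Longrightarrow> l \<in> Lgrp \<Longrightarrow> k ** l \<in> Lgrp"
  by (simp add: Lgrp_iff flip: matrix_vector_mul_assoc)

lemma Lgrp_inv:
  assumes "l \<in> Lgrp"
  shows "matrix_inv l \<in> Lgrp"
proof -
  have "matrix_inv l *v theta y = theta (matrix_inv l *v y)" for y
  proof -
    have "l *v theta (matrix_inv l *v y) = theta y"
      using assms by (simp add: Lgrp_theta Lgrp_SO)
    then show ?thesis using assms by (metis SO_inv_mult_vec(1) Lgrp_SO)
  qed
  then show ?thesis using assms by (simp add: Lgrp_iff)
qed

lemma Lgrp_inner:
  assumes "l \<in> Lgrp"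
  shows "(l *v u) \<bullet> (l *v v) = u \<bullet> v"
  using SO_form[OF Lgrp_SO[OF assms], of u "theta v"] by (simp add: Lgrp_theta[OF assms])

lemma inner_lift:
  assumes "v \<in> stiefel"
  shows "lift v y \<bullet> lift v z = 2 * (y \<bullet> z)"
proof -
  have "(v *v y) \<bullet> (v *v z) = y \<bullet> z"
    using assms by (simp add: stiefel_iff_form form_lift)
  then show ?thesis by (simp add: inner_Plus) (simp add: inner_vec_def)
qed

text \<open>An element of L preserves the form and commutes with \<open>theta\<close>, hence is
  orthogonal. As \<open>lift v\<close> multiplies inner products by 2 for every \<open>v\<close> in
  \<open>stiefel\<close>, the automorphy factor is orthogonal as well.\<close>

lemma Lgrp_det_aut_factor:
  assumes "l \<in> Lgrp" "v \<in> stiefel"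
  shows "\<bar>det (aut_factor l v)\<bar> = 1"
proof -
  have "(aut_factor l v *v y) \<bullet> (aut_factor l v *v z) = y \<bullet> z" for y z
    using Lgrp_inner[OF assms(1), of "lift v y" "lift v z"] assms
    by (simp add: lift_act Lgrp_SO inner_lift act_stiefel)
  then have "orthogonal_transformation ((*v) (aut_factor l v))"
    by (simp add: orthogonal_transformation_def)
  then have "orthogonal_matrix (aut_factor l v)"
    by (simp add: orthogonal_transformation_matrix)
  then show ?thesis using det_orthogonal_matrix by fastforce
qed

lemma Lgrp_Jac_pow: "l \<in> Lgrp \<Longrightarrow> v \<in> stiefel \<Longrightarrow> Jac_pow l v s = 1"
  using Lgrp_det_aut_factor[of l v] by (simp add: Jac_pow_def flip: aut_factor_def)

text \<open>The least index i that is moved would go to a smaller one, which is fixed by minimality;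
  this contradicts injectivity. In the Leibniz expansion it leaves only the identity
  permutation.\<close>

lemma permutes_descending:
  fixes p :: "'k::{finite,linorder} \<Rightarrow> 'k"
  assumes "p permutes UNIV" "\<And>i. p i \<le> i"
  shows "p = id"
proof (rule ccontr)
  assume "p \<noteq> id"
  then have ne: "{i. p i \<noteq> i} \<noteq> {}" by auto
  define i where "i = Min {i. p i \<noteq> i}"
  have i: "p i \<noteq> i" using Min_in[OF _ ne] by (simp add: i_def)
  with assms(2)[of i] have "p i < i" by simp
  have "p (p i) = p i"
  proof (rule ccontr)
    assume "p (p i) \<noteq> p i"
    then have "i \<le> p i" unfolding i_def by (intro Min_le) auto
    with \<open>p i < i\<close> show False by simp
  qed
  with i show False using permutes_inj[OF assms(1)] by (metis injD)
qed

lemma det_unitriangular: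
  fixes A :: "((real, 'k) vec, 'k::{finite,linorder}) vec"
  assumes "\<And>i. A $ i $ i = 1" "\<And>i j. i < j \<Longrightarrow> A $ i $ j = 0"
  shows "det A = 1"
proof -
  have "det A = (\<Sum>p\<in>{id}. of_int (sign p) * (\<Prod>i\<in>UNIV. A $ i $ p i))"
    unfolding det_def
  proof (rule sum.mono_neutral_right, goal_cases)
    case 3
    show ?case
    proof
      fix p :: "'k \<Rightarrow> 'k" assume p: "p \<in> {p. p permutes UNIV} - {id}"
      then obtain i where "\<not> p i \<le> i" using permutes_descending[of p] by auto
      then have "A $ i $ p i = 0" using assms(2) by simp
      then have "(\<Prod>i\<in>UNIV. A $ i $ p i) = 0" by (meson UNIV_I finite prod_zero)
      then show "of_int (sign p) * (\<Prod>i\<in>UNIV. A $ i $ p i) = 0" by simp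
    qed
  qed (auto simp: permutes_id)
  then show ?thesis by (simp add: assms(1) sign_id)
qed

text \<open>All positive powers of \<open>Z\<close> are strictly triangular, so on and above the
  diagonal only the term of order 0 contributes and the exponential is unipotent.\<close>

lemma det_mexp_triangular:
  assumes "triangular Z"
  shows "det (mexp Z) = 1"
proof -
  have tri: "triangular (mpow Z (Suc k))" for k
  proof (induction k)
    case 0
    then show ?case using assms by (simp add: mpow_Suc)
  next
    case (Suc k)
    have "(Z ** mpow Z (Suc k)) $ i $ j = 0" if "\<not> j < i" for i j
    proof -
      have "Z $ i $ r * mpow Z (Suc k) $ r $ j = 0" for r
        using assms Suc that unfolding triangular_def
        by (metis mult_eq_0_iff order.strict_trans)
      then show ?thesis
        unfolding matrix_matrix_mult_def by (simp only: vec_lambda_beta sum.neutral_const)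
    qed
    then show ?case by (simp add: triangular_def mpow_Suc[of Z "Suc k"])
  qed
  have z: "mpow Z k $ i $ j = (if k = 0 then mat 1 $ i $ j else 0)" if "\<not> j < i" for i j k
    using tri that by (cases k) (auto simp: triangular_def)
  have "mexp Z $ i $ j = mat 1 $ i $ j" if "\<not> j < i" for i j
  proof -
    have "(\<lambda>k. (1 / fact k) * mpow Z k $ i $ j) sums (\<Sum>k\<in>{0}. (1 / fact k) * mpow Z k $ i $ j)"
      by (rule sums_finite) (use z[OF that] in auto)
    then show ?thesis
      using sums_unique2[OF mexp_entry_sums] by fastforce
  qed
  then show ?thesis
    by (intro det_unitriangular) (auto simp: mat_def)
qed

lemma inner_wplus:
  "y \<bullet> wplus \<iota> j = form y (wminus \<iota> j)" "y \<bullet> wminus \<iota> j = form y (wplus \<iota> j)"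
  by (simp_all add: form_eq_inner)

section \<open>The stabilizer of the base point in L\<close>

context
  fixes \<iota> :: "'m::finite \<Rightarrow> 'n::finite"
  assumes inj: "inj \<iota>"
begin

lemma base_point_stiefel: "base_point \<iota> \<in> stiefel"
  by (simp add: stiefel_iff_form lift_base_point form_sum_left form_sum_right basis_pairings[OF inj])

lemma mexp_amat:
  shows "act (mexp (amat \<iota> t)) (base_point \<iota>) = base_point \<iota>"
    and "det (aut_factor (mexp (amat \<iota> t)) (base_point \<iota>)) = exp (\<Sum>j\<in>UNIV. t j)"
proof -
  define D :: "real^'m^'m" where "D = (\<chi> i j. if i = j then exp (t i) else 0)"
  have "mexp (amat \<iota> t) *v lift (base_point \<iota>) y = lift (base_point \<iota>) (D *v y)" for y
  proof -
    have "mexp (amat \<iota> t) *v lift (base_point \<iota>) y = (\<Sum>j\<in>UNIV. y $ j *\<^sub>R (exp (t j) *\<^sub>R wplus \<iota> j))"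
      by (simp add: lift_base_point linear_sum[OF matrix_vector_mul_linear] matrix_vector_mult_scaleR
          mexp_eigenvector[OF amat_basis(1)[OF inj]])
    moreover have "(D *v y) $ j = exp (t j) * y $ j" for j
      by (simp add: D_def matrix_vector_mult_def if_distrib[of "\<lambda>x. x * _"] cong: if_cong)
    ultimately show ?thesis by (simp add: lift_base_point mult.commute)
  qed
  note e = lift_act_eqI[OF mexp_SO[OF amat_so[OF inj]] base_point_stiefel this]
  from e show "act (mexp (amat \<iota> t)) (base_point \<iota>) = base_point \<iota>" by blast
  have "det D = (\<Prod>j\<in>UNIV. exp (t j))"
    by (subst det_diagonal) (simp_all add: D_def)
  with e show "det (aut_factor (mexp (amat \<iota> t)) (base_point \<iota>)) = exp (\<Sum>j\<in>UNIV. t j)"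
    by (simp add: exp_sum)
qed

text \<open>Together with \<open>amat_one_lift\<close> this identifies the plane of the base point
  with the eigenspace of E_1+...+E_m for the eigenvalue 1.\<close>

lemma amat_one_fixed:
  assumes "amat \<iota> (\<lambda>_. 1) *v y = y"
  shows "y = lift (base_point \<iota>) (\<chi> j. y $ Inr j)"
proof -
  have l: "lift (base_point \<iota>) z $ Inl (\<iota> j) = z $ j" for z j
    by (simp add: lift_base_point basis_pairings[OF inj] if_distrib[of "\<lambda>x. _ * x"] cong: if_cong)
  have l0: "lift (base_point \<iota>) z $ Inl k = 0" if "k \<notin> range \<iota>" for z k
    using that by (simp only: lift_base_point sum_component vector_scaleR_component wplus_nth) (auto intro!: sum.neutral)
  show ?thesis
    unfolding vec_eq_inj[OF inj]
    using amat_mult[OF inj, where t = "\<lambda>_. 1" and y = y] l l0 by (simp add: assms del: lift_nth(1))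
qed

lemma amat_one_lift: "amat \<iota> (\<lambda>_. 1) *v lift (base_point \<iota>) y = lift (base_point \<iota>) y"
  by (simp add: lift_base_point linear_sum[OF matrix_vector_mul_linear] matrix_vector_mult_scaleR
      amat_basis(1)[OF inj])

lemma amat_theta: "amat \<iota> t *v theta y = - theta (amat \<iota> t *v y)"
  by (simp add: vec_eq_inj[OF inj] amat_mult[OF inj])

text \<open>The plane of the base point is an eigenspace of E_1+...+E_m, so commuting elements
  preserve it. Conversely, if \<open>l\<close> preserves the plane, it preserves the eigenspace for
  -1 because it commutes with \<open>theta\<close>, and also the kernel, hence it commutes with
  E_1+...+E_m.\<close>

lemma stabilizer_iff:
  assumes l: "l \<in> Lgrp"
  shows "act l (base_point \<iota>) = base_point \<iota> \<longleftrightarrow> l ** amat \<iota> (\<lambda>_. 1) = amat \<iota> (\<lambda>_. 1) ** l"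
proof
  let ?E = "amat \<iota> (\<lambda>_. 1)"
  assume comm: "l ** ?E = ?E ** l"
  have "l *v lift (base_point \<iota>) y = lift (base_point \<iota>) (aut_factor l (base_point \<iota>) *v y)" for y
  proof -
    have "?E *v (l *v lift (base_point \<iota>) y) = l *v lift (base_point \<iota>) y"
      by (simp only: matrix_vector_mul_assoc comm[symmetric])
         (simp only: matrix_vector_mul_assoc[symmetric] amat_one_lift)
    from amat_one_fixed[OF this] show ?thesis
      by (simp add: mult_lift)
  qed
  from lift_act_eqI[OF Lgrp_SO[OF l] base_point_stiefel this]
  show "act l (base_point \<iota>) = base_point \<iota>" by blast
next
  let ?E = "amat \<iota> (\<lambda>_. 1)"
  assume fixed: "act l (base_point \<iota>) = base_point \<iota>"
  note SO = Lgrp_SO[OF l]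
  have lift: "l *v lift (base_point \<iota>) y = lift (base_point \<iota>) (aut_factor l (base_point \<iota>) *v y)" for y
    using lift_act[OF SO base_point_stiefel, of y] by (simp add: fixed)
  have p: "?E *v (l *v wplus \<iota> j) = l *v (?E *v wplus \<iota> j)" for j
    by (simp add: lift amat_one_lift flip: lift_base_point_axis)
  have m: "?E *v (l *v wminus \<iota> j) = l *v (?E *v wminus \<iota> j)" for j
  proof -
    have neg: "l *v (- y) = - (l *v y)" for y
      using matrix_vector_mult_scaleR[of l "-1" y] by simp
    have "?E *v (l *v theta (wplus \<iota> j)) = l *v (?E *v theta (wplus \<iota> j))"
      by (simp only: Lgrp_theta[OF l] amat_theta p neg)
    then show ?thesis by simp
  qed
  \<comment> \<open>\<open>evec k\<close> is orthogonal to the plane both for the form and for the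
    inner product. As \<open>l\<close> preserves both and maps the plane onto itself, the image of
    \<open>evec k\<close> has the same property and lies in the kernel of \<open>?E\<close>.\<close>
  have e: "?E *v (l *v evec k) = l *v (?E *v evec k)" if k: "k \<notin> range \<iota>" for k
  proof -
    have 0: "form (evec k) (lift (base_point \<iota>) z) = 0" "evec k \<bullet> lift (base_point \<iota>) z = 0" for z
      using k by (auto simp: lift_base_point form_sum_right inner_sum_right inner_wplus
          intro!: sum.neutral)
    have "form (l *v evec k) (wplus \<iota> j) = 0" "(l *v evec k) \<bullet> wplus \<iota> j = 0" for j
    proof -
      obtain z where z: "axis j 1 = aut_factor l (base_point \<iota>) *v z"
        by (rule aut_factor_surj[OF SO base_point_stiefel])
      then have w: "wplus \<iota> j = l *v lift (base_point \<iota>) z"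
        by (simp add: lift flip: lift_base_point_axis)
      show "form (l *v evec k) (wplus \<iota> j) = 0"
        unfolding w SO_form[OF SO] by (rule 0)
      show "(l *v evec k) \<bullet> wplus \<iota> j = 0"
        unfolding w Lgrp_inner[OF l] by (rule 0)
    qed
    then have "(l *v evec k) $ Inl (\<iota> j) = 0" "(l *v evec k) $ Inr j = 0" for j
      by (simp_all add: inner_wplus form_wplus form_wminus)
    then have "?E *v (l *v evec k) = 0"
      by (simp add: vec_eq_inj[OF inj] amat_mult[OF inj])
    then show ?thesis by (simp add: amat_basis(3)[OF inj k])
  qed
  have "?E *v (l *v y) = l *v (?E *v y)" for y
    by (subst (1 2) basis_expansion[OF inj, of y])
       (simp add: matrix_vector_right_distrib linear_sum[OF matrix_vector_mul_linear]
          matrix_vector_mult_scaleR p m e)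
  then show "l ** ?E = ?E ** l"
    by (intro matrix_eq[THEN iffD2] allI) (simp flip: matrix_vector_mul_assoc)
qed

lemma Mgrp_fixes:
  assumes "k \<in> Mgrp \<iota>"
  shows "k \<in> Lgrp" "act k (base_point \<iota>) = base_point \<iota>"
  using assms stabilizer_iff[of k] by (auto simp: Mgrp_def afrak_eq)

lemma exp_generated_commute:
  assumes "y \<in> exp_generated (mfrak0 \<iota>)" "T \<in> afrak0 \<iota>"
  shows "y ** T = T ** y"
  using assms(1)
proof induction
  case (mult y X)
  then have "X ** T = T ** X" using assms(2) by (simp add: mfrak0_def)
  from mexp_intertwine[OF this] mult.IH show ?case
    by (metis matrix_mul_assoc)
qed simp

text \<open>This is the identification Y = L/(L \<inter> M_0). Both factors of an element of M_0
  commute with \<open>afrak0 \<iota>\<close>, so \<open>stabilizer_iff\<close> applies; in the other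
  direction the exponential factor is taken to be 1.\<close>

lemma Lgrp_M0_iff: "l \<in> Lgrp \<inter> M0grp \<iota> \<longleftrightarrow> l \<in> Lgrp \<and> act l (base_point \<iota>) = base_point \<iota>"
proof
  assume l: "l \<in> Lgrp \<inter> M0grp \<iota>"
  have E: "amat \<iota> (\<lambda>_. 1) \<in> afrak0 \<iota>" by (auto simp: afrak0_eq)
  obtain k y where ky: "l = k ** y" "k ** amat \<iota> (\<lambda>_. 1) = amat \<iota> (\<lambda>_. 1) ** k"
    "y ** amat \<iota> (\<lambda>_. 1) = amat \<iota> (\<lambda>_. 1) ** y"
    using l E exp_generated_commute[OF _ E] unfolding M0grp_def by blast
  then have "l ** amat \<iota> (\<lambda>_. 1) = amat \<iota> (\<lambda>_. 1) ** l"
    by (metis matrix_mul_assoc)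
  with l show "l \<in> Lgrp \<and> act l (base_point \<iota>) = base_point \<iota>"
    using stabilizer_iff by auto
next
  assume l: "l \<in> Lgrp \<and> act l (base_point \<iota>) = base_point \<iota>"
  then have c: "l ** amat \<iota> (\<lambda>_. 1) = amat \<iota> (\<lambda>_. 1) ** l"
    using stabilizer_iff by auto
  have "l ** T = T ** l" if T: "T \<in> afrak0 \<iota>" for T
  proof -
    obtain s where "T = amat \<iota> (\<lambda>_. s)" using T by (auto simp: afrak0_eq)
    then have T': "T = s *\<^sub>R amat \<iota> (\<lambda>_. 1)" by (simp add: amat_scaleR)
    show ?thesis by (simp add: T' matrix_scalar_ac scalar_matrix_assoc[symmetric] c)
  qed
  moreover have "l = l ** mat 1" by simp
  ultimately show "l \<in> Lgrp \<inter> M0grp \<iota>"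
    using l exp_generated.one unfolding M0grp_def by blast
qed

end

context
  fixes \<iota> :: "'m::{finite,linorder} \<Rightarrow> 'n::finite"
  assumes inj: "inj \<iota>"
begin

lemma mexp_nfrak:
  assumes X: "X \<in> nfrak \<iota>"
  shows "act (mexp X) (base_point \<iota>) = base_point \<iota>"
    and "det (aut_factor (mexp X) (base_point \<iota>)) = 1"
proof -
  obtain Z where Z: "triangular Z" "\<And>y. X *v lift (base_point \<iota>) y = lift (base_point \<iota>) (Z *v y)"
    using nfrak_triangular[OF inj X] by blast
  \<comment> \<open>The matrix of the embedding of the plane: invariance becomes
    \<open>X ** W = W ** Z\<close>, to which \<open>mexp_intertwine\<close> applies with a
    rectangular \<open>W\<close>.\<close>
  define W where "W = matrix (lift (base_point \<iota>))"
  have W: "W *v y = lift (base_point \<iota>) y" for y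
    unfolding W_def using fun_cong[OF matrix_vector_mul(2)[OF linear_lift]] .
  have "X ** W = W ** Z"
    by (intro matrix_eq[THEN iffD2] allI) (simp add: W Z flip: matrix_vector_mul_assoc)
  then have "(mexp X ** W) *v y = (W ** mexp Z) *v y" for y
    by (simp add: mexp_intertwine)
  then have "mexp X *v lift (base_point \<iota>) y = lift (base_point \<iota>) (mexp Z *v y)" for y
    by (simp add: W flip: matrix_vector_mul_assoc)
  from lift_act_eqI[OF mexp_SO[OF nfrak_so[OF inj X]] base_point_stiefel[OF inj] this]
  show "act (mexp X) (base_point \<iota>) = base_point \<iota>"
    and "det (aut_factor (mexp X) (base_point \<iota>)) = 1"
    using det_mexp_triangular[OF Z(1)] by auto
qed

end

subsection \<open>Iwasawa decomposition\<close>

lemma sum_matrix_vector_mult: "(\<Sum>i\<in>I. A i) *v y = (\<Sum>i\<in>I. A i *v y)"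
  for A :: "'i \<Rightarrow> real^'k::finite^'l::finite"
  by (rule linear_sum[OF bounded_linear.linear[OF bounded_linear_matrix_vector_mult_right]])

lemma matrix_vector_mult_sum: "A *v (\<Sum>i\<in>I. f i) = (\<Sum>i\<in>I. A *v f i)"
  for A :: "real^'k::finite^'l::finite"
  by (rule linear_sum[OF matrix_vector_mul_linear])

context
  fixes \<iota> :: "'m::{finite,linorder} \<Rightarrow> 'n::finite"
  assumes inj: "inj \<iota>"
begin

lemma nfrak_sum: "(\<And>i. i \<in> I \<Longrightarrow> f i \<in> nfrak \<iota>) \<Longrightarrow> (\<Sum>i\<in>I. f i) \<in> nfrak \<iota>"
  and nfrak_scale: "X \<in> nfrak \<iota> \<Longrightarrow> c *\<^sub>R X \<in> nfrak \<iota>"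
  unfolding nfrak_def by (auto intro: span_sum span_scale)

text \<open>\<open>x\<close> is an isometry, so the pairings can be pulled back to the weight basis,
  where they are the coefficients of the vector.\<close>

lemma form_nondegenerate_basis:
  assumes x: "x \<in> SO_nm"
    and "\<And>j. form v (x *v wplus \<iota> j) = 0" "\<And>j. form v (x *v wminus \<iota> j) = 0"
    and "\<And>k. k \<notin> range \<iota> \<Longrightarrow> form v (x *v evec k) = 0"
  shows "v = 0"
proof -
  define v' where "v' = matrix_inv x *v v"
  have v: "v = x *v v'" using x by (simp add: v'_def)
  have "form v' (wplus \<iota> j) = 0" "form v' (wminus \<iota> j) = 0" for j
    using assms(2,3)[of j] unfolding v SO_form[OF x] .
  moreover have "v' $ Inl k = 0" if "k \<notin> range \<iota>" for k
    using assms(4)[OF that] unfolding v SO_form[OF x] by simp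
  ultimately have "v' = 0"
    by (subst basis_expansion[OF inj, of v']) simp
  then show ?thesis by (simp add: v)
qed

text \<open>
  The decomposition is stated as an induction principle: right multiplication by elements of
  \<open>A\<close> and \<open>N\<close> moves every \<open>x\<close> into \<open>L\<close>. Gram-Schmidt, from the largest index downwards, makes the
  vectors \<open>x w\<^sub>j\<close> (\<open>w\<^sub>j\<close> being \<open>wplus \<iota> j\<close>) orthogonal of squared length 2, the roots
  \<open>E\<^sub>j\<^sup>*\<close> then make \<open>x e\<^sub>k\<close> orthogonal to them, and the roots \<open>E\<^sub>j\<^sup>* + E\<^sub>i\<^sup>*\<close> move the images of the
  opposite vectors to \<open>theta (x w\<^sub>j)\<close>. At that point \<open>x\<close> commutes with \<open>theta\<close>, that is, \<open>x \<in> L\<close>.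
\<close>

context
  fixes Q :: "real^('n + 'm)^('n + 'm) \<Rightarrow> bool"
  assumes L: "\<And>l. l \<in> Lgrp \<Longrightarrow> Q l"
    and N: "\<And>x X. x \<in> SO_nm \<Longrightarrow> X \<in> nfrak \<iota> \<Longrightarrow> Q (x ** mexp X) \<Longrightarrow> Q x"
    and A: "\<And>x t. x \<in> SO_nm \<Longrightarrow> Q (x ** mexp (amat \<iota> t)) \<Longrightarrow> Q x"
begin

lemma iwasawa_evec_orthogonal:
  assumes x: "x \<in> SO_nm"
    and gram: "\<And>j l. (x *v wplus \<iota> j) \<bullet> (x *v wplus \<iota> l) = (if j = l then 2 else 0)"
    and orth: "\<And>k j. k \<notin> range \<iota> \<Longrightarrow> (x *v evec k) \<bullet> (x *v wplus \<iota> j) = 0"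
  shows "Q x"
proof -
  note basis = basis_pairings[OF inj]
  define a where "a k j = ((x *v wplus \<iota> j) \<bullet> (x *v wminus \<iota> k)) / 2" for k j
  \<comment> \<open>The defect: \<open>x\<close> lies in L once it sends each
    \<open>wminus \<iota> l\<close> to \<open>theta (x *v wplus \<iota> l)\<close> and each
    \<open>evec k\<close> to a vector fixed by \<open>theta\<close>.\<close>
  define d where "d l = theta (x *v wplus \<iota> l) - x *v wminus \<iota> l" for l
  have d: "d l = (\<Sum>k\<in>UNIV. a k l *\<^sub>R (x *v wplus \<iota> k))" for l
  proof -
    have "d l - (\<Sum>k\<in>UNIV. a k l *\<^sub>R (x *v wplus \<iota> k)) = 0"
    proof (rule form_nondegenerate_basis[OF x])
      fix j
      show "form (d l - (\<Sum>k\<in>UNIV. a k l *\<^sub>R (x *v wplus \<iota> k))) (x *v wplus \<iota> j) = 0"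
        by (simp add: d_def form_sum_left SO_form[OF x] basis gram)
      show "form (d l - (\<Sum>k\<in>UNIV. a k l *\<^sub>R (x *v wplus \<iota> k))) (x *v wminus \<iota> j) = 0"
        by (simp add: d_def form_sum_left SO_form[OF x] basis a_def
            if_distrib[of "\<lambda>x. _ * x"] cong: if_cong)
    next
      fix k assume "k \<notin> range \<iota>"
      then show "form (d l - (\<Sum>k\<in>UNIV. a k l *\<^sub>R (x *v wplus \<iota> k))) (x *v evec k) = 0"
        using orth[of k l] by (auto simp: d_def form_sum_left SO_form[OF x] basis inner_commute
            simp del: wplus_nth wminus_nth) (auto intro!: sum.neutral)
    qed
    then show ?thesis by simp
  qed
  \<comment> \<open>By the expansion just shown, the \<open>d l\<close> lie in an isotropic
    subspace. Expanding \<open>form (d j) (d k) = 0\<close> from the definition of \<open>d\<close>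
    leaves exactly the sum of \<open>a k j\<close> and \<open>a j k\<close>.\<close>
  have skew: "a j k = - a k j" for j k
  proof -
    have "form (d j) (d k) = 0"
      by (simp add: d form_sum_left form_sum_right SO_form[OF x] basis)
    moreover have th: "(x *v wplus \<iota> j) \<bullet> theta (x *v wplus \<iota> k) = 0" for j k
      by (simp add: SO_form[OF x] basis flip: form_eq_inner)
    moreover have "theta (x *v wplus \<iota> j) \<bullet> (x *v wplus \<iota> k) = 0"
      by (subst inner_commute) (rule th)
    ultimately have "(x *v wplus \<iota> j) \<bullet> (x *v wminus \<iota> k) + (x *v wminus \<iota> j) \<bullet> (x *v wplus \<iota> k) = 0"
      unfolding d_def by (simp add: SO_form[OF x] basis inner_diff_left inner_diff_right)
    then show ?thesis
      by (simp add: a_def inner_commute[of "x *v wminus \<iota> j"])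
  qed
  \<comment> \<open>The factor 1/4 compensates the pairing 2 of \<open>wplus \<iota> l\<close> with
    \<open>wminus \<iota> l\<close> and the double count of unordered pairs, since \<open>a\<close>
    and \<open>wedge\<close> are both antisymmetric. The result is that \<open>x ** X\<close> adds
    \<open>d l\<close> to the image of \<open>wminus \<iota> l\<close>.\<close>
  define X where "X = (\<Sum>j\<in>UNIV. \<Sum>k\<in>UNIV. (a k j / 4) *\<^sub>R wedge (wplus \<iota> k) (wplus \<iota> j))"
  have Xn: "X \<in> nfrak \<iota>"
    unfolding X_def
  proof (intro nfrak_sum nfrak_scale)
    fix j k
    show "wedge (wplus \<iota> k) (wplus \<iota> j) \<in> nfrak \<iota>"
    proof (cases "j = k")
      case True
      then have "wedge (wplus \<iota> k) (wplus \<iota> j) = 0"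
        by (simp add: matrix_eq wedge_mult)
      then show ?thesis by (simp add: nfrak_def span_zero)
    qed (simp add: nfrak_wedge(2)[OF inj])
  qed
  have Xp: "X *v wplus \<iota> l = 0" for l
    by (simp add: X_def sum_matrix_vector_mult wedge_mult basis flip: scaleR_matrix_vector_assoc)
  have Xe: "X *v evec k = 0" if "k \<notin> range \<iota>" for k
    using that by (auto simp: X_def sum_matrix_vector_mult wedge_mult simp flip: scaleR_matrix_vector_assoc
        intro!: sum.neutral)
  have Xm: "X *v wminus \<iota> l = (\<Sum>k\<in>UNIV. a k l *\<^sub>R wplus \<iota> k)" for l
  proof -
    have "X *v wminus \<iota> l = (\<Sum>j\<in>UNIV. \<Sum>k\<in>UNIV. ((if j = l then a k j / 2 else 0) *\<^sub>R wplus \<iota> k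
        - (if k = l then a k j / 2 else 0) *\<^sub>R wplus \<iota> j))"
      by (auto simp: X_def sum_matrix_vector_mult wedge_mult basis scaleR_diff_right
          simp flip: scaleR_matrix_vector_assoc intro!: sum.cong)
    also have "\<dots> = (\<Sum>j\<in>UNIV. \<Sum>k\<in>UNIV. (if j = l then a k j / 2 else 0) *\<^sub>R wplus \<iota> k)
        - (\<Sum>j\<in>UNIV. \<Sum>k\<in>UNIV. (if k = l then a k j / 2 else 0) *\<^sub>R wplus \<iota> j)"
      by (simp add: sum_subtractf)
    also have "(\<Sum>j\<in>UNIV. \<Sum>k\<in>UNIV. (if k = l then a k j / 2 else 0) *\<^sub>R wplus \<iota> j)
        = (\<Sum>j\<in>UNIV. (a l j / 2) *\<^sub>R wplus \<iota> j)"
      by (simp add: if_distrib[of "\<lambda>x. x *\<^sub>R _"] cong: if_cong)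
    also have "(\<Sum>j\<in>UNIV. \<Sum>k\<in>UNIV. (if j = l then a k j / 2 else 0) *\<^sub>R wplus \<iota> k)
        = (\<Sum>k\<in>UNIV. (a k l / 2) *\<^sub>R wplus \<iota> k)"
      by (subst sum.swap) (simp add: if_distrib[of "\<lambda>x. x *\<^sub>R _"] cong: if_cong)
    also have "(\<Sum>k\<in>UNIV. (a k l / 2) *\<^sub>R wplus \<iota> k) - (\<Sum>j\<in>UNIV. (a l j / 2) *\<^sub>R wplus \<iota> j)
        = (\<Sum>k\<in>UNIV. a k l *\<^sub>R wplus \<iota> k)"
      unfolding sum_subtractf[symmetric]
      by (rule sum.cong[OF refl]) (simp add: skew[of l] flip: scaleR_add_left)
    finally show ?thesis .
  qed
  have XX: "X *v (X *v wminus \<iota> l) = 0" for l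
    by (simp add: Xm matrix_vector_mult_sum matrix_vector_mult_scaleR Xp)
  define y where "y = x ** mexp X"
  have ySO: "y \<in> SO_nm"
    using x mexp_SO[OF nfrak_so[OF inj Xn]] by (simp add: y_def)
  have yp: "y *v wplus \<iota> l = x *v wplus \<iota> l" for l
    by (simp add: y_def mexp_square_zero Xp flip: matrix_vector_mul_assoc)
  have ye: "y *v evec k = x *v evec k" if "k \<notin> range \<iota>" for k
    using that by (simp add: y_def mexp_square_zero Xe flip: matrix_vector_mul_assoc)
  have ym: "y *v wminus \<iota> l = theta (x *v wplus \<iota> l)" for l
  proof -
    have "y *v wminus \<iota> l = x *v wminus \<iota> l + d l"
      by (simp add: y_def mexp_square_zero[OF XX] Xm matrix_vector_right_distrib
          matrix_vector_mult_sum matrix_vector_mult_scaleR d flip: matrix_vector_mul_assoc)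
    then show ?thesis by (simp add: d_def)
  qed
  \<comment> \<open>The image of \<open>evec k\<close> is orthogonal to the plane of x both for the
    form and for the inner product, so its last m coordinates are orthogonal to the range of the
    automorphy factor, which is everything.\<close>
  have te: "theta (x *v evec k) = x *v evec k" if k: "k \<notin> range \<iota>" for k
  proof -
    define r :: "(real, 'm) vec" where "r = (\<chi> j. (x *v evec k) $ Inr j)"
    define M where "M = aut_factor x (base_point \<iota>)"
    have "r \<bullet> (M *v z) = 0" for z
    proof -
      have "(x *v evec k) \<bullet> (x *v lift (base_point \<iota>) z) = 0"
        using orth[OF k] by (simp add: lift_base_point matrix_vector_mult_sum
            matrix_vector_mult_scaleR inner_sum_right)
      moreover have "form (x *v evec k) (x *v lift (base_point \<iota>) z) = 0"
        unfolding SO_form[OF x] using k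
        by (auto simp: lift_base_point form_sum_right intro!: sum.neutral)
      ultimately have "(\<Sum>j\<in>UNIV. (x *v evec k) $ Inr j * (x *v lift (base_point \<iota>) z) $ Inr j) = 0"
        by (simp add: form_def inner_Plus)
      then show ?thesis
        by (simp add: mult_lift inner_vec_def r_def M_def)
    qed
    moreover obtain z where "r = M *v z"
      unfolding M_def by (rule aut_factor_surj[OF x base_point_stiefel[OF inj]])
    ultimately have "r \<bullet> r = 0" by metis
    then have "r = 0" by simp
    then have "(x *v evec k) $ Inr j = 0" for j
      by (simp add: r_def vec_eq_iff)
    then show ?thesis by (simp add: vec_eq_Plus)
  qed
  have "y *v theta z = theta (y *v z)" for z
    by (subst (1 2) basis_expansion[OF inj, of z])
       (simp add: linear_add[OF linear_theta] linear_sum[OF linear_theta] linear_cmul[OF linear_theta]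
          matrix_vector_right_distrib matrix_vector_mult_sum matrix_vector_mult_scaleR yp ym ye te)
  then have "y \<in> Lgrp" using ySO by (simp add: Lgrp_iff)
  then show ?thesis using L N[OF x Xn] by (simp add: y_def)
qed

lemma iwasawa_wplus_orthogonal:
  assumes x: "x \<in> SO_nm"
    and gram: "\<And>j l. (x *v wplus \<iota> j) \<bullet> (x *v wplus \<iota> l) = (if j = l then 2 else 0)"
  shows "Q x"
proof -
  note basis = basis_pairings[OF inj]
  \<comment> \<open>exp X adds \<open>c k j\<close> times \<open>x *v wplus \<iota> j\<close> to the
    image of \<open>evec k\<close>. These vectors are orthogonal of squared length 2, so the inner
    product changes by \<open>2 * c k j\<close>.\<close>
  define c where "c k j = - ((x *v evec k) \<bullet> (x *v wplus \<iota> j)) / 2" for k j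
  define X where "X = (\<Sum>k\<in>- range \<iota>. \<Sum>j\<in>UNIV. c k j *\<^sub>R wedge (wplus \<iota> j) (evec k))"
  have Xn: "X \<in> nfrak \<iota>"
    unfolding X_def by (intro nfrak_sum nfrak_scale nfrak_wedge(3)[OF inj]) auto
  have Xp: "X *v wplus \<iota> l = 0" for l
    by (auto simp: X_def sum_matrix_vector_mult wedge_mult basis simp flip: scaleR_matrix_vector_assoc
        intro!: sum.neutral)
  have Xe: "X *v evec l = (\<Sum>j\<in>UNIV. c l j *\<^sub>R wplus \<iota> j)" if "l \<notin> range \<iota>" for l
  proof -
    have "X *v evec l = (\<Sum>k\<in>- range \<iota>. (if k = l then \<Sum>j\<in>UNIV. c k j *\<^sub>R wplus \<iota> j else 0))"
      unfolding X_def sum_matrix_vector_mult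
    proof (rule sum.cong[OF refl])
      fix k assume "k \<in> - range \<iota>"
      show "(\<Sum>j\<in>UNIV. (c k j *\<^sub>R wedge (wplus \<iota> j) (evec k)) *v evec l)
          = (if k = l then \<Sum>j\<in>UNIV. c k j *\<^sub>R wplus \<iota> j else 0)"
      proof -
        have "(c k j *\<^sub>R wedge (wplus \<iota> j) (evec k)) *v evec l = (if k = l then c k j *\<^sub>R wplus \<iota> j else 0)" for j
          using that by (auto simp: wedge_mult axis_def[of "Inl k"] simp flip: scaleR_matrix_vector_assoc)
        then show ?thesis by simp
      qed
    qed
    then show ?thesis using that by simp
  qed
  have XX: "X *v (X *v evec l) = 0" if "l \<notin> range \<iota>" for l
    by (simp add: Xe[OF that] matrix_vector_mult_sum matrix_vector_mult_scaleR Xp)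
  define y where "y = x ** mexp X"
  have ySO: "y \<in> SO_nm"
    using x mexp_SO[OF nfrak_so[OF inj Xn]] by (simp add: y_def)
  have yp: "y *v wplus \<iota> l = x *v wplus \<iota> l" for l
    by (simp add: y_def mexp_square_zero Xp flip: matrix_vector_mul_assoc)
  have ye: "y *v evec l = x *v evec l + (\<Sum>j\<in>UNIV. c l j *\<^sub>R (x *v wplus \<iota> j))" if "l \<notin> range \<iota>" for l
    by (simp add: y_def mexp_square_zero[OF XX[OF that]] Xe[OF that] matrix_vector_right_distrib
        matrix_vector_mult_sum matrix_vector_mult_scaleR flip: matrix_vector_mul_assoc)
  have "Q y"
  proof (rule iwasawa_evec_orthogonal[OF ySO])
    fix k j assume k: "k \<notin> range \<iota>"
    show "(y *v evec k) \<bullet> (y *v wplus \<iota> j) = 0"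
      by (simp add: yp ye[OF k] inner_add_left inner_diff_left inner_sum_left gram c_def
          if_distrib[of "\<lambda>x. _ * x"] sum_negf cong: if_cong)
  qed (simp add: yp gram)
  then show ?thesis using N[OF x Xn] by (simp add: y_def)
qed

lemma iwasawa_gram_schmidt:
  assumes "x \<in> SO_nm"
    and "\<And>i j. i \<in> I \<Longrightarrow> i < j \<Longrightarrow> j \<in> I"
    and "\<And>j l. j \<in> I \<Longrightarrow> l \<in> I \<Longrightarrow> (x *v wplus \<iota> j) \<bullet> (x *v wplus \<iota> l) = (if j = l then 2 else 0)"
  shows "Q x"
  using assms
proof (induction "card (- I)" arbitrary: I x rule: less_induct)
  case less
  note x = less.prems(1) and up = less.prems(2) and gram = less.prems(3)
  note basis = basis_pairings[OF inj]
  show ?case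
  proof (cases "I = UNIV")
    case True
    then show ?thesis using iwasawa_wplus_orthogonal[OF x] gram by simp
  next
    case False
    \<comment> \<open>The largest index not yet treated is taken, so that every \<open>j\<close> in
      \<open>I\<close> exceeds it and \<open>E\<^sub>j\<^sup>* - E\<^sub>i\<^sup>*\<close> is a
      positive root.\<close>
    define i where "i = Max (- I)"
    have iI: "i \<notin> I" using Max_in[of "- I"] False by (auto simp: i_def)
    have gt: "j \<in> I" if "i < j" for j
    proof (rule ccontr)
      assume "j \<notin> I"
      then have "j \<le> i" unfolding i_def by (intro Max_ge) auto
      with that show False by simp
    qed
    have lt: "i < j" if "j \<in> I" for j
      using up[OF that, of i] iI that by (metis linorder_less_linear)
    \<comment> \<open>The pairing of \<open>wplus \<iota> i\<close> with
      \<open>wminus \<iota> i\<close> makes the coefficient enter as \<open>2 * c j\<close>, and the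
      treated vectors have squared length 2; hence the 4.\<close>
    define c where "c j = - ((x *v wplus \<iota> i) \<bullet> (x *v wplus \<iota> j)) / 4" for j
    define X where "X = (\<Sum>j\<in>I. c j *\<^sub>R wedge (wplus \<iota> j) (wminus \<iota> i))"
    have Xn: "X \<in> nfrak \<iota>"
      unfolding X_def by (intro nfrak_sum nfrak_scale nfrak_wedge(1)[OF inj] lt)
    have X0: "X *v wplus \<iota> l = 0" if "l \<noteq> i" for l
      using that by (simp add: X_def sum_matrix_vector_mult wedge_mult basis flip: scaleR_matrix_vector_assoc)
    have Xi: "X *v wplus \<iota> i = (\<Sum>j\<in>I. (2 * c j) *\<^sub>R wplus \<iota> j)"
      by (simp add: X_def sum_matrix_vector_mult wedge_mult basis mult.commute flip: scaleR_matrix_vector_assoc)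
    have XX: "X *v (X *v wplus \<iota> i) = 0"
      unfolding Xi matrix_vector_mult_sum matrix_vector_mult_scaleR
      by (rule sum.neutral) (use iI X0 in \<open>metis scaleR_zero_right\<close>)
    define y where "y = x ** mexp X"
    have ySO: "y \<in> SO_nm"
      using x mexp_SO[OF nfrak_so[OF inj Xn]] by (simp add: y_def)
    have y0: "y *v wplus \<iota> l = x *v wplus \<iota> l" if "l \<noteq> i" for l
      using X0[OF that] by (simp add: y_def mexp_square_zero flip: matrix_vector_mul_assoc)
    have yi: "y *v wplus \<iota> i = x *v wplus \<iota> i + (\<Sum>j\<in>I. (2 * c j) *\<^sub>R (x *v wplus \<iota> j))"
      by (simp add: y_def mexp_square_zero[OF XX] Xi matrix_vector_right_distrib
          matrix_vector_mult_sum matrix_vector_mult_scaleR flip: matrix_vector_mul_assoc)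
    have orth: "(y *v wplus \<iota> i) \<bullet> (y *v wplus \<iota> l) = 0" if l: "l \<in> I" for l
    proof -
      have li: "l \<noteq> i" using l iI by auto
      have "(\<Sum>j\<in>I. (2 * c j) * ((x *v wplus \<iota> j) \<bullet> (x *v wplus \<iota> l)))
          = (\<Sum>j\<in>I. if j = l then 4 * c j else 0)"
        by (rule sum.cong[OF refl]) (use gram l in auto)
      also have "\<dots> = 4 * c l" using l by simp
      finally show ?thesis
        by (simp add: y0[OF li] yi inner_add_left inner_sum_left c_def)
    qed
    define r where "r = norm (y *v wplus \<iota> i)"
    have "y *v wplus \<iota> i \<noteq> 0"
    proof
      assume "y *v wplus \<iota> i = 0"
      then have "wplus \<iota> i = 0" using SO_inv_mult_vec(1)[OF ySO, of "wplus \<iota> i"] by simp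
      then have "wplus \<iota> i $ Inr i = 0" by simp
      then show False by simp
    qed
    then have r: "r > 0" by (simp add: r_def)
    \<comment> \<open>The one-parameter subgroup of \<open>E\<^sub>i\<close> rescales only the i-th
      vector, here from norm \<open>r\<close> to norm \<open>sqrt 2\<close>.\<close>
    define t where "t l = (if l = i then ln (sqrt 2 / r) else 0)" for l
    define z where "z = y ** mexp (amat \<iota> t)"
    have zSO: "z \<in> SO_nm"
      using ySO mexp_SO[OF amat_so[OF inj]] by (simp add: z_def)
    have zp: "z *v wplus \<iota> l = (if l = i then sqrt 2 / r else 1) *\<^sub>R (y *v wplus \<iota> l)" for l
      using r by (simp add: z_def mexp_eigenvector[OF amat_basis(1)[OF inj]] matrix_vector_mult_scaleR t_def
          flip: matrix_vector_mul_assoc)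
    have "Q z"
    proof (rule less.hyps[OF _ zSO])
      show "card (- insert i I) < card (- I)"
        using iI by (intro psubset_card_mono) auto
      show "k \<in> insert i I" if "j \<in> insert i I" "j < k" for j k
        using that up gt by auto
      have ii: "(y *v wplus \<iota> i) \<bullet> (y *v wplus \<iota> i) = r * r"
        by (simp add: r_def dot_square_norm power2_eq_square)
      have zi: "(z *v wplus \<iota> i) \<bullet> (z *v wplus \<iota> i) = 2"
        using r by (simp add: zp ii)
      have zo: "(z *v wplus \<iota> i) \<bullet> (z *v wplus \<iota> l) = 0" if "l \<in> I" for l
        using orth[OF that] by (simp add: zp)
      have zo': "(z *v wplus \<iota> l) \<bullet> (z *v wplus \<iota> i) = 0" if "l \<in> I" for l
        by (subst inner_commute) (rule zo[OF that])
      show "(z *v wplus \<iota> j) \<bullet> (z *v wplus \<iota> l) = (if j = l then 2 else 0)"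
        if "j \<in> insert i I" "l \<in> insert i I" for j l
      proof (cases "j = i"; cases "l = i")
        assume "j \<noteq> i" "l \<noteq> i"
        then show ?thesis using that gram by (simp add: zp y0)
      qed (use that zi zo zo' in auto)
    qed
    then have "Q y" using A[OF ySO] by (simp add: z_def)
    then show ?thesis using N[OF x Xn] by (simp add: y_def)
  qed
qed

lemma iwasawa_induct: "x \<in> SO_nm \<Longrightarrow> Q x"
  by (rule iwasawa_gram_schmidt[of x "{}"]) auto

end

end

subsection \<open>Topology of the action\<close>

lemma continuous_on_vec_iff:
  "continuous_on S f \<longleftrightarrow> (\<forall>i. continuous_on S (\<lambda>x. f x $ i))"
proof
  assume "\<forall>i. continuous_on S (\<lambda>x. f x $ i)"
  then have "continuous_on S (\<lambda>x. \<chi> i. f x $ i)" by (intro continuous_on_vec_lambda) auto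
  then show "continuous_on S f" by simp
qed (auto intro: continuous_on_component)

lemma continuous_on_matrix_mult:
  fixes f :: "'a::topological_space \<Rightarrow> real^'k::finite^'l::finite"
  assumes "continuous_on S f" "continuous_on S g"
  shows "continuous_on S (\<lambda>x. f x ** g x)"
  unfolding matrix_matrix_mult_def by (intro continuous_intros assms)

lemma continuous_on_det:
  fixes f :: "'a::topological_space \<Rightarrow> real^'k::finite^'k"
  assumes "continuous_on S f"
  shows "continuous_on S (\<lambda>x. det (f x))"
  unfolding det_def by (intro continuous_intros assms)

text \<open>Cramer's rule for the j-th column of the inverse. It exhibits the entries as quotients
  of determinants, from which continuity of inversion follows.\<close>

lemma matrix_inv_cramer:
  fixes M :: "real^'k::finite^'k"
  assumes "invertible M"
  shows "matrix_inv M $ i $ j = det (\<chi> k l. if l = i then axis j 1 $ k else M $ k $ l) / det M"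
proof -
  have "M *v (matrix_inv M *v axis j 1) = axis j 1"
    by (simp add: matrix_vector_mul_assoc invertible_matrix_inv(2)[OF assms])
  then have "matrix_inv M *v axis j 1
      = (\<chi> i. det (\<chi> k l. if l = i then axis j 1 $ k else M $ k $ l) / det M)"
    using cramer[of M] assms by (simp add: invertible_det_nz)
  then have "(matrix_inv M *v axis j 1) $ i
      = det (\<chi> k l. if l = i then axis j 1 $ k else M $ k $ l) / det M"
    by simp
  then show ?thesis by (simp add: matrix_vector_mult_basis column_def)
qed

lemma continuous_on_matrix_inv:
  fixes f :: "'a::topological_space \<Rightarrow> real^'k::finite^'k"
  assumes "continuous_on S f" "\<And>x. x \<in> S \<Longrightarrow> invertible (f x)"
  shows "continuous_on S (\<lambda>x. matrix_inv (f x))"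
  unfolding continuous_on_vec_iff
proof (intro allI)
  fix i j
  have "continuous_on S (\<lambda>x. if l = i then axis j 1 $ k else f x $ k $ l)" for k l
    by (cases "l = i") (auto intro!: continuous_intros assms)
  then have "continuous_on S
      (\<lambda>x. det (\<chi> k l. if l = i then axis j 1 $ k else f x $ k $ l) / det (f x))"
    using assms by (intro continuous_on_divide continuous_on_det continuous_on_vec_lambda)
      (auto simp: invertible_det_nz)
  then show "continuous_on S (\<lambda>x. matrix_inv (f x) $ i $ j)"
    by (rule continuous_on_eq) (simp add: matrix_inv_cramer assms)
qed

lemma continuous_on_blocks:
  assumes "continuous_on S h"
  shows "continuous_on S (\<lambda>x. blockA (h x))" "continuous_on S (\<lambda>x. blockB (h x))"
    "continuous_on S (\<lambda>x. blockC (h x))" "continuous_on S (\<lambda>x. blockD (h x))"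
  unfolding blockA_def blockB_def blockC_def blockD_def by (intro continuous_intros assms)+

lemma continuous_on_aut_factor:
  assumes "continuous_on S h" "continuous_on S v"
  shows "continuous_on S (\<lambda>x. aut_factor (h x) (v x))"
  unfolding aut_factor_def
  by (intro continuous_on_add continuous_on_matrix_mult continuous_on_blocks assms)

lemma continuous_on_act:
  assumes "continuous_on S h" "continuous_on S v"
    and "\<And>x. x \<in> S \<Longrightarrow> h x \<in> SO_nm" "\<And>x. x \<in> S \<Longrightarrow> v x \<in> stiefel"
  shows "continuous_on S (\<lambda>x. act (h x) (v x))"
  unfolding act_def aut_factor_def[symmetric]
  by (intro continuous_on_add continuous_on_matrix_mult continuous_on_blocks
      continuous_on_matrix_inv continuous_on_aut_factor aut_factor_invertible assms)

lemma continuous_on_Jac_pow: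
  assumes "continuous_on S h" "continuous_on S v"
    and "\<And>x. x \<in> S \<Longrightarrow> h x \<in> SO_nm" "\<And>x. x \<in> S \<Longrightarrow> v x \<in> stiefel"
  shows "continuous_on S (\<lambda>x. Jac_pow (h x) (v x) s)"
  unfolding Jac_pow_def aut_factor_def[symmetric]
  using aut_factor_invertible assms
  by (intro continuous_on_powr continuous_on_rabs continuous_on_det continuous_on_aut_factor
      continuous_on_const) (auto simp: invertible_det_nz)

lemma continuous_on_left_mult: "continuous_on S (\<lambda>x. (h :: real^'k::finite^'l::finite) ** (x :: real^'j::finite^'k))"
  by (intro continuous_on_matrix_mult continuous_on_const continuous_on_id)

text \<open>L is cut out by continuous equations and consists of orthogonal matrices. Compactness
  makes the orbit map from L closed and lets convergence on Y be tested on L.\<close>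

lemma compact_Lgrp: "compact (Lgrp :: (real^('n::finite + 'm::finite)^('n + 'm)) set)"
proof -
  have "Lgrp = {h :: real^('n + 'm)^('n + 'm). det h = 1 \<and> (\<forall>u v. form (h *v u) (h *v v) = form u v)
      \<and> blockB h = 0 \<and> blockC h = 0}"
    by (auto simp: Lgrp_def SO_nm_def)
  moreover have "closed \<dots>"
    by (intro closed_Collect_conj closed_Collect_all closed_Collect_eq continuous_on_det
        continuous_on_blocks continuous_on_id continuous_on_const)
       (auto simp: form_def matrix_vector_mult_def intro!: continuous_intros)
  moreover have "bounded (Lgrp :: (real^('n + 'm)^('n + 'm)) set)"
    unfolding bounded_iff
  proof (intro exI ballI)
    fix h :: "real^('n + 'm)^('n + 'm)" assume h: "h \<in> Lgrp"
    have "\<bar>h $ p $ q\<bar> \<le> 1" for p q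
    proof -
      have "h $ p $ q = (h *v axis q 1) $ p"
        by (simp add: matrix_vector_mult_basis column_def)
      also have "\<bar>\<dots>\<bar> \<le> norm (h *v axis q 1)"
        by (rule component_le_norm_cart)
      also have "\<dots> = norm (axis q 1 :: real^('n + 'm))"
        by (simp add: norm_eq_sqrt_inner Lgrp_inner[OF h])
      finally show ?thesis by simp
    qed
    then have "norm (h $ p) \<le> (\<Sum>q\<in>(UNIV :: ('n + 'm) set). 1)" for p
      by (intro order_trans[OF norm_le_l1_cart] sum_mono)
    then have "(\<Sum>p\<in>UNIV. norm (h $ p)) \<le> (\<Sum>p\<in>(UNIV :: ('n + 'm) set). \<Sum>q\<in>(UNIV :: ('n + 'm) set). 1)"
      by (intro sum_mono)
    moreover have "norm h \<le> (\<Sum>p\<in>UNIV. norm (h $ p))"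
      unfolding norm_vec_def by (rule L2_set_le_sum) simp
    ultimately show "norm h \<le> (\<Sum>p\<in>(UNIV :: ('n + 'm) set). \<Sum>q\<in>(UNIV :: ('n + 'm) set). 1)"
      by linarith
  qed
  ultimately show ?thesis by (simp add: compact_eq_bounded_closed)
qed

subsection \<open>The orbit of the base point\<close>

lemma stiefel_norm:
  assumes "v \<in> stiefel"
  shows "(v *v y) \<bullet> (v *v z) = y \<bullet> z"
  using assms by (simp add: stiefel_iff_form form_lift)

lemma stiefel_complement_dim:
  fixes v :: "real^'m::finite^'n::finite"
  assumes "v \<in> stiefel"
  shows "subspace {x. \<forall>y. (v *v y) \<bullet> x = 0}" "dim {x. \<forall>y. (v *v y) \<bullet> x = 0} + CARD('m) = CARD('n)"
proof -
  show "subspace {x. \<forall>y. (v *v y) \<bullet> x = 0}"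
    by (rule subspaceI) (auto simp: inner_add_right)
  have "inj ((*v) v)"
  proof (rule injI)
    fix y z assume "v *v y = v *v z"
    then have "(v *v (y - z)) \<bullet> (v *v (y - z)) = 0" by (simp add: matrix_vector_mult_diff_distrib)
    then show "y = z" by (simp add: stiefel_norm[OF assms])
  qed
  then have "dim (range ((*v) v)) = CARD('m)"
    using dim_image_eq[of "(*v) v" UNIV] by simp
  moreover have "dim {x \<in> (UNIV :: (real^'n) set). \<forall>y\<in>range ((*v) v). orthogonal y x} + dim (range ((*v) v))
      = dim (UNIV :: (real^'n) set)"
    by (rule dim_subspace_orthogonal_to_vectors)
       (auto intro: linear_subspace_image)
  ultimately show "dim {x. \<forall>y. (v *v y) \<bullet> x = 0} + CARD('m) = CARD('n)"
    by (simp add: orthogonal_def)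
qed

text \<open>The images of \<open>v\<close> and \<open>w\<close> have orthogonal complements of the
  same dimension. An isometry between these, combined with \<open>v *v y\<close> going to
  \<open>w *v y\<close>, gives \<open>A\<close>.\<close>

lemma orthogonal_extension_frame:
  fixes v w :: "real^'m::finite^'n::finite"
  assumes "v \<in> stiefel" "w \<in> stiefel"
  obtains A :: "real^'n^'n" where "\<And>x y. (A *v x) \<bullet> (A *v y) = x \<bullet> y" "\<And>y. A *v (v *v y) = w *v y"
proof -
  let ?S = "{x. \<forall>y. (v *v y) \<bullet> x = 0}" and ?T = "{x. \<forall>y. (w *v y) \<bullet> x = 0}"
  have "dim ?S = dim ?T"
    using stiefel_complement_dim(2)[OF assms(1)] stiefel_complement_dim(2)[OF assms(2)] by linarith
  obtain f where f: "linear f" "f ` ?S = ?T" "\<And>x. x \<in> ?S \<Longrightarrow> norm (f x) = norm x"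
    by (rule isometries_subspaces[OF stiefel_complement_dim(1)[OF assms(1)]
          stiefel_complement_dim(1)[OF assms(2)] \<open>dim ?S = dim ?T\<close>]) (rule that)
  define p where "p x = transpose v *v x" for x
  define q where "q x = x - v *v p x" for x
  have pv: "p (v *v y) = y" for y
    using assms(1) by (simp add: p_def stiefel_def matrix_vector_mul_assoc del: transpose_matrix_vector)
  have q: "q x \<in> ?S" for x
  proof -
    have "(v *v y) \<bullet> (v *v p x) = (v *v y) \<bullet> x" for y
      by (simp only: stiefel_norm[OF assms(1)]) (simp only: p_def inner_transpose)
    then show ?thesis by (simp add: q_def inner_diff_right)
  qed
  define F where "F x = w *v p x + f (q x)" for x
  have lp: "linear p" unfolding p_def by (rule matrix_vector_mul_linear)
  have lq: "linear q"
    unfolding q_def by (intro linear_compose_sub linear_id linear_compose[OF lp matrix_vector_mul_linear, unfolded o_def])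
       (auto intro: linear_ident)
  have lF: "linear F"
    unfolding F_def
    by (intro linear_compose_add linear_compose[OF lp matrix_vector_mul_linear, unfolded o_def]
        linear_compose[OF lq f(1), unfolded o_def])
  have nF: "norm (F x) = norm x" for x
  proof -
    have fq: "(w *v p x) \<bullet> f (q x) = 0" using f(2) q[of x] by blast
    have "F x \<bullet> F x = p x \<bullet> p x + f (q x) \<bullet> f (q x)"
      by (simp add: F_def inner_add_left inner_add_right stiefel_norm[OF assms(2)] fq inner_commute[of "f (q x)" "w *v p x"])
    also have "f (q x) \<bullet> f (q x) = q x \<bullet> q x"
      using f(3)[OF q] by (simp add: dot_square_norm)
    also have "p x \<bullet> p x + q x \<bullet> q x = (v *v p x + q x) \<bullet> (v *v p x + q x)"
      using q[of x] by (simp add: inner_add_left inner_add_right stiefel_norm[OF assms(1)] inner_commute[of "q x" "v *v p x"])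
    also have "\<dots> = x \<bullet> x" by (simp add: q_def)
    finally show ?thesis by (simp add: norm_eq_sqrt_inner)
  qed
  have "orthogonal_transformation F"
    using lF nF by (simp add: orthogonal_transformation)
  moreover have m: "matrix F *v x = F x" for x
    using fun_cong[OF matrix_vector_mul(2)[OF lF]] .
  moreover have "F (v *v y) = w *v y" for y
    by (simp add: F_def q_def pv linear_0[OF f(1)])
  ultimately show thesis
    by (intro that[of "matrix F"]) (auto simp: orthogonal_transformation_def)
qed

lemma det_reflection:
  "det (matrix (\<lambda>y. y - 2 *\<^sub>R (y $ k) *\<^sub>R axis k 1) :: real^'k::finite^'k) = -1"
proof -
  define R where "R = (matrix (\<lambda>y. y - 2 *\<^sub>R (y $ k) *\<^sub>R axis k 1) :: real^'k^'k)"
  have e: "R $ i $ j = (if i = j then if i = k then -1 else 1 else 0)" for i j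
    by (auto simp: R_def matrix_def axis_def)
  have "det R = (\<Prod>i\<in>UNIV. R $ i $ i)"
    by (rule det_diagonal) (simp add: e)
  also have "\<dots> = (\<Prod>i\<in>UNIV. if i = k then -1 else 1)"
    by (rule prod.cong) (simp_all add: e)
  also have "\<dots> = -1" by simp
  finally show ?thesis by (simp only: R_def)
qed

text \<open>The block matrix diag(A, I) with \<open>A\<close> from
  \<open>orthogonal_extension_frame\<close> moves the base point to \<open>v\<close> and preserves
  the form. If its determinant is -1, it is composed with the reflection in an \<open>evec k\<close>
  outside the range of \<iota>, which exists as m < n and fixes the plane of the base point.\<close>

lemma Yhom_eq_stiefel:
  fixes \<iota> :: "'m::finite \<Rightarrow> 'n::finite"
  assumes inj: "inj \<iota>" and less: "CARD('m) < CARD('n)"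
  shows "Yhom \<iota> = stiefel"
proof
  show "Yhom \<iota> \<subseteq> stiefel"
    by (auto simp: Yhom_def act_stiefel base_point_stiefel[OF inj])
  show "stiefel \<subseteq> Yhom \<iota>"
  proof
    fix v :: "real^'m^'n" assume v: "v \<in> stiefel"
    obtain A :: "real^'n^'n" where A: "\<And>x y. (A *v x) \<bullet> (A *v y) = x \<bullet> y"
      "\<And>y. A *v (base_point \<iota> *v y) = v *v y"
      using orthogonal_extension_frame[OF base_point_stiefel[OF inj] v] by blast
    define top where "top y = (\<chi> i. y $ Inl i)" for y :: "real^('n + 'm)"
    define hf where "hf y = (\<chi> p. case p of Inl i \<Rightarrow> (A *v top y) $ i | Inr j \<Rightarrow> y $ Inr j)" for y :: "real^('n + 'm)"
    have hf_nth: "hf y $ Inl i = (A *v top y) $ i" "hf y $ Inr j = y $ Inr j" for y i j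
      by (simp_all add: hf_def)
    have top: "top (x + y) = top x + top y" "top (c *\<^sub>R x) = c *\<^sub>R top x" for x y c
      by (simp_all add: top_def vec_eq_iff)
    have "linear hf"
      by (rule linearI) (simp_all add: vec_eq_Plus hf_nth top matrix_vector_right_distrib matrix_vector_mult_scaleR)
    then have h: "matrix hf *v y = hf y" for y
      using fun_cong[OF matrix_vector_mul(2)] by blast
    have form_top: "form x y = top x \<bullet> top y - (\<Sum>j\<in>UNIV. x $ Inr j * y $ Inr j)" for x y :: "real^('n + 'm)"
      by (simp add: form_def inner_vec_def top_def)
    have "top (hf y) = A *v top y" for y
      by (simp add: top_def vec_eq_iff hf_nth)
    then have hform: "form (matrix hf *v x) (matrix hf *v y) = form x y" for x y
      by (simp add: h form_top A hf_nth)
    have "top (lift (base_point \<iota>) y) = base_point \<iota> *v y" for y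
      by (simp add: top_def vec_eq_iff)
    then have hlift: "matrix hf *v lift (base_point \<iota>) y = lift v y" for y
      by (simp add: h vec_eq_Plus hf_nth A)
    obtain g where g: "g \<in> SO_nm" "\<And>y. g *v lift (base_point \<iota>) y = lift v y"
    proof (cases "det (matrix hf) = 1")
      case True
      then show thesis using that[of "matrix hf"] hform hlift by (simp add: SO_nm_def)
    next
      case False
      then have det: "det (matrix hf) = -1" using det_form_preserving[OF hform] by (simp add: abs_if split: if_splits)
      obtain k where k: "k \<notin> range \<iota>"
      proof -
        have "range \<iota> \<noteq> UNIV" using less card_image[OF inj] by auto
        then show thesis using that by blast
      qed
      define rf where "rf y = y - 2 *\<^sub>R (y $ Inl k) *\<^sub>R evec k" for y :: "real^('n + 'm)"
      have "linear rf"
        by (rule linearI) (simp_all add: rf_def algebra_simps)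
      then have r: "matrix rf *v y = rf y" for y
        using fun_cong[OF matrix_vector_mul(2)] by blast
      have "form (rf x) (rf y) = form x y" for x y
        by (simp add: rf_def)
      then have "form ((matrix hf ** matrix rf) *v x) ((matrix hf ** matrix rf) *v y) = form x y" for x y
        by (simp add: hform r flip: matrix_vector_mul_assoc)
      moreover have "det (matrix rf) = -1"
        unfolding rf_def[abs_def] by (rule det_reflection)
      then have "det (matrix hf ** matrix rf) = 1" by (simp add: det_mul det)
      moreover have "rf (lift (base_point \<iota>) y) = lift (base_point \<iota>) y" for y
      proof -
        have "lift (base_point \<iota>) y $ Inl k = 0"
          using k by (auto simp: base_point_def matrix_vector_mult_def intro!: sum.neutral)
        then show ?thesis by (simp add: rf_def del: lift_nth)
      qed
      then have "(matrix hf ** matrix rf) *v lift (base_point \<iota>) y = lift v y" for y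
        by (simp add: r hlift flip: matrix_vector_mul_assoc)
      ultimately show thesis using that[of "matrix hf ** matrix rf"] by (simp add: SO_nm_def)
    qed
    have "act g (base_point \<iota>) = v"
      by (rule lift_act_eqI(1)[OF g(1) base_point_stiefel[OF inj], where a = "mat 1"]) (simp add: g(2))
    then show "v \<in> Yhom \<iota>" using g(1) by (auto simp: Yhom_def)
  qed
qed

subsection \<open>The representations\<close>

text \<open>The exponent is a parameter: it is \<beta> in the theorem, and 0 where only the
  restriction to L is of interest.\<close>

definition ext_Y :: "('m::finite \<Rightarrow> 'n::finite) \<Rightarrow> real \<Rightarrow> (real^'m^'n \<Rightarrow> complex)
    \<Rightarrow> (real^('n + 'm)^('n + 'm) \<Rightarrow> complex)" where
  "ext_Y \<iota> s f = (\<lambda>x. if x \<in> SO_nm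
     then of_real (Jac_pow x (base_point \<iota>) s) * f (act x (base_point \<iota>)) else 0)"

lemma cfun_subspace: "is_subspace (cfun S)"
  by (auto simp: is_subspace_def cfun_def intro!: continuous_intros)

lemma left_translate_linear: "is_linear_on V (left_translate h)"
  by (simp add: is_linear_on_def left_translate_def)

lemma left_translate_mult:
  "g \<in> SO_nm \<Longrightarrow> h \<in> SO_nm \<Longrightarrow> left_translate (g ** h) F = left_translate g (left_translate h F)"
  by (simp add: left_translate_def SO_matrix_inv_mult matrix_mul_assoc)

lemma left_translate_one: "left_translate (mat 1) F = F"
  by (simp add: left_translate_def)

lemma rho_add: "rho \<iota> (S + T) = rho \<iota> S + rho \<iota> T"
proof -
  have add: "\<alpha> (S + T) = \<alpha> S + \<alpha> T" if "\<alpha> \<in> pos_roots \<iota>" for \<alpha>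
    using that by (auto simp: pos_roots_def Edual_def)
  then have "(\<Sum>\<alpha>\<in>pos_roots \<iota>. real (dim (root_space \<iota> \<alpha>)) * \<alpha> (S + T))
      = (\<Sum>\<alpha>\<in>pos_roots \<iota>. real (dim (root_space \<iota> \<alpha>)) * \<alpha> S + real (dim (root_space \<iota> \<alpha>)) * \<alpha> T)"
    by (intro sum.cong refl) (simp only: add distrib_left)
  then show ?thesis by (simp add: rho_def sum.distrib distrib_left)
qed

lemma ext_Y_linear: "is_linear_on V (ext_Y \<iota> s)"
  by (auto simp: is_linear_on_def ext_Y_def fun_eq_iff algebra_simps)

context
  fixes \<iota> :: "'m::finite \<Rightarrow> 'n::finite"
  assumes inj: "inj \<iota>"
begin

lemma Yhom_stiefel: "\<eta> \<in> Yhom \<iota> \<Longrightarrow> \<eta> \<in> stiefel"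
  by (auto simp: Yhom_def act_stiefel base_point_stiefel[OF inj])

lemma act_base_point_Yhom: "h \<in> SO_nm \<Longrightarrow> act h (base_point \<iota>) \<in> Yhom \<iota>"
  by (auto simp: Yhom_def)

lemma act_Yhom:
  assumes "h \<in> SO_nm" "\<eta> \<in> Yhom \<iota>"
  shows "act h \<eta> \<in> Yhom \<iota>"
proof -
  obtain g where g: "g \<in> SO_nm" "\<eta> = act g (base_point \<iota>)" using assms by (auto simp: Yhom_def)
  then have "act h \<eta> = act (h ** g) (base_point \<iota>)"
    using assms by (simp add: act_mult base_point_stiefel[OF inj])
  with assms g show ?thesis by (simp add: act_base_point_Yhom)
qed

lemma tau_cfun:
  assumes h: "h \<in> SO_nm" and f: "f \<in> cfun (Yhom \<iota>)"
  shows "tau (Yhom \<iota>) h f \<in> cfun (Yhom \<iota>)"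
proof -
  let ?s = "(real CARD('n) - 2) / (real CARD('n) + real CARD('m))"
  have cf: "continuous_on (Yhom \<iota>) f" using f by (simp add: cfun_def)
  have ca: "continuous_on (Yhom \<iota>) (act (matrix_inv h))"
    using h Yhom_stiefel by (intro continuous_on_act continuous_on_const continuous_on_id) auto
  have "continuous_on (Yhom \<iota>) (\<lambda>\<eta>. complex_of_real (Jac_pow (matrix_inv h) \<eta> ?s) * f (act (matrix_inv h) \<eta>))"
    using h Yhom_stiefel
    by (intro continuous_on_mult continuous_on_of_real continuous_on_Jac_pow continuous_on_const
        continuous_on_id continuous_on_compose2[OF cf ca]) (auto simp: act_Yhom)
  then have "continuous_on (Yhom \<iota>) (tau (Yhom \<iota>) h f)"
    by (rule continuous_on_eq) (simp add: tau_def)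
  then show ?thesis by (simp add: cfun_def tau_def)
qed

lemma tau_rep: "is_rep SO_nm (cfun (Yhom \<iota>)) (tau (Yhom \<iota>))"
  unfolding is_rep_def
proof (intro conjI ballI cfun_subspace)
  fix g :: "real^('n + 'm)^('n + 'm)" assume g: "g \<in> SO_nm"
  show "is_linear_on (cfun (Yhom \<iota>)) (tau (Yhom \<iota>) g)"
    by (auto simp: is_linear_on_def tau_def fun_eq_iff algebra_simps)
  fix f assume f: "f \<in> cfun (Yhom \<iota>)"
  then show "tau (Yhom \<iota>) g f \<in> cfun (Yhom \<iota>)" by (rule tau_cfun[OF g])
next
  fix f assume "f \<in> cfun (Yhom \<iota>)"
  then show "tau (Yhom \<iota>) (mat 1) f = f"
    by (auto simp: tau_def fun_eq_iff cfun_def Yhom_stiefel)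
next
  fix g h :: "real^('n + 'm)^('n + 'm)" and f assume "g \<in> SO_nm" "h \<in> SO_nm"
  then show "tau (Yhom \<iota>) (g ** h) f = tau (Yhom \<iota>) g (tau (Yhom \<iota>) h f)"
    by (auto simp: tau_def fun_eq_iff SO_matrix_inv_mult act_mult Jac_pow_mult Yhom_stiefel act_Yhom)
qed

lemma ext_Y_Lgrp: "l \<in> Lgrp \<Longrightarrow> ext_Y \<iota> s f l = pull_L \<iota> f l"
  by (simp add: ext_Y_def pull_L_def Lgrp_SO Lgrp_Jac_pow base_point_stiefel[OF inj])

lemma ext_Y_cfun:
  assumes f: "f \<in> cfun (Yhom \<iota>)"
  shows "ext_Y \<iota> s f \<in> cfun SO_nm"
proof -
  have cf: "continuous_on (Yhom \<iota>) f" using f by (simp add: cfun_def)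
  have ca: "continuous_on SO_nm (\<lambda>x. act x (base_point \<iota>))"
    by (intro continuous_on_act continuous_on_const continuous_on_id base_point_stiefel[OF inj])
  have "continuous_on SO_nm (\<lambda>x. complex_of_real (Jac_pow x (base_point \<iota>) s) * f (act x (base_point \<iota>)))"
    by (intro continuous_on_mult continuous_on_of_real continuous_on_Jac_pow continuous_on_const
        continuous_on_id continuous_on_compose2[OF cf ca] base_point_stiefel[OF inj])
       (auto simp: act_base_point_Yhom)
  then have "continuous_on SO_nm (ext_Y \<iota> s f)"
    by (rule continuous_on_eq) (simp add: ext_Y_def)
  then show ?thesis by (simp add: cfun_def ext_Y_def)
qed

lemma ext_Y_tau:
  assumes "h \<in> SO_nm"
  shows "ext_Y \<iota> ((real CARD('n) - 2) / (real CARD('n) + real CARD('m))) (tau (Yhom \<iota>) h f)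
    = left_translate h (ext_Y \<iota> ((real CARD('n) - 2) / (real CARD('n) + real CARD('m))) f)"
  using assms
  by (auto simp: ext_Y_def tau_def left_translate_def fun_eq_iff SO_mult_iff act_base_point_Yhom
      act_mult Jac_pow_mult base_point_stiefel[OF inj])

lemma ext_Y_right_inv: "right_inv_on Lgrp (Lgrp \<inter> M0grp \<iota>) (ext_Y \<iota> s f)"
  unfolding right_inv_on_def
proof (intro ballI)
  fix l k :: "real^('n + 'm)^('n + 'm)" assume l: "l \<in> Lgrp" and k: "k \<in> Lgrp \<inter> M0grp \<iota>"
  then have "k \<in> Lgrp" "act k (base_point \<iota>) = base_point \<iota>"
    using Lgrp_M0_iff[OF inj] by auto
  then show "ext_Y \<iota> s f (l ** k) = ext_Y \<iota> s f l"
    using l by (simp add: ext_Y_Lgrp Lgrp_mult pull_L_def act_mult Lgrp_SO base_point_stiefel[OF inj])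
qed

lemma pull_L_L_space:
  assumes f: "f \<in> cfun (Yhom \<iota>)"
  shows "pull_L \<iota> f \<in> L_space \<iota>"
proof -
  have "continuous_on Lgrp (ext_Y \<iota> 0 f)"
    using ext_Y_cfun[OF f, of 0] Lgrp_SO by (auto simp: cfun_def intro: continuous_on_subset)
  then have "continuous_on Lgrp (pull_L \<iota> f)"
    by (rule continuous_on_eq) (rule ext_Y_Lgrp)
  moreover have "right_inv_on Lgrp (Lgrp \<inter> M0grp \<iota>) (pull_L \<iota> f)"
    using ext_Y_right_inv[of 0 f] ext_Y_Lgrp[of _ 0 f]
    by (auto simp: right_inv_on_def Lgrp_mult)
  ultimately show ?thesis by (simp add: L_space_def cfun_def pull_L_def)
qed

end

lemma ind_space_rep:
  "is_rep SO_nm (ind_space \<iota> lam) left_translate"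
  unfolding is_rep_def
proof (intro conjI ballI left_translate_linear left_translate_one left_translate_mult)
  show "is_subspace (ind_space \<iota> lam)"
    using cfun_subspace[of SO_nm]
    by (auto simp: is_subspace_def ind_space_def algebra_simps)
next
  fix h :: "real^('a + 'b)^('a + 'b)" and F assume h: "h \<in> SO_nm" and F: "F \<in> ind_space \<iota> lam"
  have "continuous_on SO_nm (\<lambda>x. F (matrix_inv h ** x))"
    using F h by (intro continuous_on_compose2[OF _ continuous_on_left_mult, of SO_nm F])
      (auto simp: ind_space_def cfun_def SO_mult_iff)
  then show "left_translate h F \<in> ind_space \<iota> lam"
    using F h by (auto simp: ind_space_def cfun_def left_translate_def SO_mult_iff matrix_mul_assoc)
qed auto

context
  fixes \<iota> :: "'m::{finite,linorder} \<Rightarrow> 'n::finite"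
  assumes inj: "inj \<iota>"
begin

text \<open>Iwasawa induction on the claim itself: the exponentials from A and N fix the base point,
  so passing from \<open>x\<close> to its product with one of them leaves the orbit point
  unchanged.\<close>

lemma Lgrp_orbit:
  assumes "x \<in> SO_nm"
  shows "\<exists>l\<in>Lgrp. act l (base_point \<iota>) = act x (base_point \<iota>)"
proof (rule iwasawa_induct[OF inj _ _ _ assms])
  fix x X assume "x \<in> SO_nm" "X \<in> nfrak \<iota>"
    and "\<exists>l\<in>Lgrp. act l (base_point \<iota>) = act (x ** mexp X) (base_point \<iota>)"
  then show "\<exists>l\<in>Lgrp. act l (base_point \<iota>) = act x (base_point \<iota>)"
    by (simp add: act_mult mexp_SO nfrak_so[OF inj] mexp_nfrak[OF inj] base_point_stiefel[OF inj])
next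
  fix x t assume "x \<in> SO_nm"
    and "\<exists>l\<in>Lgrp. act l (base_point \<iota>) = act (x ** mexp (amat \<iota> t)) (base_point \<iota>)"
  then show "\<exists>l\<in>Lgrp. act l (base_point \<iota>) = act x (base_point \<iota>)"
    by (simp add: act_mult mexp_SO amat_so[OF inj] mexp_amat[OF inj] base_point_stiefel[OF inj])
qed auto

lemma Yhom_Lgrp: "\<eta> \<in> Yhom \<iota> \<Longrightarrow> \<exists>l\<in>Lgrp. act l (base_point \<iota>) = \<eta>"
  using Lgrp_orbit by (auto simp: Yhom_def)

lemma pull_L_inj: "inj_on (pull_L \<iota>) (cfun (Yhom \<iota>))"
proof (rule inj_onI)
  fix f g assume fg: "f \<in> cfun (Yhom \<iota>)" "g \<in> cfun (Yhom \<iota>)" "pull_L \<iota> f = pull_L \<iota> g"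
  show "f = g"
  proof
    fix \<eta>
    show "f \<eta> = g \<eta>"
    proof (cases "\<eta> \<in> Yhom \<iota>")
      case True
      then obtain l where "l \<in> Lgrp" "\<eta> = act l (base_point \<iota>)" using Yhom_Lgrp by blast
      then show ?thesis using fun_cong[OF fg(3), of l] by (simp add: pull_L_def)
    next
      case False
      then show ?thesis using fg by (simp add: cfun_def)
    qed
  qed
qed

text \<open>An invariant \<phi> descends to the orbit because L \<inter> M_0 is the stabilizer. The
  descended function is continuous because the orbit map from the compact L is closed.\<close>

lemma pull_L_surj:
  assumes \<phi>: "\<phi> \<in> L_space \<iota>"
  shows "\<exists>f\<in>cfun (Yhom \<iota>). pull_L \<iota> f = \<phi>"
proof -
  note bs = base_point_stiefel[OF inj]
  let ?q = "\<lambda>l. act l (base_point \<iota>)"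
  have c\<phi>: "continuous_on Lgrp \<phi>" and z: "\<And>x. x \<notin> Lgrp \<Longrightarrow> \<phi> x = 0"
    and ri: "\<And>l k. l \<in> Lgrp \<Longrightarrow> k \<in> Lgrp \<inter> M0grp \<iota> \<Longrightarrow> \<phi> (l ** k) = \<phi> l"
    using \<phi> by (auto simp: L_space_def cfun_def right_inv_on_def)
  have wd: "\<phi> k = \<phi> l" if kl: "k \<in> Lgrp" "l \<in> Lgrp" "?q k = ?q l" for k l
  proof -
    have "matrix_inv l ** k \<in> Lgrp" by (intro Lgrp_mult Lgrp_inv kl)
    moreover have "?q (matrix_inv l ** k) = base_point \<iota>"
      using kl by (simp add: act_mult Lgrp_SO bs act_inv)
    ultimately have "matrix_inv l ** k \<in> Lgrp \<inter> M0grp \<iota>"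
      using Lgrp_M0_iff[OF inj] by blast
    from ri[OF kl(2) this] show ?thesis
      using kl by (simp add: matrix_mul_assoc Lgrp_SO)
  qed
  define f where "f \<eta> = (if \<eta> \<in> Yhom \<iota> then \<phi> (SOME l. l \<in> Lgrp \<and> ?q l = \<eta>) else 0)" for \<eta>
  have f: "f (?q l) = \<phi> l" if l: "l \<in> Lgrp" for l
  proof -
    define k where "k = (SOME k. k \<in> Lgrp \<and> ?q k = ?q l)"
    have k: "k \<in> Lgrp \<and> ?q k = ?q l"
      unfolding k_def by (rule someI[of _ l]) (simp add: l)
    have "f (?q l) = \<phi> k"
      by (simp add: f_def k_def act_base_point_Yhom[OF inj] Lgrp_SO[OF l])
    also have "\<phi> k = \<phi> l" using k l by (intro wd) auto
    finally show ?thesis .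
  qed
  have Y: "Yhom \<iota> = ?q ` Lgrp"
    using Yhom_Lgrp by (force simp: act_base_point_Yhom[OF inj] Lgrp_SO)
  have cq: "continuous_on S ?q" if "S \<subseteq> Lgrp" for S
    using that by (intro continuous_on_act continuous_on_const continuous_on_id bs) (auto intro: Lgrp_SO)
  have "closed (Yhom \<iota>)"
    unfolding Y by (intro compact_imp_closed compact_continuous_image cq compact_Lgrp order_refl)
  \<comment> \<open>The preimage of a closed set under \<open>f\<close> is the image of a compact
    subset of L under the orbit map.\<close>
  have "continuous_on (Yhom \<iota>) f"
    unfolding continuous_on_closed_vimage[OF \<open>closed (Yhom \<iota>)\<close>]
  proof (intro allI impI)
    fix B :: "complex set" assume "closed B"
    have cl: "closed (\<phi> -` B \<inter> Lgrp)"
      using c\<phi> \<open>closed B\<close> continuous_on_closed_vimage[OF compact_imp_closed[OF compact_Lgrp]] by blast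
    then have "compact (\<phi> -` B \<inter> Lgrp)"
      using compact_Int_closed[OF compact_Lgrp cl] by (simp add: Int_commute Int_left_commute)
    then have "compact (?q ` (\<phi> -` B \<inter> Lgrp))"
      by (intro compact_continuous_image cq) auto
    moreover have "f -` B \<inter> Yhom \<iota> = ?q ` (\<phi> -` B \<inter> Lgrp)"
      unfolding Y using f by auto
    ultimately show "closed (f -` B \<inter> Yhom \<iota>)" by (simp add: compact_imp_closed)
  qed
  then have "f \<in> cfun (Yhom \<iota>)" by (simp add: cfun_def f_def)
  moreover have "pull_L \<iota> f = \<phi>"
    by (auto simp: fun_eq_iff pull_L_def f z)
  ultimately show ?thesis by blast
qed

lemma pull_L_bij: "bij_betw (pull_L \<iota>) (cfun (Yhom \<iota>)) (L_space \<iota>)"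
  unfolding bij_betw_def
  using pull_L_inj pull_L_surj pull_L_L_space[OF inj] by blast

text \<open>From Y to H, a compact set has compact image in Y and the Jacobian factor is bounded on
  it. From H to Y, convergence on the single compact set L suffices: there the factor is 1, and L
  maps onto Y.\<close>

lemma ext_Y_uniform_limit:
  fixes fs :: "nat \<Rightarrow> ((real, 'm) vec, 'n) vec \<Rightarrow> complex"
  shows "(\<forall>K. compact K \<and> K \<subseteq> Yhom \<iota> \<longrightarrow> uniform_limit K fs f sequentially) \<longleftrightarrow>
    (\<forall>K. compact K \<and> K \<subseteq> SO_nm \<longrightarrow> uniform_limit K (\<lambda>k. ext_Y \<iota> s (fs k)) (ext_Y \<iota> s f) sequentially)"
proof (intro iffI allI impI)
  note bs = base_point_stiefel[OF inj]
  fix K :: "(real^('n + 'm)^('n + 'm)) set"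
  assume lim: "\<forall>K. compact K \<and> K \<subseteq> Yhom \<iota> \<longrightarrow> uniform_limit K fs f sequentially"
    and K: "compact K \<and> K \<subseteq> SO_nm"
  let ?q = "\<lambda>x. act x (base_point \<iota>)" and ?J = "\<lambda>x. Jac_pow x (base_point \<iota>) s"
  have "compact (?q ` K)"
    using K by (intro compact_continuous_image continuous_on_act continuous_on_const continuous_on_id bs) auto
  moreover have "?q ` K \<subseteq> Yhom \<iota>"
    using K by (auto simp: act_base_point_Yhom[OF inj])
  ultimately have u: "uniform_limit (?q ` K) fs f sequentially"
    using lim by blast
  have "compact (?J ` K)"
    using K by (intro compact_continuous_image continuous_on_Jac_pow continuous_on_const continuous_on_id bs) auto
  then obtain B where B: "B > 0" "\<And>x. x \<in> K \<Longrightarrow> \<bar>?J x\<bar> \<le> B"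
    using compact_imp_bounded[of "?J ` K"] unfolding bounded_pos by auto
  show "uniform_limit K (\<lambda>k. ext_Y \<iota> s (fs k)) (ext_Y \<iota> s f) sequentially"
    unfolding uniform_limit_iff
  proof (intro allI impI)
    fix e :: real assume "e > 0"
    then have "e / B > 0" using B by simp
    then have "\<forall>\<^sub>F n in sequentially. \<forall>y\<in>?q ` K. dist (fs n y) (f y) < e / B"
      using u unfolding uniform_limit_iff by blast
    then show "\<forall>\<^sub>F n in sequentially. \<forall>x\<in>K. dist (ext_Y \<iota> s (fs n) x) (ext_Y \<iota> s f x) < e"
    proof eventually_elim
      case (elim n)
      show ?case
      proof
        fix x assume x: "x \<in> K"
        then have xS: "x \<in> SO_nm" using K by auto
        have "dist (ext_Y \<iota> s (fs n) x) (ext_Y \<iota> s f x) = \<bar>?J x\<bar> * dist (fs n (?q x)) (f (?q x))"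
          using xS by (simp add: ext_Y_def dist_norm norm_mult flip: right_diff_distrib)
        also have "\<dots> \<le> B * dist (fs n (?q x)) (f (?q x))"
          using B(2)[OF x] by (intro mult_right_mono) auto
        also have "\<dots> < B * (e / B)"
          using elim x B(1) by (intro mult_strict_left_mono) auto
        finally show "dist (ext_Y \<iota> s (fs n) x) (ext_Y \<iota> s f x) < e" using B(1) by simp
      qed
    qed
  qed
next
  fix K :: "((real, 'm) vec, 'n) vec set"
  assume lim: "\<forall>K. compact K \<and> K \<subseteq> SO_nm \<longrightarrow> uniform_limit K (\<lambda>k. ext_Y \<iota> s (fs k)) (ext_Y \<iota> s f) sequentially"
    and K: "compact K \<and> K \<subseteq> Yhom \<iota>"
  have u: "uniform_limit Lgrp (\<lambda>k. ext_Y \<iota> s (fs k)) (ext_Y \<iota> s f) sequentially"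
    using lim compact_Lgrp Lgrp_SO by blast
  show "uniform_limit K fs f sequentially"
    unfolding uniform_limit_iff
  proof (intro allI impI)
    fix e :: real assume "e > 0"
    then have "\<forall>\<^sub>F n in sequentially. \<forall>l\<in>Lgrp. dist (ext_Y \<iota> s (fs n) l) (ext_Y \<iota> s f l) < e"
      using u unfolding uniform_limit_iff by blast
    then show "\<forall>\<^sub>F n in sequentially. \<forall>y\<in>K. dist (fs n y) (f y) < e"
    proof eventually_elim
      case (elim n)
      show ?case
      proof
        fix y assume "y \<in> K"
        then obtain l where l: "l \<in> Lgrp" "y = act l (base_point \<iota>)" using K Yhom_Lgrp by blast
        then show "dist (fs n y) (f y) < e"
          using bspec[OF elim l(1)] by (simp add: ext_Y_Lgrp[OF inj] pull_L_def)
      qed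
    qed
  qed
qed

end

section \<open>Extended functions as the invariant members of the induced space\<close>

context
  fixes \<iota> :: "'m::{finite,linorder} \<Rightarrow> 'n::finite"
    and lam :: "real ^ ('n + 'm) ^ ('n + 'm) \<Rightarrow> complex"
    and s :: real
  assumes inj: "inj \<iota>"
    and char: "\<And>t. exp (- (\<i> * lam (amat \<iota> t) + of_real (rho \<iota> (amat \<iota> t))))
      = of_real (exp (- s * (real CARD('n) + real CARD('m)) * (\<Sum>j\<in>UNIV. t j)))"
begin

text \<open>\<open>char\<close> equates the character of A with the power of \<bar>det j\<bar> in
  \<open>Jac_pow\<close>. The factors from M and N contribute 1, and all three groups fix the base
  point.\<close>

lemma ext_Y_ind_space:
  assumes f: "f \<in> cfun (Yhom \<iota>)"
  shows "ext_Y \<iota> s f \<in> ind_space \<iota> lam"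
  unfolding ind_space_def mem_Collect_eq
proof (intro conjI ballI ext_Y_cfun[OF inj f])
  fix x k T u :: "((real, 'n + 'm) vec, 'n + 'm) vec"
  assume x: "x \<in> SO_nm" and k: "k \<in> Mgrp \<iota>" and T: "T \<in> afrak \<iota>" and u: "u \<in> Ngrp \<iota>"
  obtain t where t: "T = amat \<iota> t" using T by (auto simp: afrak_eq)
  obtain X where X: "u = mexp X" "X \<in> nfrak \<iota>" using u by (auto simp: Ngrp_def)
  note bs = base_point_stiefel[OF inj]
  have kS: "k \<in> SO_nm" and kf: "act k (base_point \<iota>) = base_point \<iota>" and kJ: "Jac_pow k (base_point \<iota>) s = 1"
    using Mgrp_fixes[OF inj k] by (simp_all add: Lgrp_SO Lgrp_Jac_pow bs)
  have aS: "mexp T \<in> SO_nm" and af: "act (mexp T) (base_point \<iota>) = base_point \<iota>"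
    and aJ: "of_real (Jac_pow (mexp T) (base_point \<iota>) s) = exp (- (\<i> * lam T + of_real (rho \<iota> T)))"
    unfolding char t
    by (simp_all add: mexp_SO amat_so[OF inj] mexp_amat[OF inj] Jac_pow_def exp_powr_real mult_ac
        flip: aut_factor_def)
  have uS: "u \<in> SO_nm" and uf: "act u (base_point \<iota>) = base_point \<iota>" and uJ: "Jac_pow u (base_point \<iota>) s = 1"
    using mexp_nfrak[OF inj X(2)] mexp_SO[OF nfrak_so[OF inj X(2)]]
    by (simp_all add: X(1) Jac_pow_def flip: aut_factor_def)
  have "ext_Y \<iota> s f (x ** k ** mexp T ** u)
      = of_real (Jac_pow (mexp T) (base_point \<iota>) s) * ext_Y \<iota> s f x"
    using x by (simp add: ext_Y_def act_mult Jac_pow_mult kS kf kJ aS af uS uf uJ bs mult_ac)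
  then show "ext_Y \<iota> s f (x ** k ** mexp T ** u) = exp (- (\<i> * lam T + of_real (rho \<iota> T))) * ext_Y \<iota> s f x"
    by (simp only: aJ)
qed

text \<open>The remaining factors of MAN are set equal to 1, which brings the covariance into the
  form that \<open>iwasawa_induct\<close> takes.\<close>

lemma ind_space_right_mult:
  assumes F: "F \<in> ind_space \<iota> lam" and x: "x \<in> SO_nm"
  shows "X \<in> nfrak \<iota> \<Longrightarrow> F (x ** mexp X) = F x"
    and "F (x ** mexp (amat \<iota> t)) = exp (- (\<i> * lam (amat \<iota> t) + of_real (rho \<iota> (amat \<iota> t)))) * F x"
proof -
  have cov: "F (x ** k ** mexp T ** u) = exp (- (\<i> * lam T + of_real (rho \<iota> T))) * F x"
    if "k \<in> Mgrp \<iota>" "T \<in> afrak \<iota>" "u \<in> Ngrp \<iota>" for k T u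
    using F x that by (auto simp: ind_space_def)
  have 1: "mat 1 \<in> Mgrp \<iota>" by (simp add: Mgrp_def Lgrp_one)
  have u1: "mat 1 \<in> Ngrp \<iota>"
    unfolding Ngrp_def nfrak_def by (rule image_eqI[of _ _ 0]) (simp_all add: mexp_0 span_zero)
  have a: "amat \<iota> t \<in> afrak \<iota>" for t by (simp add: afrak_eq)
  have 0: "amat \<iota> (\<lambda>_. 0) = 0" by (simp add: amat_def)
  show "F (x ** mexp X) = F x" if "X \<in> nfrak \<iota>"
  proof -
    have "F (x ** mat 1 ** mexp (amat \<iota> (\<lambda>_. 0)) ** mexp X)
        = exp (- (\<i> * lam (amat \<iota> (\<lambda>_. 0)) + of_real (rho \<iota> (amat \<iota> (\<lambda>_. 0))))) * F x"
      by (rule cov[OF 1 a]) (use that in \<open>auto simp: Ngrp_def\<close>)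
    then show ?thesis unfolding char by (simp add: 0 mexp_0)
  qed
  show "F (x ** mexp (amat \<iota> t)) = exp (- (\<i> * lam (amat \<iota> t) + of_real (rho \<iota> (amat \<iota> t)))) * F x"
    using cov[OF 1 a u1] by simp
qed

lemma ind_space_eqI:
  assumes F: "F \<in> ind_space \<iota> lam" and G: "G \<in> ind_space \<iota> lam"
    and eq: "\<And>l. l \<in> Lgrp \<Longrightarrow> F l = G l"
  shows "F = G"
proof
  fix x
  show "F x = G x"
  proof (cases "x \<in> SO_nm")
    case True
    show ?thesis
      by (rule iwasawa_induct[OF inj eq _ _ True])
         (simp_all add: ind_space_right_mult[OF F] ind_space_right_mult[OF G])
  next
    case False
    then show ?thesis using F G by (simp add: ind_space_def cfun_def)
  qed
qed

text \<open>For surjectivity, the restriction of a member F to L descends to a function on Y, and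
  the extension of that function agrees with F on L, hence everywhere by
  \<open>ind_space_eqI\<close>.\<close>

lemma ext_Y_bij: "bij_betw (ext_Y \<iota> s) (cfun (Yhom \<iota>)) (ind_space_Y \<iota> lam)"
  unfolding bij_betw_def
proof
  show "inj_on (ext_Y \<iota> s) (cfun (Yhom \<iota>))"
  proof (rule inj_onI)
    fix f g assume fg: "f \<in> cfun (Yhom \<iota>)" "g \<in> cfun (Yhom \<iota>)" "ext_Y \<iota> s f = ext_Y \<iota> s g"
    have "pull_L \<iota> f l = pull_L \<iota> g l" for l
      using ext_Y_Lgrp[OF inj, of l s f] ext_Y_Lgrp[OF inj, of l s g] fg(3)
      by (cases "l \<in> Lgrp") (simp_all add: pull_L_def)
    then show "f = g" using fg inj_onD[OF pull_L_inj[OF inj]] by blast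
  qed
  show "ext_Y \<iota> s ` cfun (Yhom \<iota>) = ind_space_Y \<iota> lam"
  proof (intro equalityI subsetI)
    fix F assume "F \<in> ext_Y \<iota> s ` cfun (Yhom \<iota>)"
    then show "F \<in> ind_space_Y \<iota> lam"
      by (auto simp: ind_space_Y_def ext_Y_ind_space ext_Y_right_inv[OF inj])
  next
    fix F assume "F \<in> ind_space_Y \<iota> lam"
    then have F: "F \<in> ind_space \<iota> lam" "right_inv_on Lgrp (Lgrp \<inter> M0grp \<iota>) F"
      by (auto simp: ind_space_Y_def)
    define \<phi> where "\<phi> l = (if l \<in> Lgrp then F l else 0)" for l
    have "continuous_on Lgrp F"
      using F(1) by (auto simp: ind_space_def cfun_def intro: continuous_on_subset Lgrp_SO)
    then have "continuous_on Lgrp \<phi>" by (rule continuous_on_eq) (simp add: \<phi>_def)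
    then have "\<phi> \<in> L_space \<iota>"
      using F(2) by (auto simp: L_space_def cfun_def \<phi>_def right_inv_on_def Lgrp_mult)
    then obtain f where f: "f \<in> cfun (Yhom \<iota>)" "pull_L \<iota> f = \<phi>" using pull_L_surj[OF inj] by blast
    have "F = ext_Y \<iota> s f"
      by (rule ind_space_eqI[OF F(1) ext_Y_ind_space[OF f(1)]]) (simp add: ext_Y_Lgrp[OF inj] f(2) \<phi>_def)
    then show "F \<in> ext_Y \<iota> s ` cfun (Yhom \<iota>)" using f(1) by blast
  qed
qed

end

theorem lemma14:
  fixes \<iota> :: "'m::{finite,linorder} \<Rightarrow> 'n::finite"
    and lam :: "real ^ ('n + 'm) ^ ('n + 'm) \<Rightarrow> complex"
  assumes "inj \<iota>"
    and "CARD('n) \<ge> 2"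
    and "is_functional_on (afrak \<iota>) lam"
    and "\<forall>T\<in>afrak0 \<iota>. - (\<i> * lam T + of_real (rho \<iota> T))
           = - of_real (2 * (real CARD('n) - 2) / (real CARD('n) - 1) * rho0 \<iota> T)"
    and "\<forall>T\<in>afrak0_perp \<iota>. - (\<i> * lam T + of_real (rho \<iota> T)) = 0"
  shows "(CARD('m) < CARD('n) \<longrightarrow> Yhom \<iota> = stiefel)
    \<and> is_rep SO_nm (cfun (Yhom \<iota>)) (tau (Yhom \<iota>))
    \<and> is_rep SO_nm (ind_space \<iota> lam) left_translate
    \<and> is_rep SO_nm (ind_space_Y \<iota> lam) left_translate
    \<and> bij_betw (pull_L \<iota>) (cfun (Yhom \<iota>)) (L_space \<iota>)
    \<and> (\<exists>ext. (\<forall>\<phi>\<in>L_space \<iota>. ext \<phi> \<in> ind_space \<iota> lam \<and> (\<forall>l\<in>Lgrp. ext \<phi> l = \<phi> l))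
           \<and> is_equivalence SO_nm (Yhom \<iota>) (cfun (Yhom \<iota>)) (tau (Yhom \<iota>))
                SO_nm (ind_space_Y \<iota> lam) left_translate (\<lambda>f. ext (pull_L \<iota> f)))"
proof -
  note inj = assms(1)
  define s where "s = (real CARD('n) - 2) / (real CARD('n) + real CARD('m))"
  have s: "s * (real CARD('n) + real CARD('m)) = real CARD('n) - 2"
    using assms(2) by (simp add: s_def)
  have char: "exp (- (\<i> * lam (amat \<iota> t) + of_real (rho \<iota> (amat \<iota> t))))
      = of_real (exp (- s * (real CARD('n) + real CARD('m)) * (\<Sum>j\<in>UNIV. t j)))" for t
  proof -
    \<comment> \<open>\<open>a\<close> is the mean of the \<open>t j\<close>; \<open>?S\<close> and
      \<open>?T\<close> are the components in \<open>afrak0 \<iota>\<close> and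
      \<open>afrak0_perp \<iota>\<close>, where the two conditions on \<open>lam\<close>
      apply.\<close>
    define a where "a = (\<Sum>j\<in>UNIV. t j) / real CARD('m)"
    let ?S = "amat \<iota> (\<lambda>_. a)" and ?T = "amat \<iota> (\<lambda>j. t j - a)"
    have sum: "amat \<iota> t = ?S + ?T" by (simp add: amat_add)
    have "lam (?S + ?T) = lam ?S + lam ?T"
      using assms(3) by (simp add: is_functional_on_def afrak_eq)
    then have "- (\<i> * lam (amat \<iota> t) + of_real (rho \<iota> (amat \<iota> t)))
        = - (\<i> * lam ?S + of_real (rho \<iota> ?S)) + - (\<i> * lam ?T + of_real (rho \<iota> ?T))"
      by (simp add: sum rho_add algebra_simps)
    also have "- (\<i> * lam ?T + of_real (rho \<iota> ?T)) = 0"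
    proof -
      have "?T \<in> afrak0_perp \<iota>"
        unfolding afrak0_perp_eq by (auto intro!: exI[of _ "\<lambda>j. t j - a"] simp: sum_subtractf a_def)
      with assms(5) show ?thesis by blast
    qed
    also have "- (\<i> * lam ?S + of_real (rho \<iota> ?S))
        = - of_real (2 * (real CARD('n) - 2) / (real CARD('n) - 1) * rho0 \<iota> ?S)"
      using assms(4) by (auto simp: afrak0_eq)
    \<comment> \<open>Here n-1 is nonzero and cancels against \<open>rho0_scalar\<close>, and m
      times the mean is the sum of the \<open>t j\<close>.\<close>
    also have "2 * (real CARD('n) - 2) / (real CARD('n) - 1) * rho0 \<iota> ?S
        = (real CARD('n) - 2) * (\<Sum>j\<in>UNIV. t j)"
      using assms(2) by (simp add: rho0_scalar[OF inj] a_def)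
    finally have e: "- (\<i> * lam (amat \<iota> t) + of_real (rho \<iota> (amat \<iota> t)))
        = of_real (- ((real CARD('n) - 2) * (\<Sum>j\<in>UNIV. t j)))"
      by simp
    have "- s * (real CARD('n) + real CARD('m)) * (\<Sum>j\<in>UNIV. t j)
        = - ((real CARD('n) - 2) * (\<Sum>j\<in>UNIV. t j))"
      by (simp only: s mult_minus_left)
    then show ?thesis by (simp only: e exp_of_real)
  qed
  \<comment> \<open>To extend a function from L, it is first brought back to Y through the inverse
    of \<open>pull_L\<close>, then extended by the Jacobian factor.\<close>
  define ext where "ext \<phi> = ext_Y \<iota> s (inv_into (cfun (Yhom \<iota>)) (pull_L \<iota>) \<phi>)" for \<phi>
  note bij = pull_L_bij[OF inj]
  have ext: "ext (pull_L \<iota> f) = ext_Y \<iota> s f" if "f \<in> cfun (Yhom \<iota>)" for f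
    using that bij by (simp add: ext_def bij_betw_def)
  have tau: "ext_Y \<iota> s (tau (Yhom \<iota>) h f) = left_translate h (ext_Y \<iota> s f)" if "h \<in> SO_nm" for h f
    unfolding s_def by (rule ext_Y_tau[OF inj that])
  have ext_ind: "ext \<phi> \<in> ind_space \<iota> lam \<and> (\<forall>l\<in>Lgrp. ext \<phi> l = \<phi> l)" if \<phi>: "\<phi> \<in> L_space \<iota>" for \<phi>
  proof -
    obtain f where f: "f \<in> cfun (Yhom \<iota>)" "\<phi> = pull_L \<iota> f"
      using bij_betw_imp_surj_on[OF bij] \<phi> by blast
    show ?thesis
      using ext_Y_ind_space[OF inj char f(1)] by (simp add: f ext ext_Y_Lgrp[OF inj])
  qed
  have bijY: "bij_betw (ext_Y \<iota> s) (cfun (Yhom \<iota>)) (ind_space_Y \<iota> lam)"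
    by (rule ext_Y_bij[OF inj char])
  have lin: "is_linear_on (cfun (Yhom \<iota>)) (\<lambda>f. ext (pull_L \<iota> f))"
    using ext_Y_linear[where V = "cfun (Yhom \<iota>)" and s = s] cfun_subspace[of "Yhom \<iota>"]
    by (simp add: is_linear_on_def is_subspace_def ext)
  have "is_equivalence SO_nm (Yhom \<iota>) (cfun (Yhom \<iota>)) (tau (Yhom \<iota>))
      SO_nm (ind_space_Y \<iota> lam) left_translate (\<lambda>f. ext (pull_L \<iota> f))"
    unfolding is_equivalence_def
  proof (intro conjI lin ballI allI impI)
    show "bij_betw (\<lambda>f. ext (pull_L \<iota> f)) (cfun (Yhom \<iota>)) (ind_space_Y \<iota> lam)"
      using bijY by (subst bij_betw_cong[OF ext])
    show "ext (pull_L \<iota> (tau (Yhom \<iota>) g f)) = left_translate g (ext (pull_L \<iota> f))"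
      if "g \<in> SO_nm" "f \<in> cfun (Yhom \<iota>)" for g f
      using that by (simp add: ext tau_cfun[OF inj] tau)
    show "(\<forall>K. compact K \<and> K \<subseteq> Yhom \<iota> \<longrightarrow> uniform_limit K fs f sequentially) \<longleftrightarrow>
       (\<forall>K. compact K \<and> K \<subseteq> SO_nm \<longrightarrow> uniform_limit K (\<lambda>k. ext (pull_L \<iota> (fs k))) (ext (pull_L \<iota> f)) sequentially)"
      if "(\<forall>k. fs k \<in> cfun (Yhom \<iota>)) \<and> f \<in> cfun (Yhom \<iota>)" for fs f
      using that ext_Y_uniform_limit[OF inj, of fs f s] by (simp add: ext)
  qed
  moreover have "is_rep SO_nm (ind_space_Y \<iota> lam) left_translate"
    unfolding is_rep_def
  proof (intro conjI ballI left_translate_linear left_translate_one left_translate_mult)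
    show "is_subspace (ind_space_Y \<iota> lam)"
      using ind_space_rep[of \<iota> lam]
      by (auto simp: is_rep_def is_subspace_def ind_space_Y_def right_inv_on_def)
    \<comment> \<open>Translation by an element outside L does not visibly respect a condition on
      the restriction to L. Invariance is therefore transported from \<open>tau\<close> through the
      bijection \<open>bijY\<close>.\<close>
    fix h :: "real^('n + 'm)^('n + 'm)" and F assume h: "h \<in> SO_nm" and F: "F \<in> ind_space_Y \<iota> lam"
    then obtain f where f: "f \<in> cfun (Yhom \<iota>)" "F = ext_Y \<iota> s f"
      using bijY by (auto simp: bij_betw_def)
    then have "left_translate h F = ext_Y \<iota> s (tau (Yhom \<iota>) h f)" by (simp add: tau[OF h])
    then show "left_translate h F \<in> ind_space_Y \<iota> lam"
      using bij_betwE[OF bijY] tau_cfun[OF inj h f(1)] by simp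
  qed auto
  ultimately show ?thesis
    using Yhom_eq_stiefel[OF inj] tau_rep[OF inj] ind_space_rep[of \<iota> lam] bij ext_ind by blast
qed

end
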